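(* Let $Q=(u,u-r)$ where $u,r$ are integers with $u>r\ge 2$. Then: (i) The set $\mathfrak Q^{-1}(Q)$ has cardinality $|\mathfrak Q^{-1}(Q)|=(r-1)(u-r)$. (ii) The set $\mathfrak Q^{-1}(Q)$ may be arranged as an $(r-1)\times(u-r)$ array $\mathcal T(Q)$ of partitions $P_{k,\ell}=P_{k,\ell}(Q)$, where $1\le k\le r-1$ and $1\le \ell\le u-r$, such that the number of parts of $P_{k,\ell}$ is $k+\ell$.
   Context: Fix an infinite field $\mathsf k$. A partition $P=(p_1,\dots,p_s)$ of $n$ is a sequence of integers $p_1\ge\dots\ge p_s>0$ with $\sum p_i=n$; it has $s$ parts. $J_P$ denotes the $n\times n$ nilpotent Jordan matrix over $\mathsf k$ whose Jordan blocks have sizes the parts of $P$. The Jordan type of a nilpotent matrix is the partition giving the sizes of its Jordan blocks. For $B=J_P$ let $\mathcal C_B=\{A\in \mathrm{Mat}_n(\mathsf k): AB=BA\}$ and let $\mathcal N_B\subset\mathcal C_B$ be the (irreducible) subvariety of nilpotent elements. $\mathfrak Q(P)$ denotes the Jordan type of a generic element of $\mathcal N_B$, i.e. the common Jordan type of all elements of some nonempty Zariski-open subset of $\mathcal N_B$. $\mathfrak Q^{-1}(Q)$ denotes the set of all partitions $P$ with $\mathfrak Q(P)=Q$. *)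

theory Defs
  imports
    "Jordan_Normal_Form.Jordan_Normal_Form"
    "HOL-Analysis.Abstract_Topology"
begin

text \<open>Partitions are weakly decreasing lists of positive integers; the number of parts
  of \<open>P\<close> is \<open>length P\<close> and the number partitioned is \<open>sum_list P\<close>.\<close>

definition is_partition :: "nat list \<Rightarrow> bool" where
  "is_partition P \<longleftrightarrow> sorted_wrt (\<ge>) P \<and> (\<forall>p\<in>set P. p > 0)"

definition J :: "nat list \<Rightarrow> 'a::{zero,one} mat" where
  "J P = jordan_matrix (map (\<lambda>p. (p, 0)) P)"

definition has_jordan_type :: "'a::semiring_1 mat \<Rightarrow> nat list \<Rightarrow> bool" where
  "has_jordan_type A P \<longleftrightarrow> is_partition P \<and> jordan_nf A (map (\<lambda>p. (p, 0)) P)"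

definition commutant :: "'a::semiring_1 mat \<Rightarrow> 'a mat set" where
  "commutant B = {A \<in> carrier_mat (dim_row B) (dim_row B). A * B = B * A}"

definition nilpotent_mat :: "'a::semiring_1 mat \<Rightarrow> bool" where
  "nilpotent_mat A \<longleftrightarrow> (\<exists>m. A ^\<^sub>m m = 0\<^sub>m (dim_row A) (dim_row A))"

definition nilpotent_commutant :: "'a::semiring_1 mat \<Rightarrow> 'a mat set" where
  "nilpotent_commutant B = {A \<in> commutant B. nilpotent_mat A}"

text \<open>Polynomials in the \<open>n\<^sup>2\<close> entries of an \<open>n \<times> n\<close> matrix, taken as functions
  (only their values on \<open>carrier_mat n n\<close> are ever used).\<close>

inductive_set poly_funs :: "nat \<Rightarrow> ('a::comm_ring_1 mat \<Rightarrow> 'a) set" for n :: nat where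
  const: "(\<lambda>A. c) \<in> poly_funs n"
| entry: "i < n \<Longrightarrow> j < n \<Longrightarrow> (\<lambda>A. A $$ (i, j)) \<in> poly_funs n"
| add: "f \<in> poly_funs n \<Longrightarrow> g \<in> poly_funs n \<Longrightarrow> (\<lambda>A. f A + g A) \<in> poly_funs n"
| mult: "f \<in> poly_funs n \<Longrightarrow> g \<in> poly_funs n \<Longrightarrow> (\<lambda>A. f A * g A) \<in> poly_funs n"

text \<open>The complement in \<open>carrier_mat n n\<close> of the common zero locus of \<open>F\<close>.\<close>

definition nonvanishing :: "nat \<Rightarrow> ('a::comm_ring_1 mat \<Rightarrow> 'a) set \<Rightarrow> 'a mat set" where
  "nonvanishing n F = {A \<in> carrier_mat n n. \<exists>f\<in>F. f A \<noteq> 0}"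

definition zariski :: "nat \<Rightarrow> 'a::field mat topology" where
  "zariski n = topology (\<lambda>U. \<exists>F\<subseteq>poly_funs n. U = nonvanishing n F)"

lemma istopology_zariski:
  "istopology (\<lambda>U :: 'a::field mat set. \<exists>F\<subseteq>poly_funs n. U = nonvanishing n F)"
  unfolding istopology_def
proof (intro conjI allI impI)
  fix S T :: "'a mat set"
  assume "\<exists>F\<subseteq>poly_funs n. S = nonvanishing n F" "\<exists>F\<subseteq>poly_funs n. T = nonvanishing n F"
  then obtain F G where F: "F \<subseteq> poly_funs n" "S = nonvanishing n F"
    and G: "G \<subseteq> poly_funs n" "T = nonvanishing n G" by blast
  let ?H = "(\<lambda>(f, g) A. f A * g A) ` (F \<times> G)"
  have "?H \<subseteq> poly_funs n" using F(1) G(1) by (auto intro: poly_funs.mult)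
  moreover have "S \<inter> T = nonvanishing n ?H"
    unfolding F G nonvanishing_def by auto
  ultimately show "\<exists>F\<subseteq>poly_funs n. S \<inter> T = nonvanishing n F" by blast
next
  fix K :: "'a mat set set"
  assume "\<forall>U\<in>K. \<exists>F\<subseteq>poly_funs n. U = nonvanishing n F"
  then obtain F where F: "\<And>U. U \<in> K \<Longrightarrow> F U \<subseteq> poly_funs n \<and> U = nonvanishing n (F U)"
    by metis
  have "\<Union>(F ` K) \<subseteq> poly_funs n" using F by blast
  moreover have "\<Union>K = nonvanishing n (\<Union>(F ` K))"
    using F unfolding nonvanishing_def by blast
  ultimately show "\<exists>F\<subseteq>poly_funs n. \<Union>K = nonvanishing n F" by blast
qed

lemma openin_zariski:
  "openin (zariski n) U \<longleftrightarrow> (\<exists>F\<subseteq>poly_funs n. U = nonvanishing n F)"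
  unfolding zariski_def by (simp add: topology_inverse' istopology_zariski)

definition generic_jordan_type :: "'a::field mat \<Rightarrow> nat list \<Rightarrow> bool" where
  "generic_jordan_type B Q \<longleftrightarrow>
    (\<exists>U. openin (subtopology (zariski (dim_row B)) (nilpotent_commutant B)) U \<and> U \<noteq> {} \<and>
      (\<forall>A\<in>U. has_jordan_type A Q))"

text \<open>The map \<open>P \<mapsto> Q(P)\<close>; the \<open>itself\<close> argument names the ground field. The definite
  description is meaningful over an infinite field, where the nilpotent commutant of
  \<open>J P\<close> is irreducible.\<close>

definition frakQ :: "'k::field itself \<Rightarrow> nat list \<Rightarrow> nat list" where
  "frakQ TYPE('k) P = (THE Q. generic_jordan_type (J P :: 'k mat) Q)"

definition frakQ_inv :: "'k::field itself \<Rightarrow> nat list \<Rightarrow> nat list set" where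
  "frakQ_inv k Q = {P. is_partition P \<and> frakQ k P = Q}"

end

theory Submission
  imports Defs "Jordan_Normal_Form.Jordan_Normal_Form_Existence"
begin

text \<open>Write \<open>B = J P\<close>. A nilpotent \<open>A\<close> commuting with \<open>B\<close> is conjugate, inside the commutant of \<open>B\<close>, to a matrix
  in a linear space of matrices which are strictly triangular for a partial order on the Jordan basis of \<open>B\<close>.
  Hence any two points of the nilpotent commutant lie on a rational curve inside it; over an infinite field
  nonempty open sets meet, and the generic Jordan type exists, is unique and has maximal rank in each power.
  The partial order bounds these ranks: if \<open>P\<close> has three parts differing pairwise by at least 2 the kernel is at least
  three-dimensional; if \<open>P\<close> is almost rectangular there is a single block; in the remaining case the generic
  type has two parts, the larger being the maximal length of a chain of basis vectors. The upper bound on that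
  length comes from disjoint incomparable pairs, the lower bound from explicit matrices over a polynomial ring.
  Partitions with prescribed size and maximal chain length are counted by induction. Decreasing one part in
  each of the two almost rectangular pieces lowers both parts of the generic type by 1 and preserves the
  number of parts; it is invertible except that it misses the partitions whose lower piece consists of
  ones, and of these there is exactly one with \<open>v + k\<close> parts for each \<open>1 \<le> k \<le> r - 1\<close>, where \<open>v = u - r\<close>.\<close>

subsection \<open>Strict triangularization of nilpotent matrices\<close>

text \<open>Everything about \<open>frakQ\<close> is extracted from ranks. The generic type is
  attained in the nilpotent commutant and dominates the rank of each power of each of its elements
  separately, so the number of parts and the largest part may be witnessed by different matrices;
  together with the size they determine a type with two parts. The ground field is only infinite: it
  may fail to be algebraically closed and may have positive characteristic. This shapes two
  constructions. Inverses along a curve are written as adjugate over determinant, and open sets are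
  compared through polynomials in one variable. A nonzero power cannot be read off by counting
  paths, as path counts may vanish in the field, so edges carry powers of an indeterminate. The
  largest part is the maximum of three competing lengths, hence the upper bound needs, in each
  region of the multiplicities, a different pairing of incomparable vectors that leaves over exactly
  one of these lengths. The cardinality is v times r - 1 because v inductive steps, starting from an
  empty set at v = 0, each add r - 1 partitions.\<close>

lemma mult_mat_entry:
  "A \<in> carrier_mat a b \<Longrightarrow> B \<in> carrier_mat b c \<Longrightarrow> i < a \<Longrightarrow> j < c \<Longrightarrow>
    (A * B) $$ (i,j) = (\<Sum>k<b. A $$ (i,k) * B $$ (k,j))"
  by (simp add: scalar_prod_def row_def col_def atLeast0LessThan)

lemma mat_mult_vec_entry:
  "A \<in> carrier_mat a b \<Longrightarrow> v \<in> carrier_vec b \<Longrightarrow> i < a \<Longrightarrow>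
    (A *\<^sub>v v) $ i = (\<Sum>k<b. A $$ (i,k) * v $ k)"
  by (simp add: scalar_prod_def row_def atLeast0LessThan)

lemma pow_mat_Suc_left:
  fixes A :: "'a::semiring_1 mat"
  assumes A: "A \<in> carrier_mat n n"
  shows "A ^\<^sub>m Suc k = A * A ^\<^sub>m k"
proof (induction k)
  case 0
  show ?case using A by simp
next
  case (Suc k)
  have "A ^\<^sub>m Suc (Suc k) = A * A ^\<^sub>m k * A" using Suc by simp
  also have "\<dots> = A * (A ^\<^sub>m k * A)" using A by (intro assoc_mult_mat) auto
  finally show ?case by simp
qed

lemma det_nz_inverse:
  fixes P :: "'a::field mat"
  assumes "P \<in> carrier_mat n n" "det P \<noteq> 0"
  obtains Q where "Q \<in> carrier_mat n n" "P * Q = 1\<^sub>m n" "Q * P = 1\<^sub>m n"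
  using det_non_zero_imp_unit[OF assms, of "()"]
  unfolding Units_def ring_mat_def by auto

lemma det_nz_iff_kernel:
  fixes P :: "'a::field mat"
  assumes "P \<in> carrier_mat n n"
  shows "det P \<noteq> 0 \<longleftrightarrow> (\<forall>v\<in>carrier_vec n. P *\<^sub>v v = 0\<^sub>v n \<longrightarrow> v = 0\<^sub>v n)"
  using det_0_iff_vec_prod_zero_field[OF assms] by blast

lemma det_pow_mat:
  fixes A :: "'a::comm_ring_1 mat"
  assumes "A \<in> carrier_mat n n"
  shows "det (A ^\<^sub>m k) = det A ^ k"
proof (induction k)
  case 0
  then show ?case using assms by simp
next
  case (Suc k)
  then show ?case using assms det_mult[of "A ^\<^sub>m k" n A] by simp
qed

lemma exists_basis_with_first_vector:
  fixes v :: "'a::field vec"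
  assumes v: "v \<in> carrier_vec n" "v \<noteq> 0\<^sub>v n"
  obtains P Q where "P \<in> carrier_mat n n" "Q \<in> carrier_mat n n" "P * Q = 1\<^sub>m n" "Q * P = 1\<^sub>m n"
    "col P 0 = v" "0 < n"
proof -
  obtain k where k: "k < n" "v $ k \<noteq> 0"
    using v by (metis carrier_vecD eq_vecI index_zero_vec(1) index_zero_vec(2))
  \<comment> \<open>The identity with column 0 replaced by \<open>v\<close> and, if \<open>k\<close>
    > 0, column \<open>k\<close> replaced by the unit vector e_0. As coordinate \<open>k\<close> of
    \<open>v\<close> is nonzero, row \<open>k\<close> of the kernel equation gives x_0 = 0, and then
    row 0 isolates x_k.\<close>
  define P where "P = mat n n (\<lambda>(i,j). if j = 0 then v $ i
    else if j = k then (if i = 0 then 1 else 0) else if i = j then 1 else 0)"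
  have P: "P \<in> carrier_mat n n" unfolding P_def by simp
  have "det P \<noteq> 0" unfolding det_nz_iff_kernel[OF P]
  proof (intro ballI impI)
    fix x assume x: "x \<in> carrier_vec n" "P *\<^sub>v x = 0\<^sub>v n"
    have eq: "(\<Sum>j<n. P $$ (i,j) * x $ j) = 0" if "i < n" for i
      using x that mat_mult_vec_entry[OF P x(1) that] by simp
    have row: "P $$ (i,0) * x $ 0 + (\<Sum>j\<in>{1..<n}. P $$ (i,j) * x $ j) = 0" if "i < n" for i
    proof -
      have "{..<n} = insert 0 {1..<n}" using k by auto
      with eq[OF that] show ?thesis by simp
    qed
    have "(\<Sum>j\<in>{1..<n}. P $$ (k,j) * x $ j) = 0"
      by (rule sum.neutral) (use k in \<open>auto simp: P_def\<close>)
    with row[OF k(1)] k have x0: "x $ 0 = 0" by (auto simp: P_def)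
    show "x = 0\<^sub>v n"
    proof (rule eq_vecI)
      fix i assume "i < dim_vec (0\<^sub>v n :: 'a vec)"
      hence i: "i < n" by simp
      show "x $ i = 0\<^sub>v n $ i"
      proof (cases "i = 0")
        case True
        then show ?thesis using x0 i by simp
      next
        case False
        define i' where "i' = (if i = k then 0 else i)"
        have i': "i' < n" using i k by (auto simp: i'_def)
        have "(\<Sum>j\<in>{1..<n}. P $$ (i',j) * x $ j) = (\<Sum>j\<in>{1..<n}. if j = i then x $ j else 0)"
          by (rule sum.cong) (use k i i' False in \<open>auto simp: P_def i'_def\<close>)
        also have "\<dots> = x $ i" using i False by simp
        finally show ?thesis using row[OF i'] x0 i by simp
      qed
    qed (use x in simp)
  qed
  from det_nz_inverse[OF P this] obtain Q where "Q \<in> carrier_mat n n" "P * Q = 1\<^sub>m n" "Q * P = 1\<^sub>m n"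
    by auto
  moreover have "col P 0 = v"
    by (rule eq_vecI) (use k v in \<open>auto simp: P_def\<close>)
  ultimately show thesis using that[OF P] k by simp
qed

text \<open>A kernel vector, which exists as det A = 0, becomes the first basis vector; the
  complementary diagonal block inherits nilpotency and is treated by induction. The only eigenvalue
  is 0, so the argument works over every field.\<close>

lemma nilpotent_similar_strict_upper:
  fixes A :: "'a::field mat"
  assumes "A \<in> carrier_mat n n" "A ^\<^sub>m m = 0\<^sub>m n n"
  shows "\<exists>U. U \<in> carrier_mat n n \<and> similar_mat A U \<and> (\<forall>j<n. \<forall>i<n. j \<le> i \<longrightarrow> U $$ (i,j) = 0)"
  using assms
proof (induction n arbitrary: A)
  case 0
  then show ?case by (intro exI[of _ A]) (auto intro: similar_mat_refl)
next
  case (Suc n)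
  note A = Suc.prems(1)
  have "det A ^ m = 0"
    using det_pow_mat[OF A, of m] Suc.prems(2) det_zero[of "Suc n"] by simp
  hence "det A = 0" by simp
  then obtain v where v: "v \<in> carrier_vec (Suc n)" "v \<noteq> 0\<^sub>v (Suc n)" "A *\<^sub>v v = 0\<^sub>v (Suc n)"
    using det_0_iff_vec_prod_zero_field[OF A] by auto
  from exists_basis_with_first_vector[OF v(1,2)] obtain P Q where
    P: "P \<in> carrier_mat (Suc n) (Suc n)" and Q: "Q \<in> carrier_mat (Suc n) (Suc n)"
    and PQ: "P * Q = 1\<^sub>m (Suc n)" "Q * P = 1\<^sub>m (Suc n)" and c: "col P 0 = v" by auto
  define B where "B = Q * A * P"
  have B: "B \<in> carrier_mat (Suc n) (Suc n)" using P Q A by (simp add: B_def)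
  have sim: "similar_mat A B"
    by (rule similar_mat_sym, rule similar_matI[of _ _ Q P "Suc n"])
       (use A B P Q PQ in \<open>auto simp: B_def\<close>)
  have "col B 0 = (Q * A) *\<^sub>v v"
    unfolding B_def using P Q A c by (subst col_mult2[of _ "Suc n" "Suc n" _ "Suc n"]) auto
  also have "\<dots> = Q *\<^sub>v (A *\<^sub>v v)" using Q A v by auto
  also have "\<dots> = 0\<^sub>v (Suc n)" using v Q by auto
  finally have col0: "B $$ (i,0) = 0" if "i < Suc n" for i
    using that B by (metis carrier_matD index_col index_zero_vec(1) zero_less_Suc)
  define C where "C = mat n n (\<lambda>(i,j). B $$ (Suc i, Suc j))"
  have C: "C \<in> carrier_mat n n" by (simp add: C_def)
  have Cij: "C $$ (i,j) = B $$ (Suc i, Suc j)" if "i < n" "j < n" for i j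
    using that by (simp add: C_def)
  define R where "R = mat 1 n (\<lambda>(i,j). B $$ (0, Suc j))"
  have R: "R \<in> carrier_mat 1 n" by (simp add: R_def)
  \<comment> \<open>The diagonal blocks of a power of a block triangular matrix are the powers of
    its diagonal blocks; this carries nilpotency over to \<open>C\<close>.\<close>
  have pow: "(\<forall>i<n. (B ^\<^sub>m k) $$ (Suc i, 0) = 0) \<and>
     (\<forall>i<n. \<forall>j<n. (B ^\<^sub>m k) $$ (Suc i, Suc j) = (C ^\<^sub>m k) $$ (i,j))" for k
  proof (induction k)
    case 0
    then show ?case using B C by auto
  next
    case (Suc k)
    have Bk: "B ^\<^sub>m k \<in> carrier_mat (Suc n) (Suc n)" using B by simp
    have Ck: "C ^\<^sub>m k \<in> carrier_mat n n" using C by simp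
    show ?case
      using Suc col0 unfolding pow_mat.simps(2)
      by (auto simp: mult_mat_entry[OF Bk B] mult_mat_entry[OF Ck C]
        lessThan_Suc_eq_insert_0 sum.reindex Cij simp del: sum.lessThan_Suc pow_mat.simps(1) index_mult_mat)
  qed
  have Bm: "B ^\<^sub>m m = 0\<^sub>m (Suc n) (Suc n)"
  proof -
    from similar_mat_sym[OF sim] obtain P' Q' where w: "similar_mat_wit B A P' Q'"
      unfolding similar_mat_def by auto
    from similar_mat_witD2[OF B w] have "P' \<in> carrier_mat (Suc n) (Suc n)" "Q' \<in> carrier_mat (Suc n) (Suc n)" by auto
    thus ?thesis using similar_mat_wit_pow_id[OF w, of m] Suc.prems(2) by simp
  qed
  have "C ^\<^sub>m m = 0\<^sub>m n n"
    by (rule eq_matI) (use pow[of m] Bm C in auto)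
  from Suc.IH[OF C this] obtain U where U: "U \<in> carrier_mat n n" "similar_mat C U"
    "\<And>i j. j < n \<Longrightarrow> i < n \<Longrightarrow> j \<le> i \<Longrightarrow> U $$ (i,j) = 0" by auto
  have B4: "B = four_block_mat (0\<^sub>m 1 1) R (0\<^sub>m n 1) C"
    by (rule eq_matI) (use B col0 in \<open>auto simp: C_def R_def\<close>)
  from similar_mat_four_block_0_ex[OF similar_mat_refl[of "0\<^sub>m 1 1 :: 'a mat" 1] U(2) R _ C]
  obtain B0 where B0: "B0 \<in> carrier_mat 1 n"
    "similar_mat B (four_block_mat (0\<^sub>m 1 1) B0 (0\<^sub>m n 1) U)"
    unfolding B4 by auto
  show ?case
  proof (intro exI conjI)
    show "four_block_mat (0\<^sub>m 1 1) B0 (0\<^sub>m n 1) U \<in> carrier_mat (Suc n) (Suc n)"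
      using four_block_carrier_mat[of "0\<^sub>m 1 1" 1 1 U n n] U by auto
    show "similar_mat A (four_block_mat (0\<^sub>m 1 1) B0 (0\<^sub>m n 1) U)"
      using similar_mat_trans[OF sim B0(2)] .
    show "\<forall>j<Suc n. \<forall>i<Suc n. j \<le> i \<longrightarrow> four_block_mat (0\<^sub>m 1 1) B0 (0\<^sub>m n 1) U $$ (i, j) = 0"
      using U B0 by (auto simp: less_Suc_eq_0_disj)
  qed
qed

subsection \<open>Jordan types\<close>

lemma dvd_prod_list_map:
  fixes f :: "'b \<Rightarrow> 'a::comm_monoid_mult"
  shows "x \<in> set xs \<Longrightarrow> f x dvd prod_list (map f xs)"
  by (induction xs) (auto intro: dvd_mult dvd_mult2)

text \<open>A strictly triangular matrix has characteristic polynomial x^n, and a Jordan block with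
  eigenvalue a contributes a factor x - a to it, so a = 0.\<close>

lemma nilpotent_jordan_nf:
  fixes A :: "'a::field mat"
  assumes "A \<in> carrier_mat n n" "A ^\<^sub>m m = 0\<^sub>m n n"
  shows "\<exists>ns. jordan_nf A (map (\<lambda>p. (p, 0)) ns)"
proof -
  obtain U where U: "U \<in> carrier_mat n n" "similar_mat A U"
    and U0: "\<And>i j. j < n \<Longrightarrow> i < n \<Longrightarrow> j \<le> i \<Longrightarrow> U $$ (i,j) = 0"
    using nilpotent_similar_strict_upper[OF assms] by blast
  have ut: "upper_triangular U" using U U0 by (intro upper_triangularI) auto
  define n_as where "n_as = triangular_to_jnf_vector U"
  have jnf: "jordan_nf U n_as" unfolding n_as_def by (rule triangular_to_jnf_vector[OF U(1) ut])
  have "diag_mat U = replicate n 0"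
    using U U0 by (auto simp: diag_mat_def intro!: nth_equalityI)
  hence cp: "char_poly U = [:0,1:] ^ n"
    using char_poly_upper_triangular[OF U(1) ut] by simp
  have "a = 0" if "(k,a) \<in> set n_as" for k a
  proof -
    from jnf that have "k \<noteq> 0" unfolding jordan_nf_def by force
    hence "poly ([:- a, 1:] ^ k) a = 0" by simp
    moreover have "[:- a, 1:] ^ k dvd (\<Prod>(k, a)\<leftarrow>n_as. [:- a, 1:] ^ k)"
      using dvd_prod_list_map[OF that, of "\<lambda>(k, a). [:- a, 1:] ^ k"] by simp
    ultimately have "poly (\<Prod>(k, a)\<leftarrow>n_as. [:- a, 1:] ^ k) a = 0"
      by (meson poly_eq_0_iff_dvd dvd_trans)
    hence "poly (char_poly U) a = 0" unfolding jordan_nf_char_poly[OF jnf] .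
    thus "a = 0" unfolding cp by simp
  qed
  hence "map (\<lambda>p. (p, 0)) (map fst n_as) = n_as"
    unfolding map_map by (intro map_idI) auto
  moreover have "jordan_nf A n_as"
    using jnf similar_mat_trans[OF U(2)] unfolding jordan_nf_def by blast
  ultimately have "jordan_nf A (map (\<lambda>p. (p, 0)) (map fst n_as))" by simp
  thus ?thesis by blast
qed

text \<open>Conjugation by the permutation matrix of \<open>f\<close>.\<close>

lemma similar_mat_reindex:
  fixes A B :: "'a::comm_ring_1 mat"
  assumes A: "A \<in> carrier_mat n n" and B: "B \<in> carrier_mat n n"
    and f: "bij_betw f {..<n} {..<n}"
    and AB: "\<And>r c. r < n \<Longrightarrow> c < n \<Longrightarrow> A $$ (r,c) = B $$ (f r, f c)"
  shows "similar_mat A B"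
proof -
  define P where "P = mat n n (\<lambda>(r,c). if c = f r then 1 else 0 :: 'a)"
  define Q where "Q = mat n n (\<lambda>(r,c). if r = f c then 1 else 0 :: 'a)"
  have P: "P \<in> carrier_mat n n" and Q: "Q \<in> carrier_mat n n" by (auto simp: P_def Q_def)
  have fl: "f r < n" if "r < n" for r using f that by (auto simp: bij_betw_def)
  have inj: "f r = f c \<longleftrightarrow> r = c" if "r < n" "c < n" for r c
    using f that by (auto simp: bij_betw_def inj_on_def)
  have PQ: "P * Q = 1\<^sub>m n"
  proof (rule eq_matI)
    fix r c assume "r < dim_row (1\<^sub>m n :: 'a mat)" "c < dim_col (1\<^sub>m n :: 'a mat)"
    hence rc: "r < n" "c < n" by auto
    have "(P * Q) $$ (r,c) = (\<Sum>k<n. if k = f r then (if k = f c then 1 else 0) else 0)"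
      unfolding mult_mat_entry[OF P Q rc] by (rule sum.cong) (use rc in \<open>auto simp: P_def Q_def\<close>)
    thus "(P * Q) $$ (r,c) = 1\<^sub>m n $$ (r,c)" using rc fl inj[OF rc] by simp
  qed (use P Q in auto)
  have PB: "(P * B) $$ (r,c) = B $$ (f r, c)" if rc: "r < n" "c < n" for r c
  proof -
    have "(P * B) $$ (r,c) = (\<Sum>k<n. if k = f r then B $$ (k,c) else 0)"
      unfolding mult_mat_entry[OF P B rc] by (rule sum.cong) (use rc in \<open>auto simp: P_def\<close>)
    thus ?thesis using rc fl by simp
  qed
  have PBc: "P * B \<in> carrier_mat n n" using P B by simp
  have "A = P * B * Q"
  proof (rule eq_matI)
    fix r c assume "r < dim_row (P * B * Q)" "c < dim_col (P * B * Q)"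
    hence rc: "r < n" "c < n" using P Q by auto
    have "(P * B * Q) $$ (r,c) = (\<Sum>k<n. if k = f c then B $$ (f r, k) else 0)"
      unfolding mult_mat_entry[OF PBc Q rc] by (rule sum.cong) (use rc PB in \<open>auto simp: Q_def\<close>)
    thus "A $$ (r,c) = (P * B * Q) $$ (r,c)" using rc fl AB by simp
  qed (use A P Q in auto)
  moreover have QP: "Q * P = 1\<^sub>m n"
  proof (rule eq_matI)
    fix r c assume "r < dim_row (1\<^sub>m n :: 'a mat)" "c < dim_col (1\<^sub>m n :: 'a mat)"
    hence rc: "r < n" "c < n" by auto
    have "r \<in> f ` {..<n}" using f rc unfolding bij_betw_def by simp
    then obtain r' where r': "r' < n" "f r' = r" by auto
    have "(Q * P) $$ (r,c) = (\<Sum>k<n. if k = r' then (if c = f k then 1 else 0) else 0)"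
      unfolding mult_mat_entry[OF Q P rc] by (rule sum.cong) (use rc r' inj in \<open>auto simp: P_def Q_def\<close>)
    thus "(Q * P) $$ (r,c) = 1\<^sub>m n $$ (r,c)" using rc r' by auto
  qed (use P Q in auto)
  ultimately show ?thesis using A B P Q PQ by (intro similar_matI[of _ _ P Q n]) auto
qed

section \<open>Blocks and levels of the Jordan basis\<close>

primrec block_of :: "nat list \<Rightarrow> nat \<Rightarrow> nat" where
  "block_of [] k = 0"
| "block_of (p # ps) k = (if k < p then 0 else Suc (block_of ps (k - p)))"

text \<open>\<open>J P\<close> raises levels: it maps the basis vector of level \<open>j\<close> in a block to the one of level \<open>j + 1\<close>. As Jordan
  blocks have their ones above the diagonal, levels decrease along the indices of a block.\<close>

primrec level_of :: "nat list \<Rightarrow> nat \<Rightarrow> nat" where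
  "level_of [] k = 0"
| "level_of (p # ps) k = (if k < p then p - 1 - k else level_of ps (k - p))"

primrec index_of :: "nat list \<Rightarrow> nat \<Rightarrow> nat \<Rightarrow> nat" where
  "index_of [] i j = 0"
| "index_of (p # ps) i j = (case i of 0 \<Rightarrow> p - 1 - j | Suc i' \<Rightarrow> p + index_of ps i' j)"

lemma index_props:
  assumes "k < sum_list P"
  shows "block_of P k < length P" "level_of P k < P ! block_of P k"
    "index_of P (block_of P k) (level_of P k) = k"
  using assms by (induction P arbitrary: k) auto

lemma index_of_props:
  assumes "i < length P" "j < P ! i"
  shows "index_of P i j < sum_list P" "block_of P (index_of P i j) = i"
    "level_of P (index_of P i j) = j"
  using assms by (induction P arbitrary: i) (auto split: nat.splits)

lemma index_eqI:
  assumes "r < sum_list P" "c < sum_list P" "block_of P r = block_of P c" "level_of P r = level_of P c"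
  shows "r = c"
  using assms index_props(3) by metis

lemma card_index:
  "card {k. k < sum_list P \<and> Pr (block_of P k) (level_of P k)} = (\<Sum>i<length P. card {j. j < P ! i \<and> Pr i j})"
proof -
  have "bij_betw (\<lambda>k. (block_of P k, level_of P k)) {k. k < sum_list P \<and> Pr (block_of P k) (level_of P k)}
     (SIGMA i:{..<length P}. {j. j < P ! i \<and> Pr i j})"
    by (rule bij_betw_byWitness[where f' = "\<lambda>(i,j). index_of P i j"])
       (auto simp: index_props index_of_props)
  from bij_betw_same_card[OF this] show ?thesis by simp
qed

lemma J_carrier [simp]: "J P \<in> carrier_mat (sum_list P) (sum_list P)"
  using jordan_matrix_carrier[of "map (\<lambda>p. (p, 0 :: 'a::{zero,one})) P"]
  by (simp add: J_def comp_def)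

lemma dim_J [simp]: "dim_row (J P) = sum_list P" "dim_col (J P) = sum_list P"
  by (simp_all add: J_def comp_def)

lemma J_entry:
  assumes "r < sum_list P" "c < sum_list P"
  shows "J P $$ (r,c) = (if block_of P r = block_of P c \<and> level_of P r = Suc (level_of P c) then 1 else 0)"
  using assms
proof (induction P arbitrary: r c)
  case Nil
  then show ?case by simp
next
  case (Cons p ps)
  have eq: "(J (p # ps) :: 'a mat) = four_block_mat (jordan_block p 0) (0\<^sub>m p (sum_list ps)) (0\<^sub>m (sum_list ps) p) (J ps)"
    unfolding J_def list.map jordan_matrix_Cons by (simp add: comp_def)
  have rc: "r < p + sum_list ps" "c < p + sum_list ps" using Cons.prems by simp_all
  have entry: "(J (p # ps) :: 'a mat) $$ (r,c) =
    (if r < p then if c < p then jordan_block p 0 $$ (r,c) else 0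
     else if c < p then 0 else J ps $$ (r - p, c - p))"
    unfolding eq using rc by (subst index_mat_four_block) auto
  show ?case
  proof (cases "r < p \<or> c < p")
    case True
    then show ?thesis unfolding entry using rc by auto
  next
    case False
    hence "r - p < sum_list ps" "c - p < sum_list ps" using rc by auto
    from Cons.IH[OF this] show ?thesis unfolding entry using False by simp
  qed
qed

lemma J_pow_entry:
  assumes "r < sum_list P" "c < sum_list P"
  shows "(J P ^\<^sub>m k :: 'a::comm_ring_1 mat) $$ (r,c) =
    (if block_of P r = block_of P c \<and> level_of P r = level_of P c + k then 1 else 0)"
  using assms
proof (induction k arbitrary: r c)
  case 0
  then show ?case using index_eqI[of r P c] by auto
next
  case (Suc k)
  let ?B = "J P :: 'a mat"
  let ?n = "sum_list P"
  have pk: "?B ^\<^sub>m k \<in> carrier_mat ?n ?n" by simp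
  have "(?B ^\<^sub>m Suc k) $$ (r,c) = (\<Sum>d<?n. (?B ^\<^sub>m k) $$ (r,d) * ?B $$ (d,c))"
    unfolding pow_mat.simps by (rule mult_mat_entry[OF pk J_carrier Suc.prems])
  also have "\<dots> = (\<Sum>d<?n. if block_of P r = block_of P d \<and> level_of P r = level_of P d + k \<and>
      block_of P d = block_of P c \<and> level_of P d = Suc (level_of P c) then 1 else 0)"
    by (rule sum.cong[OF refl]) (simp add: Suc.IH Suc.prems J_entry)
  also have "\<dots> = (if block_of P r = block_of P c \<and> level_of P r = level_of P c + Suc k then 1 else 0)"
  proof (cases "block_of P r = block_of P c \<and> level_of P r = level_of P c + Suc k")
    case True
    define d0 where "d0 = index_of P (block_of P c) (Suc (level_of P c))"
    have d0: "d0 < ?n" "block_of P d0 = block_of P c" "level_of P d0 = Suc (level_of P c)"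
      using index_of_props[of "block_of P c" P "Suc (level_of P c)"] index_props[OF Suc.prems(1)]
        index_props[OF Suc.prems(2)] True by (auto simp: d0_def)
    have "(\<Sum>d<?n. if block_of P r = block_of P d \<and> level_of P r = level_of P d + k \<and>
      block_of P d = block_of P c \<and> level_of P d = Suc (level_of P c) then 1 else 0 :: 'a) =
      (\<Sum>d<?n. if d = d0 then 1 else 0)"
    proof (rule sum.cong[OF refl])
      fix d assume "d \<in> {..<?n}"
      thus "(if block_of P r = block_of P d \<and> level_of P r = level_of P d + k \<and>
        block_of P d = block_of P c \<and> level_of P d = Suc (level_of P c) then 1 else 0 :: 'a) =
        (if d = d0 then 1 else 0)"
        using True d0 index_eqI[of d P d0] by (cases "d = d0") auto
    qed
    thus ?thesis using True d0 by simp
  next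
    case False
    hence "\<not> (block_of P r = block_of P d \<and> level_of P r = level_of P d + k \<and>
      block_of P d = block_of P c \<and> level_of P d = Suc (level_of P c))" for d by linarith
    thus ?thesis using False by (simp only: if_False sum.neutral_const)
  qed
  finally show ?case .
qed

text \<open>A permutation of the blocks induces a permutation of the basis vectors that keeps
  levels. This turns an unsorted list of block sizes into a partition.\<close>

lemma similar_J_mset:
  assumes "mset P = mset Q"
  shows "similar_mat (J P :: 'a::comm_ring_1 mat) (J Q)"
proof -
  from mset_eq_permutation[OF assms] obtain p where p: "p permutes {..<length Q}" "permute_list p Q = P" .
  have len: "length P = length Q" using assms by (rule mset_eq_length)
  have n: "sum_list P = sum_list Q" using assms by (metis sum_mset_sum_list)
  have Pi: "P ! i = Q ! p i" "p i < length Q" if "i < length Q" for i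
    using p permute_list_nth[OF p(1) that] that permutes_in_image[OF p(1)] by auto
  have pinj: "p i = p j \<longleftrightarrow> i = j" for i j using permutes_inj[OF p(1)] by (auto simp: inj_def)
  define f where "f k = index_of Q (p (block_of P k)) (level_of P k)" for k
  have f: "f k < sum_list Q" "block_of Q (f k) = p (block_of P k)" "level_of Q (f k) = level_of P k"
    if "k < sum_list Q" for k
    using index_of_props[of "p (block_of P k)" Q "level_of P k"] index_props[of k P] that n Pi[of "block_of P k"] len
    by (auto simp: f_def)
  have inj: "inj_on f {..<sum_list Q}"
  proof (rule inj_onI)
    fix a b assume ab: "a \<in> {..<sum_list Q}" "b \<in> {..<sum_list Q}" "f a = f b"
    hence "block_of P a = block_of P b" "level_of P a = level_of P b"
      using f[of a] f[of b] pinj by auto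
    thus "a = b" using index_eqI[of a P b] ab n by auto
  qed
  have "bij_betw f {..<sum_list Q} {..<sum_list Q}"
    unfolding bij_betw_def by (intro conjI inj endo_inj_surj) (use f inj in auto)
  show ?thesis
  proof (rule similar_mat_reindex[OF _ _ \<open>bij_betw f {..<sum_list Q} {..<sum_list Q}\<close>])
    show "J P \<in> carrier_mat (sum_list Q) (sum_list Q)" using J_carrier[of P] n by simp
    show "J Q \<in> carrier_mat (sum_list Q) (sum_list Q)" by simp
    fix r c assume "r < sum_list Q" "c < sum_list Q"
    thus "(J P :: 'a mat) $$ (r, c) = J Q $$ (f r, f c)"
      using f[of r] f[of c] n by (simp add: J_entry pinj)
  qed
qed

lemma has_jordan_type_exists:
  fixes A :: "'a::field mat"
  assumes "A \<in> carrier_mat n n" "A ^\<^sub>m m = 0\<^sub>m n n"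
  obtains Q where "has_jordan_type A Q"
proof -
  obtain ns where ns: "jordan_nf A (map (\<lambda>p. (p, 0)) ns)"
    using nilpotent_jordan_nf[OF assms] by blast
  define Q where "Q = rev (sort ns)"
  have "similar_mat (J ns :: 'a mat) (J Q)" by (rule similar_J_mset) (simp add: Q_def)
  hence "jordan_nf A (map (\<lambda>p. (p, 0)) Q)"
    using ns similar_mat_trans[of A "J ns" "J Q"] unfolding jordan_nf_def J_def Q_def by auto
  moreover have "is_partition Q"
  proof -
    have "0 \<notin> set ns" using ns unfolding jordan_nf_def by (simp add: image_image)
    hence "p \<noteq> 0" if "p \<in> set Q" for p using that by (cases "p = 0") (simp_all add: Q_def)
    hence "\<forall>p\<in>set Q. p > 0" by simp
    moreover have "sorted (rev Q)" by (simp add: Q_def)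
    hence "sorted_wrt (\<ge>) Q" by (simp add: sorted_wrt_rev)
    ultimately show ?thesis unfolding is_partition_def by blast
  qed
  ultimately show thesis using that unfolding has_jordan_type_def by blast
qed

lemma has_jordan_typeD:
  assumes "has_jordan_type A Q" "A \<in> carrier_mat n n"
  shows "is_partition Q" "similar_mat A (J Q)" "sum_list Q = n"
proof -
  show 1: "is_partition Q" "similar_mat A (J Q)"
    using assms(1) unfolding has_jordan_type_def jordan_nf_def J_def by blast+
  from 1(2) obtain S T where "similar_mat_wit A (J Q) S T" unfolding similar_mat_def by blast
  from similar_mat_witD2(5)[OF assms(2) this] show "sum_list Q = n" using dim_J(1)[of Q] by (metis carrier_matD(1))
qed

subsection \<open>Ranks of powers\<close>

text \<open>A lower bound on the rank, encoded by factoring the identity through \<open>M\<close>.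
  The equivalent form det (X M Z) \<noteq> 0 is polynomial in \<open>M\<close>, which makes the
  condition Zariski open.\<close>

definition rank_ge :: "nat \<Rightarrow> nat \<Rightarrow> 'a::field mat \<Rightarrow> bool" where
  "rank_ge n \<rho> M \<longleftrightarrow> (\<exists>X\<in>carrier_mat \<rho> n. \<exists>Z\<in>carrier_mat n \<rho>. X * M * Z = 1\<^sub>m \<rho>)"

lemma rank_ge_det:
  fixes M :: "'a::field mat"
  assumes M: "M \<in> carrier_mat n n" and X: "X \<in> carrier_mat \<rho> n" and Z: "Z \<in> carrier_mat n \<rho>"
    and d: "det (X * M * Z) \<noteq> 0"
  shows "rank_ge n \<rho> M"
proof -
  have C: "X * M * Z \<in> carrier_mat \<rho> \<rho>" using M X Z by simp
  from det_nz_inverse[OF this d] obtain Q where Q: "Q \<in> carrier_mat \<rho> \<rho>" "Q * (X * M * Z) = 1\<^sub>m \<rho>" by auto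
  have "(Q * X) * M * Z = Q * (X * M * Z)"
    using Q M X Z by (simp add: assoc_mult_mat[of _ \<rho> \<rho> _ n _ n] assoc_mult_mat[of _ \<rho> \<rho> _ n _ \<rho>])
  thus ?thesis unfolding rank_ge_def using Q X Z by (intro bexI[of _ "Q * X"] bexI[of _ Z]) auto
qed

lemma rank_ge_iff_det:
  fixes M :: "'a::field mat"
  assumes M: "M \<in> carrier_mat n n"
  shows "rank_ge n \<rho> M \<longleftrightarrow> (\<exists>X\<in>carrier_mat \<rho> n. \<exists>Z\<in>carrier_mat n \<rho>. det (X * M * Z) \<noteq> 0)"
  using rank_ge_det[OF M] unfolding rank_ge_def by (metis det_one zero_neq_one)

lemma rank_ge_conj:
  fixes M :: "'a::field mat"
  assumes M: "M \<in> carrier_mat n n" and P: "P \<in> carrier_mat n n" and Q: "Q \<in> carrier_mat n n"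
    and r: "rank_ge n \<rho> (P * M * Q)"
  shows "rank_ge n \<rho> M"
proof -
  from r obtain X Z where X: "X \<in> carrier_mat \<rho> n" and Z: "Z \<in> carrier_mat n \<rho>"
    and XZ: "X * (P * M * Q) * Z = 1\<^sub>m \<rho>" unfolding rank_ge_def by auto
  have "X * (P * M * Q) * Z = (X * P) * M * (Q * Z)"
    using M P Q X Z
    by (simp add: assoc_mult_mat[of _ \<rho> n _ n _ n] assoc_mult_mat[of _ n n _ n _ n]
        assoc_mult_mat[of _ \<rho> n _ n _ \<rho>] assoc_mult_mat[of _ n n _ n _ \<rho>])
  thus ?thesis using XZ X Z P Q unfolding rank_ge_def
    by (intro bexI[of _ "X * P"] bexI[of _ "Q * Z"]) auto
qed

lemma rank_ge_similar:
  fixes A :: "'a::field mat"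
  assumes "similar_mat A B" "A \<in> carrier_mat n n"
  shows "rank_ge n \<rho> (A ^\<^sub>m i) \<longleftrightarrow> rank_ge n \<rho> (B ^\<^sub>m i)"
proof -
  have *: "rank_ge n \<rho> (B ^\<^sub>m i)" if "similar_mat A B" "A \<in> carrier_mat n n" "rank_ge n \<rho> (A ^\<^sub>m i)" for A B :: "'a mat"
  proof -
    from that(1) obtain P Q where w: "similar_mat_wit A B P Q" unfolding similar_mat_def by auto
    from similar_mat_witD2[OF that(2) w] similar_mat_wit_pow_id[OF w, of i] rank_ge_conj[of "B ^\<^sub>m i" n P Q \<rho>] that(3)
    show ?thesis by auto
  qed
  have "B \<in> carrier_mat n n" using similar_matD[OF assms(1)] assms(2) by auto
  thus ?thesis using * assms similar_mat_sym by blast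
qed

text \<open>The columns in \<open>D\<close> and their images under \<open>f\<close>, taken as rows,
  cut out an identity submatrix.\<close>

lemma rank_ge_select:
  fixes M :: "'a::field mat"
  assumes M: "M \<in> carrier_mat n n" and D: "finite D" "card D = \<rho>"
    and lt: "\<And>c. c \<in> D \<Longrightarrow> c < n" "\<And>c. c \<in> D \<Longrightarrow> f c < n"
    and e: "\<And>c c'. c \<in> D \<Longrightarrow> c' \<in> D \<Longrightarrow> M $$ (f c', c) = (if c = c' then 1 else 0)"
  shows "rank_ge n \<rho> M"
proof -
  obtain h where h: "bij_betw h {..<\<rho>} D" using ex_bij_betw_nat_finite[OF D(1)] D(2) by (metis atLeast0LessThan)
  have hD: "h a \<in> D" if "a < \<rho>" for a using h that by (auto simp: bij_betw_def)
  have hinj: "h a = h b \<longleftrightarrow> a = b" if "a < \<rho>" "b < \<rho>" for a b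
    using h that by (auto simp: bij_betw_def inj_on_def)
  define X where "X = mat \<rho> n (\<lambda>(a,k). if k = f (h a) then 1 else 0 :: 'a)"
  define Z where "Z = mat n \<rho> (\<lambda>(k,b). if k = h b then 1 else 0 :: 'a)"
  have X: "X \<in> carrier_mat \<rho> n" and Z: "Z \<in> carrier_mat n \<rho>" by (auto simp: X_def Z_def)
  have XM: "(X * M) $$ (a,k) = M $$ (f (h a), k)" if "a < \<rho>" "k < n" for a k
  proof -
    have "(X * M) $$ (a,k) = (\<Sum>d<n. if d = f (h a) then M $$ (d,k) else 0)"
      unfolding mult_mat_entry[OF X M that] by (rule sum.cong) (use that in \<open>auto simp: X_def\<close>)
    thus ?thesis using lt hD that by simp
  qed
  have "X * M * Z = 1\<^sub>m \<rho>"
  proof (rule eq_matI)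
    fix a b assume "a < dim_row (1\<^sub>m \<rho> :: 'a mat)" "b < dim_col (1\<^sub>m \<rho> :: 'a mat)"
    hence ab: "a < \<rho>" "b < \<rho>" by auto
    have "(X * M * Z) $$ (a,b) = (\<Sum>k<n. if k = h b then M $$ (f (h a), k) else 0)"
      unfolding mult_mat_entry[OF mult_carrier_mat[OF X M] Z ab]
      by (rule sum.cong) (use ab XM in \<open>auto simp: Z_def\<close>)
    also have "\<dots> = M $$ (f (h a), h b)" using lt hD ab by simp
    also have "\<dots> = 1\<^sub>m \<rho> $$ (a,b)" using e[OF hD hD] ab hinj by auto
    finally show "(X * M * Z) $$ (a,b) = 1\<^sub>m \<rho> $$ (a,b)" .
  qed (use X Z in auto)
  thus ?thesis unfolding rank_ge_def using X Z by auto
qed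

lemma underdetermined_system:
  fixes M :: "'a::field mat"
  assumes M: "M \<in> carrier_mat N \<rho>" and c: "card {r. r < N \<and> (\<exists>c<\<rho>. M $$ (r,c) \<noteq> 0)} < \<rho>"
  shows "\<exists>w\<in>carrier_vec \<rho>. w \<noteq> 0\<^sub>v \<rho> \<and> M *\<^sub>v w = 0\<^sub>v N"
proof -
  define R where "R = {r. r < N \<and> (\<exists>c<\<rho>. M $$ (r,c) \<noteq> 0)}"
  have fR: "finite R" unfolding R_def by simp
  obtain h where h: "bij_betw h {..<card R} R" using ex_bij_betw_nat_finite[OF fR] by (metis atLeast0LessThan)
  \<comment> \<open>The nonzero rows of \<open>M\<close>, padded with zero rows to a square matrix.
    There are fewer than \<rho> of them, so the last row of \<open>E\<close> vanishes and
    \<open>E\<close> is singular.\<close>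
  define E where "E = mat \<rho> \<rho> (\<lambda>(a,k). if a < card R then M $$ (h a, k) else 0)"
  have E: "E \<in> carrier_mat \<rho> \<rho>" by (simp add: E_def)
  have cR: "card R < \<rho>" using c by (simp add: R_def)
  have "det E = 0"
  proof (rule ccontr)
    assume "det E \<noteq> 0"
    from det_nz_inverse[OF E this] obtain Q where Q: "Q \<in> carrier_mat \<rho> \<rho>" "E * Q = 1\<^sub>m \<rho>" by auto
    have "(E * Q) $$ (\<rho> - 1, \<rho> - 1) = 0"
      using cR by (subst mult_mat_entry[OF E Q(1)]) (auto simp: E_def intro!: sum.neutral)
    thus False using Q cR by auto
  qed
  then obtain w where w: "w \<in> carrier_vec \<rho>" "w \<noteq> 0\<^sub>v \<rho>" "E *\<^sub>v w = 0\<^sub>v \<rho>"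
    using det_0_iff_vec_prod_zero_field[OF E] by auto
  have "M *\<^sub>v w = 0\<^sub>v N"
  proof (rule eq_vecI)
    fix r assume "r < dim_vec (0\<^sub>v N :: 'a vec)"
    hence r: "r < N" by simp
    have "(\<Sum>k<\<rho>. M $$ (r,k) * w $ k) = 0"
    proof (cases "r \<in> R")
      case True
      then have "r \<in> h ` {..<card R}" using h by (simp add: bij_betw_def)
      then obtain a where a: "a < card R" "h a = r" by auto
      have "(E *\<^sub>v w) $ a = (\<Sum>k<\<rho>. E $$ (a,k) * w $ k)"
        using a cR by (intro mat_mult_vec_entry[OF E w(1)]) auto
      also have "\<dots> = (\<Sum>k<\<rho>. M $$ (r,k) * w $ k)"
        by (rule sum.cong) (use a cR in \<open>auto simp: E_def\<close>)
      finally show ?thesis using w(3) a cR by simp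
    next
      case False
      then show ?thesis using r by (auto simp: R_def intro!: sum.neutral)
    qed
    thus "(M *\<^sub>v w) $ r = 0\<^sub>v N $ r" using mat_mult_vec_entry[OF M w(1) r] r by simp
  qed (use M in simp)
  thus ?thesis using w by auto
qed

lemma rank_ge_le_nonzero_rows:
  fixes M :: "'a::field mat"
  assumes M: "M \<in> carrier_mat n n" and r: "rank_ge n \<rho> M"
  shows "\<rho> \<le> card {r. r < n \<and> (\<exists>c<n. M $$ (r,c) \<noteq> 0)}"
proof (rule ccontr)
  assume a: "\<not> ?thesis"
  from r obtain X Z where X: "X \<in> carrier_mat \<rho> n" and Z: "Z \<in> carrier_mat n \<rho>"
    and XZ: "X * M * Z = 1\<^sub>m \<rho>" unfolding rank_ge_def by auto
  have MZ: "M * Z \<in> carrier_mat n \<rho>" using M Z by simp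
  have "{r. r < n \<and> (\<exists>c<\<rho>. (M * Z) $$ (r,c) \<noteq> 0)} \<subseteq> {r. r < n \<and> (\<exists>c<n. M $$ (r,c) \<noteq> 0)}"
  proof safe
    fix r c assume rc: "r < n" "c < \<rho>" "(M * Z) $$ (r,c) \<noteq> 0"
    then obtain k where "k < n" "M $$ (r,k) * Z $$ (k,c) \<noteq> 0"
      unfolding mult_mat_entry[OF M Z rc(1,2)] by (metis (mono_tags, lifting) lessThan_iff sum.neutral)
    thus "\<exists>c<n. M $$ (r,c) \<noteq> 0" by auto
  qed
  from card_mono[OF _ this] a have "card {r. r < n \<and> (\<exists>c<\<rho>. (M * Z) $$ (r,c) \<noteq> 0)} < \<rho>" by simp
  from underdetermined_system[OF MZ this] obtain w where w: "w \<in> carrier_vec \<rho>" "w \<noteq> 0\<^sub>v \<rho>"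
    "M * Z *\<^sub>v w = 0\<^sub>v n" by auto
  have "w = X * M * Z *\<^sub>v w" using XZ w by simp
  also have "X * M * Z = X * (M * Z)" using X M Z by (rule assoc_mult_mat)
  also have "\<dots> *\<^sub>v w = X *\<^sub>v (M * Z *\<^sub>v w)" using X MZ w(1) by (rule assoc_mult_mat_vec)
  also have "\<dots> = 0\<^sub>v \<rho>" unfolding w(3) by (rule eq_vecI) (use X in auto)
  finally show False using w(2) by simp
qed

lemma sum_list_diff_min: "sum_list (map (\<lambda>q. q - i) Q) + sum_list (map (min i) Q) = sum_list (Q :: nat list)"
  by (induction Q) auto

text \<open>The i-th power has rank equal to the sum of the truncated differences q - i. Its nonzero
  rows have level at least i; conversely, vectors with room for i more levels are sent to distinct
  basis vectors. The additive form avoids truncated subtraction.\<close>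

lemma rank_ge_J_pow:
  "rank_ge (sum_list Q) \<rho> (J Q ^\<^sub>m i :: 'a::field mat) \<longleftrightarrow> \<rho> + sum_list (map (min i) Q) \<le> sum_list Q"
proof
  let ?n = "sum_list Q" and ?M = "J Q ^\<^sub>m i :: 'a mat"
  have M: "?M \<in> carrier_mat ?n ?n" by simp
  have S: "sum_list (map (\<lambda>q. q - i) Q) = (\<Sum>b<length Q. Q ! b - i)"
    by (simp add: sum_list_sum_nth atLeast0LessThan)
  {
    assume "rank_ge ?n \<rho> ?M"
    from rank_ge_le_nonzero_rows[OF M this]
    have "\<rho> \<le> card {r. r < ?n \<and> (\<exists>c<?n. ?M $$ (r,c) \<noteq> 0)}" .
    also have "\<dots> \<le> card {r. r < ?n \<and> i \<le> level_of Q r}"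
      by (rule card_mono) (auto simp: J_pow_entry split: if_splits)
    also have "\<dots> = (\<Sum>b<length Q. card {j. j < Q ! b \<and> i \<le> j})"
      by (rule card_index)
    also have "\<dots> = (\<Sum>b<length Q. Q ! b - i)"
    proof (rule sum.cong)
      fix b
      have "{j. j < Q ! b \<and> i \<le> j} = {i..<Q ! b}" by auto
      thus "card {j. j < Q ! b \<and> i \<le> j} = Q ! b - i" by simp
    qed simp
    finally show "\<rho> + sum_list (map (min i) Q) \<le> ?n" using S sum_list_diff_min[of i Q] by simp
  }
  {
    assume le: "\<rho> + sum_list (map (min i) Q) \<le> ?n"
    define D where "D = {c. c < ?n \<and> level_of Q c + i < Q ! block_of Q c}"
    have "card D = (\<Sum>b<length Q. card {j. j < Q ! b \<and> j + i < Q ! b})"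
      unfolding D_def by (rule card_index)
    also have "\<dots> = (\<Sum>b<length Q. Q ! b - i)"
    proof (rule sum.cong)
      fix b
      have "{j. j < Q ! b \<and> j + i < Q ! b} = {..<Q ! b - i}" by auto
      thus "card {j. j < Q ! b \<and> j + i < Q ! b} = Q ! b - i" by simp
    qed simp
    finally have "\<rho> \<le> card D" using S sum_list_diff_min[of i Q] le by simp
    then obtain D' where D': "D' \<subseteq> D" "card D' = \<rho>" by (meson obtain_subset_with_card_n)
    define f where "f c = index_of Q (block_of Q c) (level_of Q c + i)" for c
    have f: "f c < ?n" "block_of Q (f c) = block_of Q c" "level_of Q (f c) = level_of Q c + i" if "c \<in> D" for c
      using index_of_props[of "block_of Q c" Q "level_of Q c + i"] index_props[of c Q] that
      by (auto simp: f_def D_def)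
    show "rank_ge ?n \<rho> ?M"
    proof (rule rank_ge_select[OF M _ D'(2), where f = f])
      show "finite D'" using D'(1) by (rule finite_subset) (simp add: D_def)
      fix c assume c: "c \<in> D'"
      show "c < ?n" "f c < ?n" using c D' f by (auto simp: D_def)
      fix c' assume c': "c' \<in> D'"
      have cD: "c \<in> D" "c' \<in> D" "c < ?n" "c' < ?n" using c c' D' by (auto simp: D_def)
      show "?M $$ (f c', c) = (if c = c' then 1 else 0)"
        using f[OF cD(2)] cD index_eqI[of c Q c'] by (auto simp: J_pow_entry)
    qed
  }
qed

lemma rank_ge_jordan_type:
  fixes A :: "'a::field mat"
  assumes "has_jordan_type A Q" "A \<in> carrier_mat n n"
  shows "rank_ge n \<rho> (A ^\<^sub>m i) \<longleftrightarrow> \<rho> + sum_list (map (min i) Q) \<le> n"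
  using rank_ge_similar[OF has_jordan_typeD(2)[OF assms] assms(2)] rank_ge_J_pow[of Q \<rho> i, where 'a = 'a]
    has_jordan_typeD(3)[OF assms] by simp

lemma sum_min_Suc: "sum_list (map (min (Suc i)) Q) = sum_list (map (min i) Q) + length (filter (\<lambda>q. i < q) Q)"
  by (induction Q) auto

text \<open>First differences in \<open>i\<close> of these sums count the parts exceeding
  \<open>i\<close>, and differences of those counts are the multiplicities.\<close>

lemma partition_eqI:
  assumes "is_partition P" "is_partition Q" "\<And>i. sum_list (map (min i) P) = sum_list (map (min i) Q)"
  shows "P = Q"
proof -
  have gt: "length (filter (\<lambda>q. i < q) P) = length (filter (\<lambda>q. i < q) Q)" for i
    using assms(3)[of i] assms(3)[of "Suc i"] by (simp add: sum_min_Suc)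
  have split: "length (filter (\<lambda>q. i < q) R) = length (filter (\<lambda>q. Suc i < q) R) + count (mset R) (Suc i)" for R and i :: nat
    by (induction R) auto
  have "count (mset P) x = count (mset Q) x" for x
  proof (cases x)
    case 0
    then show ?thesis using assms(1,2) unfolding is_partition_def
      by (metis count_inI less_irrefl set_mset_mset)
  next
    case (Suc i)
    then show ?thesis using gt[of i] gt[of "Suc i"] split[of i P] split[of i Q] by simp
  qed
  hence "mset P = mset Q" by (rule multiset_eqI)
  moreover have "sorted (rev P)" "sorted (rev Q)"
    using assms(1,2) by (auto simp: is_partition_def sorted_wrt_rev)
  ultimately have "rev P = rev Q" by (metis properties_for_sort mset_rev)
  thus ?thesis by simp
qed

subsection \<open>Generic Jordan types\<close>

lemma poly_funs_sum:
  "finite I \<Longrightarrow> (\<And>x. x \<in> I \<Longrightarrow> f x \<in> poly_funs n) \<Longrightarrow> (\<lambda>M. \<Sum>x\<in>I. f x M) \<in> poly_funs n"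
  by (induction I rule: finite_induct) (simp_all add: poly_funs.const poly_funs.add)

lemma poly_funs_prod:
  "finite I \<Longrightarrow> (\<And>x. x \<in> I \<Longrightarrow> f x \<in> poly_funs n) \<Longrightarrow> (\<lambda>M. \<Prod>x\<in>I. f x M) \<in> poly_funs n"
  by (induction I rule: finite_induct) (simp_all add: poly_funs.const poly_funs.mult)

definition poly_mat :: "nat \<Rightarrow> nat \<Rightarrow> nat \<Rightarrow> ('a::comm_ring_1 mat \<Rightarrow> 'a mat) \<Rightarrow> bool" where
  "poly_mat n a b F \<longleftrightarrow> (\<forall>M. F M \<in> carrier_mat a b) \<and> (\<forall>i<a. \<forall>j<b. (\<lambda>M. F M $$ (i,j)) \<in> poly_funs n)"

lemma poly_mat_const: "X \<in> carrier_mat a b \<Longrightarrow> poly_mat n a b (\<lambda>M. X)"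
  by (simp add: poly_mat_def poly_funs.const)

text \<open>Truncation to size \<open>n\<close>: members of \<open>poly_funs n\<close> are functions on matrices of any size.\<close>

lemma poly_mat_entries: "poly_mat n n n (\<lambda>M. mat n n (\<lambda>ij. M $$ ij))"
  by (simp add: poly_mat_def poly_funs.entry)

lemma poly_mat_mult:
  assumes F: "poly_mat n a b F" and G: "poly_mat n b c G"
  shows "poly_mat n a c (\<lambda>M. F M * G M)"
proof -
  have FM: "F M \<in> carrier_mat a b" and GM: "G M \<in> carrier_mat b c" for M
    using F G by (auto simp: poly_mat_def)
  have "(\<lambda>M. (F M * G M) $$ (i,j)) \<in> poly_funs n" if "i < a" "j < c" for i j
  proof -
    have "(\<lambda>M. (F M * G M) $$ (i,j)) = (\<lambda>M. \<Sum>k<b. F M $$ (i,k) * G M $$ (k,j))"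
      using mult_mat_entry[OF FM GM that] by (rule ext)
    also have "\<dots> \<in> poly_funs n"
      using F G that by (intro poly_funs_sum poly_funs.mult) (auto simp: poly_mat_def)
    finally show ?thesis .
  qed
  thus ?thesis using FM GM unfolding poly_mat_def by (metis mult_carrier_mat)
qed

lemma poly_mat_pow:
  assumes F: "poly_mat n a a F"
  shows "poly_mat n a a (\<lambda>M. F M ^\<^sub>m k)"
proof (induction k)
  case 0
  have "dim_row (F M) = a" for M using F unfolding poly_mat_def by (metis carrier_matD(1))
  hence "(\<lambda>M. F M ^\<^sub>m 0) = (\<lambda>M. 1\<^sub>m a)" by simp
  then show ?case using poly_mat_const[of "1\<^sub>m a" a a n] by simp
next
  case (Suc k)
  then show ?case using poly_mat_mult[OF Suc F] by simp
qed

lemma poly_mat_det: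
  assumes F: "poly_mat n a a F"
  shows "(\<lambda>M. det (F M)) \<in> poly_funs n"
proof -
  have "(\<lambda>M. det (F M)) = (\<lambda>M. \<Sum>p\<in>{p. p permutes {0..<a}}. signof p * (\<Prod>i\<in>{0..<a}. F M $$ (i, p i)))"
    using F by (intro ext det_def') (auto simp: poly_mat_def)
  also have "\<dots> \<in> poly_funs n"
  proof (intro poly_funs_sum poly_funs.mult poly_funs_prod poly_funs.const)
    fix p i assume "p \<in> {p. p permutes {0..<a}}" "i \<in> {0..<a}"
    hence "i < a" "p i < a" using permutes_in_image[of p "{0..<a}" i] by auto
    thus "(\<lambda>M. F M $$ (i, p i)) \<in> poly_funs n" using F by (auto simp: poly_mat_def)
  qed (simp_all add: finite_permutations)
  finally show ?thesis .
qed

text \<open>The defining functions are det (X M^i Z) for all \<open>X\<close> and \<open>Z\<close>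
  of matching sizes; they take the role of the minors of M^i.\<close>

lemma openin_zariski_rank_ge:
  "openin (zariski n) {A \<in> carrier_mat n n. rank_ge n \<rho> (A ^\<^sub>m i :: 'a::field mat)}"
proof -
  define F where "F = (\<lambda>(X, Z) (M :: 'a mat). det (X * mat n n (\<lambda>ij. M $$ ij) ^\<^sub>m i * Z)) `
    (carrier_mat \<rho> n \<times> carrier_mat n \<rho>)"
  have "F \<subseteq> poly_funs n"
    unfolding F_def by (auto intro!: poly_mat_det poly_mat_mult poly_mat_pow poly_mat_const poly_mat_entries)
  moreover have "{A \<in> carrier_mat n n. rank_ge n \<rho> (A ^\<^sub>m i)} = nonvanishing n F"
  proof -
    have "rank_ge n \<rho> (A ^\<^sub>m i) \<longleftrightarrow> (\<exists>f\<in>F. f A \<noteq> 0)" if A: "A \<in> carrier_mat n n" for A :: "'a mat"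
    proof -
      have "mat n n (\<lambda>ij. A $$ ij) = A" using A by (intro eq_matI) auto
      thus ?thesis using rank_ge_iff_det[OF pow_carrier_mat[OF A, of i], of \<rho>] by (auto simp: F_def)
    qed
    thus ?thesis unfolding nonvanishing_def by blast
  qed
  ultimately show ?thesis unfolding openin_zariski by blast
qed

section \<open>Rational curves and intersections of open sets\<close>

lemma poly_fun_along_curve:
  fixes D :: "'a::field poly"
  assumes "f \<in> poly_funs n"
  shows "\<exists>p N. \<forall>\<tau> M. (\<forall>i<n. \<forall>j<n. poly D \<tau> * M $$ (i,j) = poly (H i j) \<tau>) \<longrightarrow>
    poly D \<tau> ^ N * f M = poly p \<tau>"
  using assms
proof induction
  case (const c)
  show ?case by (rule exI[of _ "[:c:]"], rule exI[of _ 0]) simp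
next
  case (entry i j)
  then show ?case by (intro exI[of _ "H i j"] exI[of _ 1]) simp
next
  case (add f g)
  then obtain p1 N1 p2 N2 where
    1: "\<And>\<tau> M. (\<forall>i<n. \<forall>j<n. poly D \<tau> * M $$ (i,j) = poly (H i j) \<tau>) \<Longrightarrow> poly D \<tau> ^ N1 * f M = poly p1 \<tau>" and
    2: "\<And>\<tau> M. (\<forall>i<n. \<forall>j<n. poly D \<tau> * M $$ (i,j) = poly (H i j) \<tau>) \<Longrightarrow> poly D \<tau> ^ N2 * g M = poly p2 \<tau>"
    by metis
  show ?case
    by (intro exI[of _ "D ^ N2 * p1 + D ^ N1 * p2"] exI[of _ "N1 + N2"] allI impI)
       (simp add: 1[symmetric] 2[symmetric] power_add algebra_simps)
next
  case (mult f g)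
  then obtain p1 N1 p2 N2 where
    1: "\<And>\<tau> M. (\<forall>i<n. \<forall>j<n. poly D \<tau> * M $$ (i,j) = poly (H i j) \<tau>) \<Longrightarrow> poly D \<tau> ^ N1 * f M = poly p1 \<tau>" and
    2: "\<And>\<tau> M. (\<forall>i<n. \<forall>j<n. poly D \<tau> * M $$ (i,j) = poly (H i j) \<tau>) \<Longrightarrow> poly D \<tau> ^ N2 * g M = poly p2 \<tau>"
    by metis
  show ?case
    by (intro exI[of _ "p1 * p2"] exI[of _ "N1 + N2"] allI impI)
       (simp add: 1[symmetric] 2[symmetric] power_add algebra_simps)
qed

lemma infinite_field_nonroot:
  fixes p :: "'a::field poly"
  assumes "infinite (UNIV :: 'a set)" "p \<noteq> 0"
  obtains x where "poly p x \<noteq> 0"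
proof -
  have "finite {x. poly p x = 0}" using assms(2) by (rule poly_roots_finite)
  hence "{x. poly p x = 0} \<noteq> UNIV" using assms(1) by metis
  thus thesis using that by auto
qed

text \<open>The curve is \<open>\<tau> \<mapsto> H(\<tau>) / D(\<tau>)\<close>.\<close>

definition joined_by_curve :: "nat \<Rightarrow> 'a::field mat set \<Rightarrow> 'a mat \<Rightarrow> 'a mat \<Rightarrow> bool" where
  "joined_by_curve n N A1 A2 \<longleftrightarrow> (\<exists>(D :: 'a poly) H \<tau>1 \<tau>2. poly D \<tau>1 \<noteq> 0 \<and> poly D \<tau>2 \<noteq> 0 \<and>
    (\<forall>i<n. \<forall>j<n. poly D \<tau>1 * A1 $$ (i,j) = poly (H i j) \<tau>1) \<and>
    (\<forall>i<n. \<forall>j<n. poly D \<tau>2 * A2 $$ (i,j) = poly (H i j) \<tau>2) \<and>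
    (\<forall>\<tau>. poly D \<tau> \<noteq> 0 \<longrightarrow> (\<exists>M\<in>N. \<forall>i<n. \<forall>j<n. poly D \<tau> * M $$ (i,j) = poly (H i j) \<tau>)))"

text \<open>A polynomial function that is nonzero at an end point pulls back, after multiplication
  by a power of \<open>D\<close>, to a nonzero polynomial in \<tau>. The product of \<open>D\<close>
  and the two pullbacks has a nonroot in an infinite field, and the point of the curve there lies in
  both sets.\<close>

lemma open_sets_meet:
  fixes N :: "'a::field mat set"
  assumes inf: "infinite (UNIV :: 'a set)" and N: "N \<subseteq> carrier_mat n n"
    and join: "\<And>A1 A2. A1 \<in> N \<Longrightarrow> A2 \<in> N \<Longrightarrow> joined_by_curve n N A1 A2"
    and U1: "openin (subtopology (zariski n) N) U1" "U1 \<noteq> {}"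
    and U2: "openin (subtopology (zariski n) N) U2" "U2 \<noteq> {}"
  shows "U1 \<inter> U2 \<noteq> {}"
proof -
  have ob: "\<exists>F\<subseteq>poly_funs n. U = N \<inter> nonvanishing n F" if "openin (subtopology (zariski n) N) U" for U
    using that unfolding openin_subtopology openin_zariski by blast
  from ob[OF U1(1)] obtain F1 where F1: "F1 \<subseteq> poly_funs n" "U1 = N \<inter> nonvanishing n F1" by auto
  from ob[OF U2(1)] obtain F2 where F2: "F2 \<subseteq> poly_funs n" "U2 = N \<inter> nonvanishing n F2" by auto
  from F1 U1 obtain A1 f1 where A1: "A1 \<in> N" "f1 \<in> F1" "f1 A1 \<noteq> 0" by (auto simp: nonvanishing_def)
  from F2 U2 obtain A2 f2 where A2: "A2 \<in> N" "f2 \<in> F2" "f2 A2 \<noteq> 0" by (auto simp: nonvanishing_def)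
  from join[OF A1(1) A2(1)] obtain D H \<tau>1 \<tau>2 where D: "poly D \<tau>1 \<noteq> 0" "poly D \<tau>2 \<noteq> 0"
    and H1: "\<forall>i<n. \<forall>j<n. poly D \<tau>1 * A1 $$ (i,j) = poly (H i j) \<tau>1"
    and H2: "\<forall>i<n. \<forall>j<n. poly D \<tau>2 * A2 $$ (i,j) = poly (H i j) \<tau>2"
    and M: "\<And>\<tau>. poly D \<tau> \<noteq> 0 \<Longrightarrow> \<exists>M\<in>N. \<forall>i<n. \<forall>j<n. poly D \<tau> * M $$ (i,j) = poly (H i j) \<tau>"
    unfolding joined_by_curve_def by blast
  from poly_fun_along_curve[of f1 n D H] A1 F1 obtain p1 N1 where
    p1: "\<And>\<tau> M. (\<forall>i<n. \<forall>j<n. poly D \<tau> * M $$ (i,j) = poly (H i j) \<tau>) \<Longrightarrow> poly D \<tau> ^ N1 * f1 M = poly p1 \<tau>"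
    by blast
  from poly_fun_along_curve[of f2 n D H] A2 F2 obtain p2 N2 where
    p2: "\<And>\<tau> M. (\<forall>i<n. \<forall>j<n. poly D \<tau> * M $$ (i,j) = poly (H i j) \<tau>) \<Longrightarrow> poly D \<tau> ^ N2 * f2 M = poly p2 \<tau>"
    by blast
  have "poly p1 \<tau>1 \<noteq> 0" "poly p2 \<tau>2 \<noteq> 0"
    using p1[OF H1] p2[OF H2] D A1(3) A2(3) by (metis mult_eq_0_iff power_not_zero)+
  hence "D * p1 * p2 \<noteq> 0" using D by auto
  from infinite_field_nonroot[OF inf this] obtain \<tau> where \<tau>: "poly (D * p1 * p2) \<tau> \<noteq> 0" .
  hence nz: "poly D \<tau> \<noteq> 0" "poly p1 \<tau> \<noteq> 0" "poly p2 \<tau> \<noteq> 0" by auto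
  from M[OF nz(1)] obtain A where A: "A \<in> N" "\<forall>i<n. \<forall>j<n. poly D \<tau> * A $$ (i,j) = poly (H i j) \<tau>" by auto
  have "f1 A \<noteq> 0" "f2 A \<noteq> 0" using p1[OF A(2)] p2[OF A(2)] nz by auto
  hence "A \<in> U1 \<inter> U2" using A(1) N A1(2) A2(2) unfolding F1(2) F2(2) nonvanishing_def by auto
  thus ?thesis by auto
qed

lemma has_jordan_type_unique:
  fixes A :: "'a::field mat"
  assumes "A \<in> carrier_mat n n" "has_jordan_type A P" "has_jordan_type A Q"
  shows "P = Q"
proof (rule partition_eqI)
  show "is_partition P" "is_partition Q" using assms has_jordan_typeD by blast+
  fix i
  have le: "sum_list (map (min i) R) \<le> n" if "has_jordan_type A R" for R
    using has_jordan_typeD(3)[OF that assms(1)] sum_list_diff_min[of i R] by simp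
  have "\<rho> + sum_list (map (min i) P) \<le> n \<longleftrightarrow> \<rho> + sum_list (map (min i) Q) \<le> n" for \<rho>
    using rank_ge_jordan_type[OF assms(2,1)] rank_ge_jordan_type[OF assms(3,1)] by blast
  from this[of "n - sum_list (map (min i) P)"] this[of "n - sum_list (map (min i) Q)"] le[OF assms(2)] le[OF assms(3)]
  show "sum_list (map (min i) P) = sum_list (map (min i) Q)" by simp
qed

lemma nilpotent_commutant_type:
  fixes B :: "'a::field mat"
  assumes "B \<in> carrier_mat n n" "A \<in> nilpotent_commutant B"
  shows "A \<in> carrier_mat n n" "\<exists>Q. has_jordan_type A Q"
proof -
  show A: "A \<in> carrier_mat n n" using assms by (auto simp: nilpotent_commutant_def commutant_def)
  from assms(2) obtain m where "A ^\<^sub>m m = 0\<^sub>m n n"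
    using A by (auto simp: nilpotent_commutant_def nilpotent_mat_def)
  thus "\<exists>Q. has_jordan_type A Q" using has_jordan_type_exists[OF A] by blast
qed

lemma zero_in_nilpotent_commutant:
  fixes B :: "'a::field mat"
  assumes B: "B \<in> carrier_mat n n"
  shows "0\<^sub>m n n \<in> nilpotent_commutant B"
proof -
  have "(0\<^sub>m n n :: 'a mat) ^\<^sub>m 1 = 0\<^sub>m n n" by simp
  hence "nilpotent_mat (0\<^sub>m n n :: 'a mat)" unfolding nilpotent_mat_def index_zero_mat by blast
  thus ?thesis using B by (simp add: nilpotent_commutant_def commutant_def)
qed

lemma sum_min_large:
  assumes "sum_list Q \<le> i"
  shows "sum_list (map (min i) Q) = sum_list (Q :: nat list)"
proof -
  have "map (min i) Q = Q"
    by (rule map_idI) (use member_le_sum_list[of _ Q] assms in \<open>fastforce simp: min_def\<close>)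
  thus ?thesis by simp
qed

text \<open>On the open set \<open>U\<close> where all ranks are at least those of a minimizer
  \<open>A0\<close> of the total nullity, minimality forces equality, so the type is constant.
  Uniqueness and the domination of all other ranks follow because every nonempty open set meets
  \<open>U\<close>.\<close>

lemma generic_jordan_type_exists:
  fixes B :: "'a::field mat"
  assumes B: "B \<in> carrier_mat n n"
    and meet: "\<And>U1 U2. openin (subtopology (zariski n) (nilpotent_commutant B)) U1 \<Longrightarrow> U1 \<noteq> {} \<Longrightarrow>
      openin (subtopology (zariski n) (nilpotent_commutant B)) U2 \<Longrightarrow> U2 \<noteq> {} \<Longrightarrow> U1 \<inter> U2 \<noteq> {}"
  shows "\<exists>Q. (\<forall>Q'. generic_jordan_type B Q' \<longleftrightarrow> Q' = Q) \<and> (\<exists>A\<in>nilpotent_commutant B. has_jordan_type A Q) \<and>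
    (\<forall>A\<in>nilpotent_commutant B. \<forall>i \<rho>. rank_ge n \<rho> (A ^\<^sub>m i) \<longrightarrow> \<rho> + sum_list (map (min i) Q) \<le> n)"
proof -
  define N where "N = nilpotent_commutant B"
  let ?T = "subtopology (zariski n) N"
  define ty where "ty A = (SOME Q. has_jordan_type A Q)" for A :: "'a mat"
  have NC: "A \<in> carrier_mat n n" if "A \<in> N" for A
    using nilpotent_commutant_type(1)[OF B] that by (simp add: N_def)
  have ty: "has_jordan_type A (ty A)" if "A \<in> N" for A
    unfolding ty_def using nilpotent_commutant_type(2)[OF B] that unfolding N_def by (metis someI_ex)
  \<comment> \<open>A single number has a minimum, whereas it is not yet known that the ranks of
    different powers can be maximal simultaneously.\<close>
  define s where "s A = (\<Sum>i\<le>n. sum_list (map (min i) (ty A)))" for A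
  have "\<exists>A0. A0 \<in> N \<and> (\<forall>A. A \<in> N \<longrightarrow> s A0 \<le> s A)"
    using zero_in_nilpotent_commutant[OF B] unfolding N_def[symmetric] by (rule ex_has_least_nat)
  then obtain A0 where A0: "A0 \<in> N" "\<And>A. A \<in> N \<Longrightarrow> s A0 \<le> s A" by blast
  define Q where "Q = ty A0"
  define \<sigma> where "\<sigma> i = sum_list (map (min i) Q)" for i
  have sQ: "sum_list Q = n" using has_jordan_typeD(3)[OF ty[OF A0(1)] NC[OF A0(1)]] by (simp add: Q_def)
  have \<sigma>n: "\<sigma> i \<le> n" for i using sum_list_diff_min[of i Q] sQ by (simp add: \<sigma>_def)
  have rk: "rank_ge n \<rho> (A ^\<^sub>m i) \<longleftrightarrow> \<rho> + sum_list (map (min i) (ty A)) \<le> n" if "A \<in> N" for A \<rho> i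
    by (rule rank_ge_jordan_type[OF ty[OF that] NC[OF that]])
  \<comment> \<open>A finite intersection: for i \<ge> n the sum of min(i, q) over the parts equals
    n for every type of size n.\<close>
  define U where "U = (\<Inter>i\<in>{..n}. N \<inter> {A \<in> carrier_mat n n. rank_ge n (n - \<sigma> i) (A ^\<^sub>m i)})"
  have oV: "openin ?T (N \<inter> {A \<in> carrier_mat n n. rank_ge n \<rho> (A ^\<^sub>m i)})" for i \<rho>
    using openin_zariski_rank_ge openin_subtopology by (metis inf_commute)
  have oU: "openin ?T U" unfolding U_def by (rule openin_INT2) (use oV in auto)
  have UN: "U \<subseteq> N" unfolding U_def by auto
  have A0U: "A0 \<in> U"
    unfolding U_def using A0(1) NC \<sigma>n by (auto simp: rk \<sigma>_def Q_def)
  have UQ: "ty A = Q" if A: "A \<in> U" for A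
  proof (rule partition_eqI)
    have AN: "A \<in> N" using A UN by auto
    show "is_partition (ty A)" "is_partition Q"
      using has_jordan_typeD(1)[OF ty[OF AN] NC[OF AN]] has_jordan_typeD(1)[OF ty[OF A0(1)] NC[OF A0(1)]]
      by (auto simp: Q_def)
    have le: "sum_list (map (min i) (ty A)) \<le> \<sigma> i" if "i \<le> n" for i
    proof -
      have "rank_ge n (n - \<sigma> i) (A ^\<^sub>m i)" using A that unfolding U_def by auto
      thus ?thesis unfolding rk[OF AN] using \<sigma>n[of i] by simp
    qed
    have "s A0 \<le> s A" using A0(2) AN by simp
    moreover have "s A0 = (\<Sum>i\<le>n. \<sigma> i)" by (simp add: s_def \<sigma>_def Q_def)
    ultimately have "(\<Sum>i\<le>n. \<sigma> i) \<le> (\<Sum>i\<le>n. sum_list (map (min i) (ty A)))" by (simp add: s_def)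
    moreover have "(\<Sum>i\<le>n. sum_list (map (min i) (ty A))) \<le> (\<Sum>i\<le>n. \<sigma> i)" by (rule sum_mono) (simp add: le)
    ultimately have eq: "(\<Sum>i\<le>n. sum_list (map (min i) (ty A))) = (\<Sum>i\<le>n. \<sigma> i)" by simp
    have small: "sum_list (map (min i) (ty A)) = \<sigma> i" if "i \<le> n" for i
      using sum_mono_inv[OF eq, of i] le that by auto
    fix i
    show "sum_list (map (min i) (ty A)) = sum_list (map (min i) Q)"
    proof (cases "i \<le> n")
      case True
      then show ?thesis using small by (simp add: \<sigma>_def)
    next
      case False
      then show ?thesis
        using sum_min_large[of "ty A" i] sum_min_large[of Q i] sQ has_jordan_typeD(3)[OF ty[OF AN] NC[OF AN]] by simp
    qed
  qed
  have gen: "generic_jordan_type B Q"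
    unfolding generic_jordan_type_def
  proof (intro exI[of _ U] conjI ballI)
    show "openin (subtopology (zariski (dim_row B)) (nilpotent_commutant B)) U"
      using oU B by (simp add: N_def)
    show "U \<noteq> {}" using A0U by auto
    fix A assume "A \<in> U"
    thus "has_jordan_type A Q" using UQ ty UN by (metis subsetD)
  qed
  have uniq: "Q' = Q" if g: "generic_jordan_type B Q'" for Q'
  proof -
    from g obtain U' where U': "openin ?T U'" "U' \<noteq> {}" "\<And>A. A \<in> U' \<Longrightarrow> has_jordan_type A Q'"
      unfolding generic_jordan_type_def N_def using B by auto
    from meet[of U U'] oU A0U U' obtain A where A: "A \<in> U" "A \<in> U'" unfolding N_def by blast
    hence "has_jordan_type A Q" using UQ ty UN by (metis subsetD)
    with U'(3)[OF A(2)] NC[of A] A(1) UN show ?thesis using has_jordan_type_unique by blast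
  qed
  have dom: "\<rho> + sum_list (map (min i) Q) \<le> n" if A: "A \<in> N" "rank_ge n \<rho> (A ^\<^sub>m i)" for A i \<rho>
  proof -
    have "N \<inter> {A \<in> carrier_mat n n. rank_ge n \<rho> (A ^\<^sub>m i)} \<noteq> {}" using A NC by auto
    with meet[of U] oU A0U oV[of \<rho> i]
    obtain A' where A': "A' \<in> U" "rank_ge n \<rho> (A' ^\<^sub>m i)" unfolding N_def by blast
    thus ?thesis using rk[of A'] UQ[of A'] UN by auto
  qed
  show ?thesis
    using gen uniq dom ty[OF A0(1)] A0(1) unfolding N_def Q_def by blast
qed

subsection \<open>The commutant of a nilpotent Jordan matrix\<close>

lemma commutantI:
  assumes "A \<in> carrier_mat n n" "B \<in> carrier_mat n n" "A * B = B * A"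
  shows "A \<in> commutant B"
  using assms by (simp add: commutant_def)

lemma commutantD:
  assumes "A \<in> commutant B" "B \<in> carrier_mat n n"
  shows "A \<in> carrier_mat n n" "A * B = B * A"
  using assms by (auto simp: commutant_def)

lemma commutant_mult:
  fixes B :: "'a::comm_ring_1 mat"
  assumes B: "B \<in> carrier_mat n n" and X: "X \<in> commutant B" and Y: "Y \<in> commutant B"
  shows "X * Y \<in> commutant B"
proof (rule commutantI[OF _ B])
  note X = commutantD[OF X B] and Y = commutantD[OF Y B]
  have "X * Y * B = X * (Y * B)" using X Y B by (intro assoc_mult_mat) auto
  also have "\<dots> = X * B * Y" unfolding Y(2) using X Y B by (intro assoc_mult_mat[symmetric]) auto
  also have "\<dots> = B * (X * Y)" unfolding X(2) using X Y B by (intro assoc_mult_mat) auto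
  finally show "X * Y * B = B * (X * Y)" .
  show "X * Y \<in> carrier_mat n n" using X Y by simp
qed

lemma commutant_inverse:
  fixes B :: "'a::comm_ring_1 mat"
  assumes B: "B \<in> carrier_mat n n" and X: "X \<in> commutant B" and Y: "Y \<in> carrier_mat n n"
    and inv: "X * Y = 1\<^sub>m n" "Y * X = 1\<^sub>m n"
  shows "Y \<in> commutant B"
proof (rule commutantI[OF Y B])
  note X = commutantD[OF X B]
  have "Y * B = Y * B * (X * Y)" unfolding inv using B Y by simp
  also have "\<dots> = Y * (B * (X * Y))" using X Y B by (intro assoc_mult_mat) auto
  also have "B * (X * Y) = B * X * Y" using X Y B by (intro assoc_mult_mat[symmetric]) auto
  also have "\<dots> = X * B * Y" using X by simp
  also have "\<dots> = X * (B * Y)" using X Y B by (intro assoc_mult_mat) auto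
  also have "Y * \<dots> = Y * X * (B * Y)" using X Y B by (intro assoc_mult_mat[symmetric]) auto
  finally show "Y * B = B * Y" unfolding inv using B Y by simp
qed

lemma commutant_lincomb:
  fixes B :: "'a::comm_ring_1 mat"
  assumes B: "B \<in> carrier_mat n n" and X: "X \<in> commutant B" and Y: "Y \<in> commutant B"
  shows "mat n n (\<lambda>ij. s * X $$ ij + t * Y $$ ij) \<in> commutant B"
proof (rule commutantI[OF _ B])
  note X = commutantD[OF X B] and Y = commutantD[OF Y B]
  let ?Z = "mat n n (\<lambda>ij. s * X $$ ij + t * Y $$ ij)"
  show Z: "?Z \<in> carrier_mat n n" by simp
  show "?Z * B = B * ?Z"
  proof (rule eq_matI)
    fix i j assume "i < dim_row (B * ?Z)" "j < dim_col (B * ?Z)"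
    hence ij: "i < n" "j < n" using B by auto
    have XB: "(\<Sum>k<n. X $$ (i,k) * B $$ (k,j)) = (\<Sum>k<n. B $$ (i,k) * X $$ (k,j))"
      unfolding mult_mat_entry[OF X(1) B ij, symmetric] mult_mat_entry[OF B X(1) ij, symmetric] X(2) ..
    have YB: "(\<Sum>k<n. Y $$ (i,k) * B $$ (k,j)) = (\<Sum>k<n. B $$ (i,k) * Y $$ (k,j))"
      unfolding mult_mat_entry[OF Y(1) B ij, symmetric] mult_mat_entry[OF B Y(1) ij, symmetric] Y(2) ..
    have "(?Z * B) $$ (i,j) = (\<Sum>k<n. s * (X $$ (i,k) * B $$ (k,j)) + t * (Y $$ (i,k) * B $$ (k,j)))"
      unfolding mult_mat_entry[OF Z B ij] by (rule sum.cong) (use ij in \<open>simp_all add: algebra_simps\<close>)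
    also have "\<dots> = s * (\<Sum>k<n. X $$ (i,k) * B $$ (k,j)) + t * (\<Sum>k<n. Y $$ (i,k) * B $$ (k,j))"
      by (simp add: sum.distrib sum_distrib_left)
    also have "\<dots> = (\<Sum>k<n. s * (B $$ (i,k) * X $$ (k,j)) + t * (B $$ (i,k) * Y $$ (k,j)))"
      unfolding XB YB by (simp add: sum.distrib sum_distrib_left)
    also have "\<dots> = (B * ?Z) $$ (i,j)"
      unfolding mult_mat_entry[OF B Z ij] by (rule sum.cong) (use ij in \<open>simp_all add: algebra_simps\<close>)
    finally show "(?Z * B) $$ (i,j) = (B * ?Z) $$ (i,j)" .
  qed (use B in auto)
qed

lemma commutant_one: "B \<in> carrier_mat n n \<Longrightarrow> 1\<^sub>m n \<in> commutant (B :: 'a::comm_ring_1 mat)"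
  by (simp add: commutant_def)

lemma commutant_pow:
  fixes B :: "'a::comm_ring_1 mat"
  assumes B: "B \<in> carrier_mat n n" and X: "X \<in> commutant B"
  shows "X ^\<^sub>m k \<in> commutant B"
proof (induction k)
  case 0
  have "dim_row X = n" using commutantD[OF X B] by simp
  then show ?case using commutant_one[OF B] by simp
next
  case (Suc k)
  then show ?case using commutant_mult[OF B Suc X] by simp
qed

section \<open>The partial order on the Jordan basis\<close>

definition size_at :: "nat list \<Rightarrow> nat \<Rightarrow> nat" where
  "size_at P k = P ! block_of P k"

text \<open>The first two conditions hold for every nonzero entry of a matrix commuting with \<open>J P\<close>; \<open>ord\<close> breaks the ties.\<close>

definition step :: "nat list \<Rightarrow> (nat \<Rightarrow> nat) \<Rightarrow> nat \<Rightarrow> nat \<Rightarrow> bool" where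
  "step P ord c r \<longleftrightarrow> level_of P c \<le> level_of P r \<and>
     level_of P c + size_at P r \<le> level_of P r + size_at P c \<and>
     (size_at P r = size_at P c \<longrightarrow> level_of P r = level_of P c \<longrightarrow> ord (block_of P c) < ord (block_of P r))"

lemma step_trans: "step P ord a b \<Longrightarrow> step P ord b c \<Longrightarrow> step P ord a c"
  unfolding step_def by (intro conjI impI) linarith+

lemma step_irrefl: "\<not> step P ord a a"
  unfolding step_def by simp

text \<open>\<open>ord\<close> stays a parameter: conjugation produces reversed positions among the
  blocks of equal size, the explicit matrices use the block number, and the bounds hold for every
  choice.\<close>

definition strict_part :: "nat list \<Rightarrow> (nat \<Rightarrow> nat) \<Rightarrow> 'a::comm_ring_1 mat set" where
  "strict_part P ord = {X \<in> commutant (J P). \<forall>r<sum_list P. \<forall>c<sum_list P. X $$ (r,c) \<noteq> 0 \<longrightarrow> step P ord c r}"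

lemma level_less: "k < sum_list P \<Longrightarrow> level_of P k < size_at P k"
  by (simp add: size_at_def index_props)

lemma J_mult_right_entry:
  fixes A :: "'a::comm_ring_1 mat"
  assumes A: "A \<in> carrier_mat (sum_list P) (sum_list P)" and rc: "r < sum_list P" "c < sum_list P"
  shows "(A * J P) $$ (r,c) = (if Suc (level_of P c) < size_at P c
    then A $$ (r, index_of P (block_of P c) (Suc (level_of P c))) else 0)"
proof -
  have eq: "(A * J P) $$ (r,c) = (\<Sum>d<sum_list P. A $$ (r,d) *
      (if block_of P d = block_of P c \<and> level_of P d = Suc (level_of P c) then 1 else 0))"
    unfolding mult_mat_entry[OF A J_carrier rc] by (rule sum.cong) (use rc in \<open>auto simp: J_entry\<close>)
  show ?thesis
  proof (cases "Suc (level_of P c) < size_at P c")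
    case True
    define d0 where "d0 = index_of P (block_of P c) (Suc (level_of P c))"
    have d0: "d0 < sum_list P" "block_of P d0 = block_of P c" "level_of P d0 = Suc (level_of P c)"
      using index_of_props[of "block_of P c" P "Suc (level_of P c)"] index_props(1)[OF rc(2)] True
      by (auto simp: d0_def size_at_def)
    have "(\<Sum>d<sum_list P. A $$ (r,d) *
      (if block_of P d = block_of P c \<and> level_of P d = Suc (level_of P c) then 1 else 0))
      = (\<Sum>d<sum_list P. if d = d0 then A $$ (r,d) else 0)"
    proof (rule sum.cong[OF refl])
      fix d assume "d \<in> {..<sum_list P}"
      thus "A $$ (r,d) * (if block_of P d = block_of P c \<and> level_of P d = Suc (level_of P c) then 1 else 0)
        = (if d = d0 then A $$ (r,d) else 0)"
        using d0 index_eqI[of d P d0] by (cases "d = d0") auto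
    qed
    thus ?thesis using eq True d0 by (simp add: d0_def)
  next
    case False
    have "level_of P d \<noteq> Suc (level_of P c)" if "d < sum_list P" "block_of P d = block_of P c" for d
      using level_less[OF that(1)] False that(2) by (auto simp: size_at_def)
    hence "(\<Sum>d<sum_list P. A $$ (r,d) *
      (if block_of P d = block_of P c \<and> level_of P d = Suc (level_of P c) then 1 else 0)) = 0"
      by (intro sum.neutral) auto
    thus ?thesis using eq False by simp
  qed
qed

lemma J_mult_left_entry:
  fixes A :: "'a::comm_ring_1 mat"
  assumes A: "A \<in> carrier_mat (sum_list P) (sum_list P)" and rc: "r < sum_list P" "c < sum_list P"
  shows "(J P * A) $$ (r,c) = (if 0 < level_of P r
    then A $$ (index_of P (block_of P r) (level_of P r - 1), c) else 0)"
proof -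
  have eq: "(J P * A) $$ (r,c) = (\<Sum>d<sum_list P.
      (if block_of P r = block_of P d \<and> level_of P r = Suc (level_of P d) then 1 else 0) * A $$ (d,c))"
    unfolding mult_mat_entry[OF J_carrier A rc] by (rule sum.cong) (use rc in \<open>auto simp: J_entry\<close>)
  show ?thesis
  proof (cases "0 < level_of P r")
    case True
    define d0 where "d0 = index_of P (block_of P r) (level_of P r - 1)"
    have d0: "d0 < sum_list P" "block_of P d0 = block_of P r" "Suc (level_of P d0) = level_of P r"
      using index_of_props[of "block_of P r" P "level_of P r - 1"] index_props(1,2)[OF rc(1)] True
      by (auto simp: d0_def)
    have "(\<Sum>d<sum_list P. (if block_of P r = block_of P d \<and> level_of P r = Suc (level_of P d) then 1 else 0) * A $$ (d,c))
      = (\<Sum>d<sum_list P. if d = d0 then A $$ (d,c) else 0)"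
    proof (rule sum.cong[OF refl])
      fix d assume "d \<in> {..<sum_list P}"
      thus "(if block_of P r = block_of P d \<and> level_of P r = Suc (level_of P d) then 1 else 0) * A $$ (d,c)
        = (if d = d0 then A $$ (d,c) else 0)"
        using d0 index_eqI[of d P d0] by (cases "d = d0") auto
    qed
    thus ?thesis using eq True d0 by (simp add: d0_def)
  next
    case False
    thus ?thesis using eq by simp
  qed
qed

lemma commutant_J_iff:
  fixes A :: "'a::comm_ring_1 mat"
  assumes A: "A \<in> carrier_mat (sum_list P) (sum_list P)"
  shows "A \<in> commutant (J P) \<longleftrightarrow> (\<forall>r<sum_list P. \<forall>c<sum_list P.
    (if Suc (level_of P c) < size_at P c then A $$ (r, index_of P (block_of P c) (Suc (level_of P c))) else 0) =
    (if 0 < level_of P r then A $$ (index_of P (block_of P r) (level_of P r - 1), c) else 0))"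
  (is "_ \<longleftrightarrow> ?R")
proof
  assume "A \<in> commutant (J P)"
  hence "A * J P = J P * A" by (simp add: commutant_def)
  thus ?R using J_mult_right_entry[OF A] J_mult_left_entry[OF A] by metis
next
  assume R: ?R
  have "A * J P = J P * A"
  proof (rule eq_matI)
    fix r c assume "r < dim_row (J P * A)" "c < dim_col (J P * A)"
    hence "r < sum_list P" "c < sum_list P" using A by auto
    thus "(A * J P) $$ (r,c) = (J P * A) $$ (r,c)"
      using R J_mult_right_entry[OF A] J_mult_left_entry[OF A] by metis
  qed (use A in auto)
  thus "A \<in> commutant (J P)" by (rule commutantI[OF A J_carrier])
qed

text \<open>Comparing entries of A J and J A: for each pair of blocks the entries are constant along
  diagonals, and a diagonal that meets row level 0 at a positive column level vanishes.\<close>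

lemma commutant_J_shift:
  fixes A :: "'a::comm_ring_1 mat"
  assumes A: "A \<in> commutant (J P)" and r: "i < length P" "j < P ! i" and c: "i' < length P" "Suc j' < P ! i'"
  shows "A $$ (index_of P i j, index_of P i' (Suc j')) = (if 0 < j then A $$ (index_of P i (j - 1), index_of P i' j') else 0)"
proof -
  have j': "j' < P ! i'" using c by simp
  note pr = index_of_props[OF r] and pc = index_of_props[OF c(1) j']
  have "A \<in> carrier_mat (sum_list P) (sum_list P)" using commutantD[OF A J_carrier] by simp
  from commutant_J_iff[OF this] A have "(if Suc (level_of P (index_of P i' j')) < size_at P (index_of P i' j')
      then A $$ (index_of P i j, index_of P (block_of P (index_of P i' j')) (Suc (level_of P (index_of P i' j')))) else 0) =
    (if 0 < level_of P (index_of P i j)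
      then A $$ (index_of P (block_of P (index_of P i j)) (level_of P (index_of P i j) - 1), index_of P i' j') else 0)"
    using pr(1) pc(1) by blast
  thus ?thesis using pr pc c by (simp add: size_at_def)
qed

text \<open>J kills the top vector of a block, hence also its image, which therefore consists of top
  vectors.\<close>

lemma commutant_J_shift_end:
  fixes A :: "'a::comm_ring_1 mat"
  assumes A: "A \<in> commutant (J P)" and r: "i < length P" "Suc j < P ! i" and c: "i' < length P" "Suc j' = P ! i'"
  shows "A $$ (index_of P i j, index_of P i' j') = 0"
proof -
  have j': "j' < P ! i'" using c by simp
  note pr = index_of_props[OF r] and pc = index_of_props[OF c(1) j']
  have "A \<in> carrier_mat (sum_list P) (sum_list P)" using commutantD[OF A J_carrier] by simp
  from commutant_J_iff[OF this] A have "(if Suc (level_of P (index_of P i' j')) < size_at P (index_of P i' j')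
      then A $$ (index_of P i (Suc j), index_of P (block_of P (index_of P i' j')) (Suc (level_of P (index_of P i' j')))) else 0) =
    (if 0 < level_of P (index_of P i (Suc j))
      then A $$ (index_of P (block_of P (index_of P i (Suc j))) (level_of P (index_of P i (Suc j)) - 1), index_of P i' j') else 0)"
    using pr(1) pc(1) by blast
  thus ?thesis using pr pc c by (simp add: size_at_def)
qed

lemma commutant_J_level_mono:
  fixes A :: "'a::comm_ring_1 mat"
  assumes A: "A \<in> commutant (J P)" and "i < length P" "j < P ! i" "i' < length P" "j' < P ! i'" "j < j'"
  shows "A $$ (index_of P i j, index_of P i' j') = 0"
  using assms(3,5,6)
proof (induction j' arbitrary: j)
  case 0
  then show ?case by simp
next
  case (Suc j')
  then show ?case using commutant_J_shift[OF A assms(2) Suc.prems(1) assms(4) Suc.prems(2)] by simp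
qed

text \<open>\<open>d\<close> is the distance of the column from the top of its block. Moving up the
  diagonal by \<open>d\<close> steps reaches the situation of
  \<open>commutant_J_shift_end\<close>.\<close>

lemma commutant_J_colevel_mono:
  fixes A :: "'a::comm_ring_1 mat"
  assumes A: "A \<in> commutant (J P)" and "i < length P" "i' < length P" "j + d < P ! i" "Suc (j' + d) = P ! i'"
    "j + d < P ! i - 1"
  shows "A $$ (index_of P i j, index_of P i' j') = 0"
  using assms(4-6)
proof (induction d arbitrary: j j')
  case 0
  then show ?case using commutant_J_shift_end[OF A assms(2) _ assms(3), of j j'] by simp
next
  case (Suc d)
  have "A $$ (index_of P i (Suc j), index_of P i' (Suc j')) = 0" using Suc by simp
  thus ?case using commutant_J_shift[OF A assms(2) _ assms(3), of "Suc j" j'] Suc.prems by simp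
qed

text \<open>A commuting matrix preserves the images and the kernels of the powers of J: the level
  does not drop, and the distance to the top of the block, size minus level, does not grow.\<close>

lemma commutant_J_entry_nonzero:
  fixes A :: "'a::comm_ring_1 mat"
  assumes A: "A \<in> commutant (J P)" and rc: "r < sum_list P" "c < sum_list P" and nz: "A $$ (r,c) \<noteq> 0"
  shows "level_of P c \<le> level_of P r" "level_of P c + size_at P r \<le> level_of P r + size_at P c"
proof -
  note r = index_props[OF rc(1)] and c = index_props[OF rc(2)]
  show "level_of P c \<le> level_of P r"
    using commutant_J_level_mono[OF A r(1,2) c(1,2)] nz r(3) c(3) by (metis not_le)
  show "level_of P c + size_at P r \<le> level_of P r + size_at P c"
  proof (rule ccontr)
    assume "\<not> ?thesis"
    hence lt: "level_of P r + P ! block_of P c < level_of P c + P ! block_of P r" by (simp add: size_at_def)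
    have "A $$ (index_of P (block_of P r) (level_of P r), index_of P (block_of P c) (level_of P c)) = 0"
      by (rule commutant_J_colevel_mono[OF A r(1) c(1), where d = "P ! block_of P c - 1 - level_of P c"])
         (use lt c(2) in linarith)+
    thus False using nz r(3) c(3) by simp
  qed
qed

lemma commutant_J_same_level:
  fixes A :: "'a::comm_ring_1 mat"
  assumes A: "A \<in> commutant (J P)" and "i < length P" "j < P ! i" "i' < length P" "j < P ! i'"
  shows "A $$ (index_of P i j, index_of P i' j) = A $$ (index_of P i 0, index_of P i' 0)"
  using assms(3,5)
proof (induction j)
  case (Suc j)
  then show ?case using commutant_J_shift[OF A assms(2) Suc.prems(1) assms(4) Suc.prems(2)] by simp
qed simp

text \<open>\<open>a i i' d\<close> is the coefficient of the vector of level \<open>d\<close> in block \<open>i'\<close> in the image of the vector of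
  level 0 in block \<open>i\<close>.\<close>

definition toeplitz :: "nat list \<Rightarrow> (nat \<Rightarrow> nat \<Rightarrow> nat \<Rightarrow> 'a::zero) \<Rightarrow> 'a mat" where
  "toeplitz P a = mat (sum_list P) (sum_list P) (\<lambda>(r,c). if level_of P c \<le> level_of P r
     then a (block_of P c) (block_of P r) (level_of P r - level_of P c) else 0)"

lemma toeplitz_carrier [simp]: "toeplitz P a \<in> carrier_mat (sum_list P) (sum_list P)"
  by (simp add: toeplitz_def)

lemma toeplitz_entry:
  "r < sum_list P \<Longrightarrow> c < sum_list P \<Longrightarrow> toeplitz P a $$ (r,c) = (if level_of P c \<le> level_of P r
     then a (block_of P c) (block_of P r) (level_of P r - level_of P c) else 0)"
  by (simp add: toeplitz_def)

text \<open>A vector of level 0 in block \<open>i\<close> is killed by the power P ! i of J, so its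
  image has to be. A component of level \<open>d\<close> in block \<open>i'\<close> satisfies this
  exactly if P ! i' - d \<le> P ! i.\<close>

lemma toeplitz_commutant:
  fixes a :: "nat \<Rightarrow> nat \<Rightarrow> nat \<Rightarrow> 'a::comm_ring_1"
  assumes a: "\<And>i i' d. i < length P \<Longrightarrow> i' < length P \<Longrightarrow> a i i' d \<noteq> 0 \<Longrightarrow> P ! i' \<le> d + P ! i"
  shows "toeplitz P a \<in> commutant (J P)"
  unfolding commutant_J_iff[OF toeplitz_carrier]
proof (intro allI impI)
  fix r c assume rc: "r < sum_list P" "c < sum_list P"
  note r = index_props[OF rc(1)] and c = index_props[OF rc(2)]
  let ?i = "block_of P c" and ?i' = "block_of P r" and ?j = "level_of P c" and ?j' = "level_of P r"
  have L: "toeplitz P a $$ (r, index_of P ?i (Suc ?j)) = (if Suc ?j \<le> ?j' then a ?i ?i' (?j' - Suc ?j) else 0)"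
    if "Suc ?j < size_at P c"
    using that index_of_props[OF c(1), of "Suc ?j"] rc by (simp add: toeplitz_entry size_at_def)
  have R: "toeplitz P a $$ (index_of P ?i' (?j' - 1), c) = (if ?j \<le> ?j' - 1 then a ?i ?i' (?j' - 1 - ?j) else 0)"
    if "0 < ?j'"
    using that index_of_props[OF r(1), of "?j' - 1"] rc r by (simp add: toeplitz_entry)
  show "(if Suc ?j < size_at P c then toeplitz P a $$ (r, index_of P ?i (Suc ?j)) else 0) =
    (if 0 < ?j' then toeplitz P a $$ (index_of P ?i' (?j' - 1), c) else 0)"
  proof (cases "Suc ?j < size_at P c")
    case True
    then show ?thesis using L R by auto
  next
    case False
    hence "size_at P c = Suc ?j" using level_less[OF rc(2)] by simp
    hence "a ?i ?i' (?j' - 1 - ?j) = 0" if "0 < ?j'" "?j \<le> ?j' - 1"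
      using a[OF c(1) r(1), of "?j' - 1 - ?j"] r(2) that by (fastforce simp: size_at_def)
    then show ?thesis using False R by auto
  qed
qed

lemma strict_partI:
  fixes X :: "'a::comm_ring_1 mat"
  assumes "X \<in> commutant (J P)"
    "\<And>r c. r < sum_list P \<Longrightarrow> c < sum_list P \<Longrightarrow> X $$ (r,c) \<noteq> 0 \<Longrightarrow> size_at P r = size_at P c \<Longrightarrow>
      level_of P r = level_of P c \<Longrightarrow> ord (block_of P c) < ord (block_of P r)"
  shows "X \<in> strict_part P ord"
  unfolding strict_part_def step_def using assms commutant_J_entry_nonzero[OF assms(1)] by blast

lemma strict_partD:
  fixes X :: "'a::comm_ring_1 mat"
  assumes "X \<in> strict_part P ord"
  shows "X \<in> commutant (J P)" "X \<in> carrier_mat (sum_list P) (sum_list P)"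
    "r < sum_list P \<Longrightarrow> c < sum_list P \<Longrightarrow> X $$ (r,c) \<noteq> 0 \<Longrightarrow> step P ord c r"
  using assms commutantD[of X "J P", OF _ J_carrier] by (auto simp: strict_part_def)

text \<open>The entry of a power is a sum over paths; transitivity of \<open>step\<close> turns a
  path of \<open>k\<close> steps into a chain of \<open>k + 1\<close> distinct vectors.\<close>

lemma pow_entry_chain:
  fixes X :: "'a::comm_ring_1 mat"
  assumes X: "X \<in> strict_part P ord" and rc: "r < sum_list P" "c < sum_list P" and nz: "(X ^\<^sub>m k) $$ (r,c) \<noteq> 0"
  shows "\<exists>C. C \<subseteq> {..<sum_list P} \<and> card C = Suc k \<and> r \<in> C \<and> (\<forall>a\<in>C. a = r \<or> step P ord a r) \<and>
    (\<forall>a\<in>C. \<forall>b\<in>C. a = b \<or> step P ord a b \<or> step P ord b a)"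
  using rc(1) nz
proof (induction k arbitrary: r)
  case 0
  then show ?case by (intro exI[of _ "{r}"]) auto
next
  case (Suc k)
  note X' = strict_partD[OF X]
  have "(X ^\<^sub>m Suc k) $$ (r,c) = (\<Sum>d<sum_list P. X $$ (r,d) * (X ^\<^sub>m k) $$ (d,c))"
    unfolding pow_mat_Suc_left[OF X'(2)]
    by (rule mult_mat_entry[OF X'(2) pow_carrier_mat[OF X'(2)] Suc.prems(1) rc(2)])
  with Suc.prems(2) obtain d where d: "d < sum_list P" "X $$ (r,d) * (X ^\<^sub>m k) $$ (d,c) \<noteq> 0"
    by (metis (mono_tags, lifting) lessThan_iff sum.neutral)
  have nz: "X $$ (r,d) \<noteq> 0" "(X ^\<^sub>m k) $$ (d,c) \<noteq> 0" using d(2) mult_zero_left mult_zero_right by metis+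
  have st: "step P ord d r" by (rule X'(3)[OF Suc.prems(1) d(1) nz(1)])
  from Suc.IH[OF d(1) nz(2)] obtain C where C: "C \<subseteq> {..<sum_list P}" "card C = Suc k" "d \<in> C"
    "\<forall>a\<in>C. a = d \<or> step P ord a d" "\<forall>a\<in>C. \<forall>b\<in>C. a = b \<or> step P ord a b \<or> step P ord b a" by blast
  have below: "step P ord a r" if "a \<in> C" for a
    using bspec[OF C(4) that] st step_trans[of P ord a d r] by auto
  have "r \<notin> C" using below step_irrefl by blast
  moreover have "finite C" using C(1) finite_subset by blast
  ultimately show ?case
    using C below Suc.prems(1) by (intro exI[of _ "insert r C"]) auto
qed

lemma strict_part_nilpotent:
  fixes X :: "'a::comm_ring_1 mat"
  assumes X: "X \<in> strict_part P ord"
  shows "X ^\<^sub>m sum_list P = 0\<^sub>m (sum_list P) (sum_list P)"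
proof (rule eq_matI)
  note X' = strict_partD[OF X]
  fix r c assume "r < dim_row (0\<^sub>m (sum_list P) (sum_list P) :: 'a mat)" "c < dim_col (0\<^sub>m (sum_list P) (sum_list P) :: 'a mat)"
  hence rc: "r < sum_list P" "c < sum_list P" by auto
  have "(X ^\<^sub>m sum_list P) $$ (r,c) = 0"
  proof (rule ccontr)
    assume "\<not> ?thesis"
    from pow_entry_chain[OF X rc this] obtain C where "C \<subseteq> {..<sum_list P}" "card C = Suc (sum_list P)" by blast
    thus False using card_mono[of "{..<sum_list P}" C] by simp
  qed
  thus "(X ^\<^sub>m sum_list P) $$ (r,c) = 0\<^sub>m (sum_list P) (sum_list P) $$ (r,c)" using rc by simp
qed (use strict_partD[OF X] in auto)

lemma strict_part_subset:
  "strict_part P ord \<subseteq> (nilpotent_commutant (J P) :: 'a::comm_ring_1 mat set)"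
proof
  fix X :: "'a mat" assume X: "X \<in> strict_part P ord"
  have "dim_row X = sum_list P" using strict_partD(2)[OF X] by simp
  hence "nilpotent_mat X" unfolding nilpotent_mat_def using strict_part_nilpotent[OF X] by auto
  thus "X \<in> nilpotent_commutant (J P)" using strict_partD(1)[OF X] by (simp add: nilpotent_commutant_def)
qed

subsection \<open>Irreducibility of the nilpotent commutant\<close>

definition size_class :: "nat list \<Rightarrow> nat \<Rightarrow> nat set" where
  "size_class P p = {i. i < length P \<and> P ! i = p}"

text \<open>\<open>pos i\<close> is the position of the block \<open>i\<close> among the blocks of the same size,
  and \<open>e p a\<close> is the block of size \<open>p\<close> at position \<open>a\<close>.\<close>

definition enumerates :: "nat list \<Rightarrow> (nat \<Rightarrow> nat \<Rightarrow> nat) \<Rightarrow> (nat \<Rightarrow> nat) \<Rightarrow> bool" where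
  "enumerates P e pos \<longleftrightarrow>
    (\<forall>p. \<forall>a<card (size_class P p). e p a < length P \<and> P ! e p a = p \<and> pos (e p a) = a) \<and>
    (\<forall>i<length P. pos i < card (size_class P (P ! i)) \<and> e (P ! i) (pos i) = i)"

lemma enumerates_exists: "\<exists>e pos. enumerates P e pos"
proof -
  have "\<exists>h. bij_betw h {..<card (size_class P p)} (size_class P p)" for p
    using ex_bij_betw_nat_finite[of "size_class P p"] by (simp add: size_class_def atLeast0LessThan)
  then obtain e where e: "\<And>p. bij_betw (e p) {..<card (size_class P p)} (size_class P p)" by metis
  define pos where "pos i = the_inv_into {..<card (size_class P (P ! i))} (e (P ! i)) i" for i
  have 1: "e p a < length P" "P ! e p a = p" if "a < card (size_class P p)" for p a
  proof -
    have "e p a \<in> size_class P p" using bij_betw_apply[OF e] that by auto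
    thus "e p a < length P" "P ! e p a = p" by (auto simp: size_class_def)
  qed
  have 2: "pos (e p a) = a" if "a < card (size_class P p)" for p a
    unfolding pos_def using 1[OF that] bij_betw_imp_inj_on[OF e] that by (simp add: the_inv_into_f_f)
  have 3: "pos i < card (size_class P (P ! i)) \<and> e (P ! i) (pos i) = i" if "i < length P" for i
  proof -
    have "i \<in> e (P ! i) ` {..<card (size_class P (P ! i))}"
      using e[of "P ! i"] that by (simp add: bij_betw_def size_class_def)
    then obtain a where "a < card (size_class P (P ! i))" "e (P ! i) a = i" by auto
    with 2[OF this(1)] show ?thesis by auto
  qed
  show ?thesis unfolding enumerates_def using 1 2 3 by blast
qed

section \<open>The quotient of the commutant by its radical\<close>

context
  fixes P :: "nat list" and e :: "nat \<Rightarrow> nat \<Rightarrow> nat" and pos :: "nat \<Rightarrow> nat"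
  assumes en: "enumerates P e pos"
begin

lemma enumerates_e:
  assumes "a < card (size_class P p)"
  shows "e p a < length P" "P ! e p a = p" "pos (e p a) = a"
  using en assms by (auto simp: enumerates_def)

lemma enumerates_pos:
  assumes "i < length P"
  shows "pos i < card (size_class P (P ! i))" "e (P ! i) (pos i) = i"
  using en assms by (auto simp: enumerates_def)

text \<open>The commutant modulo its radical is a product of full matrix algebras, one for each
  block size \<open>p\<close>, whose dimension is the number of blocks of that size squared. This is
  the component at \<open>p\<close>; \<open>block_diagonal\<close> is a section of the quotient
  map.\<close>

definition degree_part :: "nat \<Rightarrow> 'a mat \<Rightarrow> 'a mat" where
  "degree_part p A = mat (card (size_class P p)) (card (size_class P p))
     (\<lambda>(a,b). A $$ (index_of P (e p a) 0, index_of P (e p b) 0))"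

definition block_diagonal :: "(nat \<Rightarrow> 'a::zero mat) \<Rightarrow> 'a mat" where
  "block_diagonal S = toeplitz P (\<lambda>i i' d. if d = 0 \<and> P ! i = P ! i' then S (P ! i) $$ (pos i', pos i) else 0)"

lemma degree_part_carrier [simp]:
  "degree_part p A \<in> carrier_mat (card (size_class P p)) (card (size_class P p))"
  by (simp add: degree_part_def)

lemma block_diagonal_carrier [simp]: "block_diagonal S \<in> carrier_mat (sum_list P) (sum_list P)"
  by (simp add: block_diagonal_def)

lemma degree_part_dim [simp]:
  "dim_row (degree_part p A) = card (size_class P p)" "dim_col (degree_part p A) = card (size_class P p)"
  by (simp_all add: degree_part_def)

lemma block_diagonal_dim [simp]:
  "dim_row (block_diagonal S) = sum_list P" "dim_col (block_diagonal S) = sum_list P"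
  by (simp_all add: block_diagonal_def toeplitz_def)

lemma block_diagonal_commutant:
  "block_diagonal (S :: nat \<Rightarrow> 'a::comm_ring_1 mat) \<in> commutant (J P)"
  unfolding block_diagonal_def by (rule toeplitz_commutant) (auto split: if_splits)

lemma block_diagonal_entry:
  "r < sum_list P \<Longrightarrow> c < sum_list P \<Longrightarrow> block_diagonal S $$ (r,c) =
    (if level_of P r = level_of P c \<and> size_at P r = size_at P c
     then S (size_at P r) $$ (pos (block_of P r), pos (block_of P c)) else 0)"
  by (auto simp: block_diagonal_def toeplitz_entry size_at_def)

lemma sum_same_level_size:
  fixes f :: "nat \<Rightarrow> 'a::comm_monoid_add"
  assumes j: "j < p" and z: "\<And>d. d < sum_list P \<Longrightarrow> \<not> (level_of P d = j \<and> size_at P d = p) \<Longrightarrow> f d = 0"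
  shows "(\<Sum>d<sum_list P. f d) = (\<Sum>a<card (size_class P p). f (index_of P (e p a) j))"
proof -
  have ix: "index_of P (e p a) j < sum_list P" "block_of P (index_of P (e p a) j) = e p a"
    "level_of P (index_of P (e p a) j) = j" if "a < card (size_class P p)" for a
    using index_of_props[of "e p a" P j] enumerates_e[OF that] j by auto
  have "(\<Sum>d<sum_list P. f d) = (\<Sum>d\<in>(\<lambda>a. index_of P (e p a) j) ` {..<card (size_class P p)}. f d)"
  proof (rule sum.mono_neutral_right)
    show "(\<lambda>a. index_of P (e p a) j) ` {..<card (size_class P p)} \<subseteq> {..<sum_list P}" using ix by auto
    show "\<forall>d\<in>{..<sum_list P} - (\<lambda>a. index_of P (e p a) j) ` {..<card (size_class P p)}. f d = 0"
    proof
      fix d assume d: "d \<in> {..<sum_list P} - (\<lambda>a. index_of P (e p a) j) ` {..<card (size_class P p)}"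
      show "f d = 0"
      proof (rule z)
        show "\<not> (level_of P d = j \<and> size_at P d = p)"
        proof
          assume a: "level_of P d = j \<and> size_at P d = p"
          note i = index_props[of d P]
          have "index_of P (e p (pos (block_of P d))) j = d" "pos (block_of P d) < card (size_class P p)"
            using a d i enumerates_pos[of "block_of P d"] by (auto simp: size_at_def)
          hence "d \<in> (\<lambda>a. index_of P (e p a) j) ` {..<card (size_class P p)}"
            by (intro image_eqI[of _ _ "pos (block_of P d)"]) auto
          thus False using d by blast
        qed
      qed (use d in auto)
    qed
  qed simp
  also have "\<dots> = (\<Sum>a<card (size_class P p). f (index_of P (e p a) j))"
  proof (rule sum.reindex_cong[where l = "\<lambda>a. index_of P (e p a) j"])
    show "inj_on (\<lambda>a. index_of P (e p a) j) {..<card (size_class P p)}"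
    proof (rule inj_onI)
      fix a b assume "a \<in> {..<card (size_class P p)}" "b \<in> {..<card (size_class P p)}"
        and eq: "index_of P (e p a) j = index_of P (e p b) j"
      hence ab: "a < card (size_class P p)" "b < card (size_class P p)" by auto
      have "e p a = block_of P (index_of P (e p a) j)" by (rule ix(2)[OF ab(1), symmetric])
      also have "\<dots> = e p b" unfolding eq by (rule ix(2)[OF ab(2)])
      finally show "a = b" using enumerates_e(3)[OF ab(1)] enumerates_e(3)[OF ab(2)] by metis
    qed
  qed auto
  finally show ?thesis .
qed

lemma block_diagonal_mult:
  fixes S T :: "nat \<Rightarrow> 'a::comm_ring_1 mat"
  assumes S: "\<And>p. S p \<in> carrier_mat (card (size_class P p)) (card (size_class P p))"
    and T: "\<And>p. T p \<in> carrier_mat (card (size_class P p)) (card (size_class P p))"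
  shows "block_diagonal S * block_diagonal T = block_diagonal (\<lambda>p. S p * T p)"
proof (rule eq_matI)
  fix r c assume "r < dim_row (block_diagonal (\<lambda>p. S p * T p))" "c < dim_col (block_diagonal (\<lambda>p. S p * T p))"
  hence rc: "r < sum_list P" "c < sum_list P" using block_diagonal_carrier[of "\<lambda>p. S p * T p"] by (metis carrier_matD)+
  define j where "j = level_of P r"
  define p where "p = size_at P r"
  note jp_def = j_def[symmetric] p_def[symmetric]
  let ?k = "card (size_class P p)"
  have jp: "j < p" unfolding j_def p_def by (rule level_less[OF rc(1)])
  have pr: "pos (block_of P r) < ?k" using enumerates_pos(1)[OF index_props(1)[OF rc(1)]] by (simp add: p_def size_at_def)
  have ix: "index_of P (e p a) j < sum_list P" "block_of P (index_of P (e p a) j) = e p a"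
    "level_of P (index_of P (e p a) j) = j" "size_at P (index_of P (e p a) j) = p" if "a < ?k" for a
    using index_of_props[of "e p a" P j] enumerates_e[OF that] jp by (auto simp: size_at_def)
  have "(block_diagonal S * block_diagonal T) $$ (r,c) = (\<Sum>d<sum_list P. block_diagonal S $$ (r,d) * block_diagonal T $$ (d,c))"
    by (rule mult_mat_entry[OF block_diagonal_carrier block_diagonal_carrier rc])
  also have "\<dots> = (\<Sum>a<?k. block_diagonal S $$ (r, index_of P (e p a) j) * block_diagonal T $$ (index_of P (e p a) j, c))"
    by (rule sum_same_level_size[OF jp]) (use rc in \<open>auto simp: block_diagonal_entry jp_def\<close>)
  also have "\<dots> = (\<Sum>a<?k. if j = level_of P c \<and> p = size_at P c
      then S p $$ (pos (block_of P r), a) * T p $$ (a, pos (block_of P c)) else 0)"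
  proof (rule sum.cong[OF refl])
    fix a assume "a \<in> {..<?k}"
    hence a: "a < ?k" by simp
    show "block_diagonal S $$ (r, index_of P (e p a) j) * block_diagonal T $$ (index_of P (e p a) j, c) =
      (if j = level_of P c \<and> p = size_at P c then S p $$ (pos (block_of P r), a) * T p $$ (a, pos (block_of P c)) else 0)"
    proof -
      have "block_diagonal S $$ (r, index_of P (e p a) j) = S p $$ (pos (block_of P r), a)"
        unfolding block_diagonal_entry[OF rc(1) ix(1)[OF a]] ix(2-4)[OF a] enumerates_e(3)[OF a] jp_def by simp
      moreover have "block_diagonal T $$ (index_of P (e p a) j, c) =
        (if j = level_of P c \<and> p = size_at P c then T p $$ (a, pos (block_of P c)) else 0)"
        unfolding block_diagonal_entry[OF ix(1)[OF a] rc(2)] ix(2-4)[OF a] enumerates_e(3)[OF a] ..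
      moreover have "x * (if b then y else 0) = (if b then x * y else 0)" for x y :: 'a and b by simp
      ultimately show ?thesis by (simp only:)
    qed
  qed
  also have "\<dots> = block_diagonal (\<lambda>p. S p * T p) $$ (r,c)"
  proof (cases "j = level_of P c \<and> p = size_at P c")
    case True
    hence pc: "pos (block_of P c) < ?k" using enumerates_pos(1)[OF index_props(1)[OF rc(2)]] by (simp add: size_at_def)
    show ?thesis using True mult_mat_entry[OF S T pr pc] rc by (simp add: block_diagonal_entry jp_def del: index_mult_mat)
  next
    case False
    then show ?thesis using rc by (auto simp: block_diagonal_entry jp_def)
  qed
  finally show "(block_diagonal S * block_diagonal T) $$ (r,c) = block_diagonal (\<lambda>p. S p * T p) $$ (r,c)" .
qed (use block_diagonal_carrier in auto)

lemma pos_eq_iff: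
  assumes "i < length P" "i' < length P" "P ! i = P ! i'"
  shows "pos i = pos i' \<longleftrightarrow> i = i'"
  using enumerates_pos(2)[OF assms(1)] enumerates_pos(2)[OF assms(2)] assms(3) by metis

lemma block_diagonal_one: "block_diagonal (\<lambda>p. 1\<^sub>m (card (size_class P p))) = (1\<^sub>m (sum_list P) :: 'a::comm_ring_1 mat)"
proof (rule eq_matI)
  fix r c assume "r < dim_row (1\<^sub>m (sum_list P) :: 'a mat)" "c < dim_col (1\<^sub>m (sum_list P) :: 'a mat)"
  hence rc: "r < sum_list P" "c < sum_list P" by auto
  note r = index_props(1)[OF rc(1)] and c = index_props(1)[OF rc(2)]
  show "block_diagonal (\<lambda>p. 1\<^sub>m (card (size_class P p))) $$ (r,c) = (1\<^sub>m (sum_list P) :: 'a mat) $$ (r,c)"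
  proof (cases "level_of P r = level_of P c \<and> size_at P r = size_at P c")
    case True
    hence "pos (block_of P r) = pos (block_of P c) \<longleftrightarrow> r = c"
      using pos_eq_iff[OF r c] index_eqI[OF rc] by (auto simp: size_at_def)
    then show ?thesis using True rc enumerates_pos(1)[OF r] enumerates_pos(1)[OF c]
      by (simp add: block_diagonal_entry size_at_def)
  next
    case False
    then show ?thesis using rc by (auto simp: block_diagonal_entry)
  qed
qed (use block_diagonal_carrier in auto)

lemma degree_part_entry:
  "a < card (size_class P p) \<Longrightarrow> b < card (size_class P p) \<Longrightarrow>
    degree_part p A $$ (a,b) = A $$ (index_of P (e p a) 0, index_of P (e p b) 0)"
  by (simp add: degree_part_def)

text \<open>An intermediate vector in the product has level 0, and comparing distances to the top on
  both sides leaves \<open>p\<close> as its only possible size.\<close>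

lemma degree_part_mult:
  fixes A B :: "'a::comm_ring_1 mat"
  assumes A: "A \<in> commutant (J P)" and B: "B \<in> commutant (J P)" and p: "0 < p"
  shows "degree_part p (A * B) = degree_part p A * degree_part p B"
proof (rule eq_matI)
  let ?k = "card (size_class P p)"
  note AC = commutantD(1)[OF A J_carrier] and BC = commutantD(1)[OF B J_carrier]
  fix a b assume "a < dim_row (degree_part p A * degree_part p B)" "b < dim_col (degree_part p A * degree_part p B)"
  hence ab: "a < ?k" "b < ?k" using degree_part_carrier[of p A] degree_part_carrier[of p B] by auto
  let ?r = "index_of P (e p a) 0" and ?c = "index_of P (e p b) 0"
  have r: "?r < sum_list P" "level_of P ?r = 0" "size_at P ?r = p"
    using index_of_props[of "e p a" P 0] enumerates_e[OF ab(1)] p by (auto simp: size_at_def)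
  have c: "?c < sum_list P" "level_of P ?c = 0" "size_at P ?c = p"
    using index_of_props[of "e p b" P 0] enumerates_e[OF ab(2)] p by (auto simp: size_at_def)
  have "degree_part p (A * B) $$ (a,b) = (\<Sum>d<sum_list P. A $$ (?r,d) * B $$ (d,?c))"
    using ab mult_mat_entry[OF AC BC r(1) c(1)] by (simp add: degree_part_entry)
  also have "\<dots> = (\<Sum>a'<?k. A $$ (?r, index_of P (e p a') 0) * B $$ (index_of P (e p a') 0, ?c))"
  proof (rule sum_same_level_size[OF p])
    fix d assume d: "d < sum_list P" "\<not> (level_of P d = 0 \<and> size_at P d = p)"
    show "A $$ (?r,d) * B $$ (d,?c) = 0"
    proof (rule ccontr)
      assume "\<not> ?thesis"
      hence nz: "A $$ (?r,d) \<noteq> 0" "B $$ (d,?c) \<noteq> 0" using mult_zero_left mult_zero_right by metis+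
      from commutant_J_entry_nonzero[OF A r(1) d(1) nz(1)] commutant_J_entry_nonzero[OF B d(1) c(1) nz(2)]
      show False using r c d by auto
    qed
  qed
  also have "\<dots> = (degree_part p A * degree_part p B) $$ (a,b)"
    using ab by (simp add: mult_mat_entry[OF degree_part_carrier degree_part_carrier] degree_part_entry del: index_mult_mat)
  finally show "degree_part p (A * B) $$ (a,b) = (degree_part p A * degree_part p B) $$ (a,b)" .
qed (use degree_part_carrier in auto)

lemma degree_part_block_diagonal:
  assumes "0 < p" "S p \<in> carrier_mat (card (size_class P p)) (card (size_class P p))"
  shows "degree_part p (block_diagonal S) = S p"
proof (rule eq_matI)
  fix a b assume "a < dim_row (S p)" "b < dim_col (S p)"
  hence ab: "a < card (size_class P p)" "b < card (size_class P p)" using assms by auto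
  show "degree_part p (block_diagonal S) $$ (a,b) = S p $$ (a,b)"
    using index_of_props[of "e p a" P 0] index_of_props[of "e p b" P 0] enumerates_e[OF ab(1)] enumerates_e[OF ab(2)] assms(1) ab
    by (simp add: degree_part_entry block_diagonal_entry size_at_def)
qed (use assms degree_part_carrier[of p "block_diagonal S"] in auto)

lemma degree_part_pow:
  fixes A :: "'a::comm_ring_1 mat"
  assumes A: "A \<in> commutant (J P)" and p: "0 < p"
  shows "degree_part p (A ^\<^sub>m k) = degree_part p A ^\<^sub>m k"
proof (induction k)
  case 0
  have "dim_row A = sum_list P" using commutantD(1)[OF A J_carrier] by simp
  hence "A ^\<^sub>m 0 = block_diagonal (\<lambda>p. 1\<^sub>m (card (size_class P p)))" by (simp add: block_diagonal_one)
  hence "degree_part p (A ^\<^sub>m 0) = 1\<^sub>m (card (size_class P p))"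
    using degree_part_block_diagonal[OF p, of "\<lambda>p. 1\<^sub>m (card (size_class P p))"] by simp
  thus ?case using degree_part_carrier[of p A] by simp
next
  case (Suc k)
  then show ?case using degree_part_mult[OF commutant_pow[OF J_carrier A] A p] by simp
qed

text \<open>The degree parts of a nilpotent \<open>A\<close> are nilpotent, so each is conjugate to
  a strictly upper triangular matrix, and \<open>block_diagonal\<close> lifts the conjugating
  matrices to the commutant. Positions enter \<open>ord\<close> reversed: an entry above the
  diagonal has its row before its column, while \<open>step\<close> asks for the larger value at the
  row.\<close>

lemma nilpotent_commutant_conjugate:
  fixes A :: "'a::field mat"
  assumes A: "A \<in> nilpotent_commutant (J P)" and pos0: "\<forall>p\<in>set P. 0 < p"
  shows "\<exists>g h X. g \<in> commutant (J P) \<and> h \<in> commutant (J P) \<and> g * h = 1\<^sub>m (sum_list P) \<and> h * g = 1\<^sub>m (sum_list P) \<and>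
    X \<in> strict_part P (\<lambda>i. length P - pos i) \<and> A = g * X * h"
proof -
  have AC: "A \<in> commutant (J P)" using A by (simp add: nilpotent_commutant_def)
  note Ac = commutantD(1)[OF AC J_carrier]
  from A obtain m where m: "A ^\<^sub>m m = 0\<^sub>m (sum_list P) (sum_list P)"
    using Ac by (auto simp: nilpotent_commutant_def nilpotent_mat_def)
  define k where "k p = card (size_class P p)" for p
  have "\<exists>S T U. S \<in> carrier_mat (k p) (k p) \<and> T \<in> carrier_mat (k p) (k p) \<and> S * T = 1\<^sub>m (k p) \<and> T * S = 1\<^sub>m (k p) \<and>
    (0 < p \<longrightarrow> T * degree_part p A * S = U \<and> (\<forall>b<k p. \<forall>a<k p. b \<le> a \<longrightarrow> U $$ (a,b) = 0))" for p
  proof (cases "0 < p")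
    case True
    have dc: "degree_part p A \<in> carrier_mat (k p) (k p)" by (simp add: k_def)
    have "degree_part p A ^\<^sub>m m = degree_part p (0\<^sub>m (sum_list P) (sum_list P))"
      using degree_part_pow[OF AC True, of m] m by simp
    also have "\<dots> = 0\<^sub>m (k p) (k p)"
    proof (rule eq_matI)
      fix a b assume "a < dim_row (0\<^sub>m (k p) (k p) :: 'a mat)" "b < dim_col (0\<^sub>m (k p) (k p) :: 'a mat)"
      hence ab: "a < card (size_class P p)" "b < card (size_class P p)" by (auto simp: k_def)
      have "index_of P (e p a) 0 < sum_list P" "index_of P (e p b) 0 < sum_list P"
        using index_of_props[of "e p a" P 0] index_of_props[of "e p b" P 0] enumerates_e[OF ab(1)] enumerates_e[OF ab(2)] True by auto
      thus "degree_part p (0\<^sub>m (sum_list P) (sum_list P)) $$ (a,b) = (0\<^sub>m (k p) (k p) :: 'a mat) $$ (a,b)"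
        using ab by (simp add: degree_part_entry k_def)
    qed (use degree_part_carrier in \<open>auto simp: k_def\<close>)
    finally obtain U where U: "U \<in> carrier_mat (k p) (k p)" "similar_mat (degree_part p A) U"
      "\<forall>b<k p. \<forall>a<k p. b \<le> a \<longrightarrow> U $$ (a,b) = 0"
      using nilpotent_similar_strict_upper[OF dc] by blast
    from similar_mat_sym[OF U(2)] obtain T S where w: "similar_mat_wit U (degree_part p A) T S"
      unfolding similar_mat_def by auto
    from similar_mat_witD2[OF U(1) w] U(3) show ?thesis by blast
  next
    case False
    show ?thesis by (rule exI[of _ "1\<^sub>m (k p)"], rule exI[of _ "1\<^sub>m (k p)"]) (use False in auto)
  qed
  hence "\<forall>p. \<exists>W. fst W \<in> carrier_mat (k p) (k p) \<and> fst (snd W) \<in> carrier_mat (k p) (k p) \<and>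
    fst W * fst (snd W) = 1\<^sub>m (k p) \<and> fst (snd W) * fst W = 1\<^sub>m (k p) \<and>
    (0 < p \<longrightarrow> fst (snd W) * degree_part p A * fst W = snd (snd W) \<and>
      (\<forall>b<k p. \<forall>a<k p. b \<le> a \<longrightarrow> snd (snd W) $$ (a,b) = 0))" by (metis fst_conv snd_conv)
  from choice[OF this] obtain W where W: "\<And>p. fst (W p) \<in> carrier_mat (k p) (k p) \<and> fst (snd (W p)) \<in> carrier_mat (k p) (k p) \<and>
    fst (W p) * fst (snd (W p)) = 1\<^sub>m (k p) \<and> fst (snd (W p)) * fst (W p) = 1\<^sub>m (k p) \<and>
    (0 < p \<longrightarrow> fst (snd (W p)) * degree_part p A * fst (W p) = snd (snd (W p)) \<and>
      (\<forall>b<k p. \<forall>a<k p. b \<le> a \<longrightarrow> snd (snd (W p)) $$ (a,b) = 0))" by blast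
  define S where "S p = fst (W p)" for p
  define T where "T p = fst (snd (W p))" for p
  define U where "U p = snd (snd (W p))" for p
  have S: "\<And>p. S p \<in> carrier_mat (k p) (k p)" and T: "\<And>p. T p \<in> carrier_mat (k p) (k p)"
    and ST: "\<And>p. S p * T p = 1\<^sub>m (k p)" "\<And>p. T p * S p = 1\<^sub>m (k p)"
    and U: "\<And>p. 0 < p \<Longrightarrow> T p * degree_part p A * S p = U p"
      "\<And>p a b. 0 < p \<Longrightarrow> b < k p \<Longrightarrow> a < k p \<Longrightarrow> b \<le> a \<Longrightarrow> U p $$ (a,b) = 0"
    using W unfolding S_def T_def U_def by blast+
  define g where "g = block_diagonal S"
  define h where "h = block_diagonal T"
  have gC: "g \<in> commutant (J P)" and hC: "h \<in> commutant (J P)"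
    by (auto simp: g_def h_def block_diagonal_commutant)
  note gc = commutantD(1)[OF gC J_carrier] and hc = commutantD(1)[OF hC J_carrier]
  have gh: "g * h = 1\<^sub>m (sum_list P)" "h * g = 1\<^sub>m (sum_list P)"
    unfolding g_def h_def using block_diagonal_mult[of S T] block_diagonal_mult[of T S] S T ST block_diagonal_one
    by (simp_all add: k_def)
  define X where "X = h * A * g"
  have XC: "X \<in> commutant (J P)" unfolding X_def by (intro commutant_mult[OF J_carrier] gC hC AC)
  have dX: "degree_part p X = U p" if "0 < p" for p
    using that S T U(1)[OF that] unfolding X_def g_def h_def
    by (simp add: degree_part_mult block_diagonal_commutant commutant_mult[OF J_carrier] AC degree_part_block_diagonal k_def)
  have "X \<in> strict_part P (\<lambda>i. length P - pos i)"
  proof (rule strict_partI[OF XC])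
    fix r c assume rc: "r < sum_list P" "c < sum_list P" and nz: "X $$ (r,c) \<noteq> 0"
      and sz: "size_at P r = size_at P c" and lv: "level_of P r = level_of P c"
    note r = index_props[OF rc(1)] and c = index_props[OF rc(2)]
    let ?p = "size_at P r"
    have p: "0 < ?p" using level_less[OF rc(1)] by simp
    have "X $$ (index_of P (block_of P r) (level_of P r), index_of P (block_of P c) (level_of P r)) =
      X $$ (index_of P (block_of P r) 0, index_of P (block_of P c) 0)"
      by (rule commutant_J_same_level[OF XC r(1,2) c(1)]) (use c(2) lv in simp)
    hence "X $$ (r,c) = X $$ (index_of P (block_of P r) 0, index_of P (block_of P c) 0)"
      using r(3) c(3) lv by simp
    also have "\<dots> = degree_part ?p X $$ (pos (block_of P r), pos (block_of P c))"
      using enumerates_pos[OF r(1)] enumerates_pos[OF c(1)] sz by (simp add: degree_part_entry size_at_def)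
    also have "\<dots> = U ?p $$ (pos (block_of P r), pos (block_of P c))" using dX[OF p] by simp
    finally have "\<not> pos (block_of P c) \<le> pos (block_of P r)"
      using U(2)[OF p, of "pos (block_of P c)" "pos (block_of P r)"] nz
        enumerates_pos(1)[OF r(1)] enumerates_pos(1)[OF c(1)] sz by (auto simp: size_at_def k_def)
    moreover have "card (size_class P (P ! block_of P c)) \<le> length P"
      using card_mono[of "{..<length P}" "size_class P (P ! block_of P c)"] by (auto simp: size_class_def)
    ultimately show "length P - pos (block_of P c) < length P - pos (block_of P r)"
      using enumerates_pos(1)[OF c(1)] by simp
  qed
  moreover have "A = g * X * h"
  proof -
    have hA: "h * A \<in> carrier_mat (sum_list P) (sum_list P)" using hc Ac by simp
    have "g * X * h = g * (h * A * g * h)" unfolding X_def using gc hc Ac by (intro assoc_mult_mat) auto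
    also have "h * A * g * h = h * A * (g * h)" using hA gc hc by (intro assoc_mult_mat) auto
    also have "\<dots> = h * A" unfolding gh by (rule right_mult_one_mat[OF hA])
    also have "g * (h * A) = g * h * A" using gc hc Ac by (intro assoc_mult_mat[symmetric]) auto
    finally show ?thesis using gh Ac by simp
  qed
  ultimately show ?thesis using gC hC gh by blast
qed

end

section \<open>Curves in the nilpotent commutant\<close>

lemma strict_part_lincomb:
  fixes X Y :: "'a::comm_ring_1 mat"
  assumes X: "X \<in> strict_part P ord" and Y: "Y \<in> strict_part P ord"
  shows "mat (sum_list P) (sum_list P) (\<lambda>ij. s * X $$ ij + t * Y $$ ij) \<in> strict_part P ord"
proof -
  have "mat (sum_list P) (sum_list P) (\<lambda>ij. s * X $$ ij + t * Y $$ ij) \<in> commutant (J P)"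
    by (rule commutant_lincomb[OF J_carrier strict_partD(1)[OF X] strict_partD(1)[OF Y]])
  moreover have "step P ord c r" if rc: "r < sum_list P" "c < sum_list P" and "s * X $$ (r,c) + t * Y $$ (r,c) \<noteq> 0" for r c
  proof -
    from that(3) have "X $$ (r,c) \<noteq> 0 \<or> Y $$ (r,c) \<noteq> 0" by (metis add_0 mult_zero_right)
    thus ?thesis using strict_partD(3)[OF X rc] strict_partD(3)[OF Y rc] by blast
  qed
  ultimately show ?thesis unfolding strict_part_def by simp
qed

lemma conjugate_nilpotent_commutant:
  fixes g :: "'a::comm_ring_1 mat"
  assumes g: "g \<in> commutant (J P)" and h: "h \<in> carrier_mat (sum_list P) (sum_list P)"
    and gh: "g * h = 1\<^sub>m (sum_list P)" "h * g = 1\<^sub>m (sum_list P)" and X: "X \<in> strict_part P ord"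
  shows "g * X * h \<in> nilpotent_commutant (J P)"
proof -
  let ?n = "sum_list P"
  note gc = commutantD(1)[OF g J_carrier] and Xc = strict_partD(2)[OF X]
  have "similar_mat_wit (g * X * h) X g h"
    by (rule similar_mat_witI[OF gh refl]) (use gc h Xc in auto)
  from similar_mat_wit_pow_id[OF this, of ?n]
  have "(g * X * h) ^\<^sub>m ?n = 0\<^sub>m ?n ?n" using strict_part_nilpotent[OF X] gc h by simp
  moreover have "dim_row (g * X * h) = ?n" using gc by simp
  ultimately have "nilpotent_mat (g * X * h)" unfolding nilpotent_mat_def by auto
  moreover have "g * X * h \<in> commutant (J P)"
    by (intro commutant_mult[OF J_carrier] g strict_partD(1)[OF X] commutant_inverse[OF J_carrier g h gh])
  ultimately show ?thesis by (simp add: nilpotent_commutant_def)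
qed

lemma poly_ring_hom: "comm_ring_hom (\<lambda>p. poly p (x :: 'a::comm_ring_1))"
  by unfold_locales auto

lemma poly_semiring_hom: "semiring_hom (\<lambda>p. poly p (x :: 'a::comm_ring_1))"
  by unfold_locales auto

text \<open>With G and X interpolating linearly between the conjugating matrices and between the
  strict matrices, the curve is G X G^-1 = G X adj(G) / det(G). The commutant and
  \<open>strict_part P ord\<close> are linear, so each point with det(G) \<noteq> 0 is again
  nilpotent and commutes with J. Using one enumeration for both end points puts both strict matrices
  into the same space.\<close>

lemma nilpotent_commutant_joined:
  fixes A1 A2 :: "'a::field mat"
  assumes A1: "A1 \<in> nilpotent_commutant (J P)" and A2: "A2 \<in> nilpotent_commutant (J P)"
    and pos0: "\<forall>p\<in>set P. 0 < p"
  shows "joined_by_curve (sum_list P) (nilpotent_commutant (J P)) A1 A2"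
proof -
  let ?n = "sum_list P"
  obtain e pos where en: "enumerates P e pos" using enumerates_exists by blast
  define ord where "ord i = length P - pos i" for i
  note conj = nilpotent_commutant_conjugate[OF en _ pos0, folded ord_def]
  from conj[OF A1] obtain g1 h1 X1 where 1: "g1 \<in> commutant (J P)" "h1 \<in> commutant (J P)" "g1 * h1 = 1\<^sub>m ?n"
    "h1 * g1 = 1\<^sub>m ?n" "X1 \<in> strict_part P ord" "A1 = g1 * X1 * h1" by blast
  from conj[OF A2] obtain g2 h2 X2 where 2: "g2 \<in> commutant (J P)" "h2 \<in> commutant (J P)" "g2 * h2 = 1\<^sub>m ?n"
    "h2 * g2 = 1\<^sub>m ?n" "X2 \<in> strict_part P ord" "A2 = g2 * X2 * h2" by blast
  note c1 = commutantD(1)[OF 1(1) J_carrier] commutantD(1)[OF 1(2) J_carrier] strict_partD(2)[OF 1(5)]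
  note c2 = commutantD(1)[OF 2(1) J_carrier] commutantD(1)[OF 2(2) J_carrier] strict_partD(2)[OF 2(5)]
  define L where "L Y Z = mat ?n ?n (\<lambda>ij. [: Y $$ ij, Z $$ ij - Y $$ ij :])" for Y Z :: "'a mat"
  define G where "G = L g1 g2"
  define X where "X = L X1 X2"
  define ev where "ev t = map_mat (\<lambda>p. poly p t)" for t :: 'a
  have Gc: "G \<in> carrier_mat ?n ?n" and Xc: "X \<in> carrier_mat ?n ?n" by (auto simp: G_def X_def L_def)
  have ac: "adj_mat G \<in> carrier_mat ?n ?n" by (rule adj_mat(1)[OF Gc])
  have evL: "ev t (L Y Z) = mat ?n ?n (\<lambda>ij. (1 - t) * Y $$ ij + t * Z $$ ij)" for t Y Z
    by (rule eq_matI) (auto simp: ev_def L_def algebra_simps)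
  have ev0: "ev 0 (L Y Z) = Y" if "Y \<in> carrier_mat ?n ?n" for Y Z
    unfolding evL by (rule eq_matI) (use that in auto)
  have ev1: "ev 1 (L Y Z) = Z" if "Z \<in> carrier_mat ?n ?n" for Y Z
    unfolding evL by (rule eq_matI) (use that in auto)
  define D where "D = det G"
  define H where "H = G * X * adj_mat G"
  have detev: "det (ev t G) = poly D t" for t
    unfolding ev_def D_def by (rule comm_ring_hom.hom_det[OF poly_ring_hom])
  \<comment> \<open>For any left inverse \<open>h\<close> of the evaluated G, the evaluated adjugate
    is D(t) times \<open>h\<close>; thus \<open>H\<close> evaluates to D(t) times the
    conjugate.\<close>
  have key: "poly D t * (ev t G * ev t X * h) $$ (i,j) = poly (H $$ (i,j)) t"
    if h: "h \<in> carrier_mat ?n ?n" "h * ev t G = 1\<^sub>m ?n" and ij: "i < ?n" "j < ?n" for t h i j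
  proof -
    note mat_hom_mult = semiring_hom.mat_hom_mult[OF poly_semiring_hom[of t]]
    have c: "ev t G \<in> carrier_mat ?n ?n" "ev t X \<in> carrier_mat ?n ?n" "ev t (adj_mat G) \<in> carrier_mat ?n ?n"
      using Gc Xc ac by (auto simp: ev_def)
    have "ev t G * ev t (adj_mat G) = ev t (G * adj_mat G)"
      unfolding ev_def by (rule mat_hom_mult[OF Gc ac, symmetric])
    also have "\<dots> = poly D t \<cdot>\<^sub>m 1\<^sub>m ?n"
      unfolding adj_mat(2)[OF Gc] D_def[symmetric] by (rule eq_matI) (auto simp: ev_def)
    finally have ga: "ev t G * ev t (adj_mat G) = poly D t \<cdot>\<^sub>m 1\<^sub>m ?n" .
    have "ev t (adj_mat G) = h * ev t G * ev t (adj_mat G)" using h c by simp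
    also have "\<dots> = h * (ev t G * ev t (adj_mat G))" using h c by (intro assoc_mult_mat) auto
    also have "\<dots> = poly D t \<cdot>\<^sub>m h" unfolding ga mult_smult_distrib[OF h(1) one_carrier_mat] right_mult_one_mat[OF h(1)] ..
    finally have adj: "ev t (adj_mat G) = poly D t \<cdot>\<^sub>m h" .
    have "ev t H = ev t (G * X) * ev t (adj_mat G)"
      unfolding H_def ev_def by (rule mat_hom_mult) (use Gc Xc ac in auto)
    also have "ev t (G * X) = ev t G * ev t X" unfolding ev_def by (rule mat_hom_mult[OF Gc Xc])
    also have "ev t G * ev t X * ev t (adj_mat G) = poly D t \<cdot>\<^sub>m (ev t G * ev t X * h)"
      unfolding adj using c h by (intro mult_smult_distrib) auto
    finally have "ev t H $$ (i,j) = poly D t * (ev t G * ev t X * h) $$ (i,j)"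
      using ij c h by (simp del: index_mult_mat(1))
    moreover have "H \<in> carrier_mat ?n ?n" unfolding H_def using Gc Xc ac by simp
    ultimately show ?thesis using ij by (auto simp: ev_def)
  qed
  have GC: "ev t G \<in> commutant (J P)" for t
    unfolding G_def evL by (rule commutant_lincomb[OF J_carrier 1(1) 2(1)])
  have XS: "ev t X \<in> strict_part P ord" for t
    unfolding X_def evL by (rule strict_part_lincomb[OF 1(5) 2(5)])
  have G0: "ev 0 G = g1" "ev 0 X = X1" "ev 1 G = g2" "ev 1 X = X2"
    unfolding G_def X_def using ev0[OF c1(1)] ev0[OF c1(3)] ev1[OF c2(1)] ev1[OF c2(3)] by auto
  have "det g1 * det h1 = 1" "det g2 * det h2 = 1"
    using det_mult[OF c1(1,2)] det_mult[OF c2(1,2)] 1(3) 2(3) by auto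
  hence D01: "poly D 0 \<noteq> 0" "poly D 1 \<noteq> 0" unfolding detev[symmetric] G0 by auto
  show ?thesis
    unfolding joined_by_curve_def
  proof (rule exI[of _ D], rule exI[of _ "\<lambda>i j. H $$ (i,j)"], rule exI[of _ 0], rule exI[of _ 1], intro conjI allI impI)
    fix i j assume ij: "i < ?n" "j < ?n"
    show "poly D 0 * A1 $$ (i,j) = poly (H $$ (i,j)) 0"
      using key[of h1 0 i j] c1(2) 1(4) ij unfolding G0 1(6) by simp
    show "poly D 1 * A2 $$ (i,j) = poly (H $$ (i,j)) 1"
      using key[of h2 1 i j] c2(2) 2(4) ij unfolding G0 2(6) by simp
  next
    fix t assume nz: "poly D t \<noteq> 0"
    have Gtc: "ev t G \<in> carrier_mat ?n ?n" using Gc by (simp add: ev_def)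
    from det_nz_inverse[OF Gtc] nz obtain h where h: "h \<in> carrier_mat ?n ?n" "ev t G * h = 1\<^sub>m ?n" "h * ev t G = 1\<^sub>m ?n"
      unfolding detev by metis
    show "\<exists>M\<in>nilpotent_commutant (J P). \<forall>i<?n. \<forall>j<?n. poly D t * M $$ (i,j) = poly (H $$ (i,j)) t"
    proof (rule bexI[of _ "ev t G * ev t X * h"])
      show "\<forall>i<?n. \<forall>j<?n. poly D t * (ev t G * ev t X * h) $$ (i,j) = poly (H $$ (i,j)) t"
        using key[OF h(1,3)] by blast
      show "ev t G * ev t X * h \<in> nilpotent_commutant (J P)"
        by (rule conjugate_nilpotent_commutant[OF GC h XS])
    qed
  qed (use D01 in auto)
qed

lemma nilpotent_commutant_rank_bound:
  fixes A :: "'a::field mat"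
  assumes A: "A \<in> nilpotent_commutant (J P)" and pos0: "\<forall>p\<in>set P. 0 < p"
    and b: "\<And>X ord. X \<in> strict_part P ord \<Longrightarrow> \<not> rank_ge (sum_list P) \<rho> (X ^\<^sub>m k :: 'a mat)"
  shows "\<not> rank_ge (sum_list P) \<rho> (A ^\<^sub>m k)"
proof -
  let ?n = "sum_list P"
  obtain e pos where en: "enumerates P e pos" using enumerates_exists by blast
  from nilpotent_commutant_conjugate[OF en A pos0] obtain g h X where 1: "g \<in> commutant (J P)" "h \<in> commutant (J P)"
    "g * h = 1\<^sub>m ?n" "h * g = 1\<^sub>m ?n" "X \<in> strict_part P (\<lambda>i. length P - pos i)" "A = g * X * h" by blast
  note c = commutantD(1)[OF 1(1) J_carrier] commutantD(1)[OF 1(2) J_carrier] strict_partD(2)[OF 1(5)]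
  have "A \<in> carrier_mat ?n ?n" using 1(6) c by simp
  moreover have "similar_mat A X"
    by (rule similar_matI[of _ _ g h ?n]) (use 1 c in auto)
  ultimately show ?thesis using rank_ge_similar b[OF 1(5)] by blast
qed

text \<open>The definite description is resolved here; every later fact about \<open>frakQ\<close>
  is derived from these two.\<close>

lemma frakQ_characterization:
  assumes inf: "infinite (UNIV :: 'a::field set)" and P: "is_partition P"
  shows "\<exists>A\<in>nilpotent_commutant (J P :: 'a mat). has_jordan_type A (frakQ TYPE('a) P)"
    and "A \<in> nilpotent_commutant (J P :: 'a mat) \<Longrightarrow> rank_ge (sum_list P) \<rho> (A ^\<^sub>m i) \<Longrightarrow>
      \<rho> + sum_list (map (min i) (frakQ TYPE('a) P)) \<le> sum_list P"
proof -
  let ?N = "nilpotent_commutant (J P :: 'a mat)"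
  have pos0: "\<forall>p\<in>set P. 0 < p" using P by (auto simp: is_partition_def)
  have "U1 \<inter> U2 \<noteq> {}" if "openin (subtopology (zariski (sum_list P)) ?N) U1" "U1 \<noteq> {}"
    "openin (subtopology (zariski (sum_list P)) ?N) U2" "U2 \<noteq> {}" for U1 U2
  proof (rule open_sets_meet[OF inf _ _ that])
    show "?N \<subseteq> carrier_mat (sum_list P) (sum_list P)" using nilpotent_commutant_type(1)[OF J_carrier] by blast
  qed (rule nilpotent_commutant_joined[OF _ _ pos0])
  from generic_jordan_type_exists[OF J_carrier this] obtain Q where
    Q: "(\<forall>Q'. generic_jordan_type (J P :: 'a mat) Q' \<longleftrightarrow> Q' = Q) \<and> (\<exists>A\<in>?N. has_jordan_type A Q) \<and>
    (\<forall>A\<in>?N. \<forall>i \<rho>. rank_ge (sum_list P) \<rho> (A ^\<^sub>m i) \<longrightarrow> \<rho> + sum_list (map (min i) Q) \<le> sum_list P)"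
    by (rule exE)
  have "frakQ TYPE('a) P = Q" 
    unfolding frakQ_def using conjunct1[OF Q] by (intro the_equality) simp_all
  note fr = this
  show "\<exists>A\<in>?N. has_jordan_type A (frakQ TYPE('a) P)"
    unfolding fr using conjunct1[OF conjunct2[OF Q]] .
  show "A \<in> ?N \<Longrightarrow> rank_ge (sum_list P) \<rho> (A ^\<^sub>m i) \<Longrightarrow>
      \<rho> + sum_list (map (min i) (frakQ TYPE('a) P)) \<le> sum_list P"
    unfolding fr using conjunct2[OF conjunct2[OF Q]] by blast
qed

subsection \<open>Rank bounds from the poset of basis vectors\<close>

lemma rank_ge_1_iff:
  fixes M :: "'a::field mat"
  assumes M: "M \<in> carrier_mat n n"
  shows "rank_ge n 1 M \<longleftrightarrow> (\<exists>r<n. \<exists>c<n. M $$ (r,c) \<noteq> 0)"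
proof
  assume "rank_ge n 1 M"
  from rank_ge_le_nonzero_rows[OF M this] have "{r. r < n \<and> (\<exists>c<n. M $$ (r,c) \<noteq> 0)} \<noteq> {}"
    by (metis One_nat_def card.empty not_less_eq_eq zero_le)
  thus "\<exists>r<n. \<exists>c<n. M $$ (r,c) \<noteq> 0" by blast
next
  assume "\<exists>r<n. \<exists>c<n. M $$ (r,c) \<noteq> 0"
  then obtain r c where rc: "r < n" "c < n" "M $$ (r,c) \<noteq> 0" by blast
  define X where "X = mat 1 n (\<lambda>(_,k). if k = r then 1 else 0 :: 'a)"
  define Z where "Z = mat n 1 (\<lambda>(k,_). if k = c then 1 else 0 :: 'a)"
  have X: "X \<in> carrier_mat 1 n" and Z: "Z \<in> carrier_mat n 1" by (auto simp: X_def Z_def)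
  have z: "(0::nat) < 1" by simp
  have XM: "(X * M) $$ (0,k) = M $$ (r,k)" if "k < n" for k
  proof -
    have "(X * M) $$ (0,k) = (\<Sum>d<n. if d = r then M $$ (d,k) else 0)"
      unfolding mult_mat_entry[OF X M z that] by (rule sum.cong) (auto simp: X_def)
    thus ?thesis using rc by simp
  qed
  have "(X * M * Z) $$ (0,0) = (\<Sum>k<n. if k = c then M $$ (r,k) else 0)"
    unfolding mult_mat_entry[OF mult_carrier_mat[OF X M] Z z z]
    by (rule sum.cong) (use XM in \<open>auto simp: Z_def\<close>)
  hence e: "(X * M * Z) $$ (0,0) \<noteq> 0" using rc by simp
  have C: "X * M * Z \<in> carrier_mat 1 1" using X M Z by simp
  have "det (X * M * Z) \<noteq> 0" using e det_single[OF C] by simp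
  thus "rank_ge n 1 M" by (rule rank_ge_det[OF M X Z])
qed

definition label_ok :: "nat list \<Rightarrow> nat \<times> nat \<Rightarrow> bool" where
  "label_ok P a \<longleftrightarrow> fst a < length P \<and> snd a < P ! fst a"

text \<open>The tie-break by \<open>ord\<close> is dropped from both relations, so incomparable
  labels are unrelated by \<open>step\<close> for every \<open>ord\<close>.\<close>

definition incomparable :: "nat list \<Rightarrow> nat \<times> nat \<Rightarrow> nat \<times> nat \<Rightarrow> bool" where
  "incomparable P a b \<longleftrightarrow> \<not> (snd a \<le> snd b \<and> snd a + P ! fst b \<le> snd b + P ! fst a) \<and>
     \<not> (snd b \<le> snd a \<and> snd b + P ! fst a \<le> snd a + P ! fst b)"

text \<open>A chain misses an element of each of a family of disjoint incomparable pairs.\<close>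

lemma incomparable_pairs_bound:
  fixes X :: "'a::field mat" and a b :: "'i \<Rightarrow> nat \<times> nat"
  assumes X: "X \<in> strict_part P ord" and r: "rank_ge (sum_list P) 1 (X ^\<^sub>m k)"
    and fin: "finite T" and inj: "inj_on a T" "inj_on b T" and disj: "a ` T \<inter> b ` T = {}"
    and ok: "\<And>t. t \<in> T \<Longrightarrow> label_ok P (a t)" "\<And>t. t \<in> T \<Longrightarrow> label_ok P (b t)"
    and inc: "\<And>t. t \<in> T \<Longrightarrow> incomparable P (a t) (b t)"
  shows "k + card T < sum_list P"
proof -
  let ?n = "sum_list P"
  have "X ^\<^sub>m k \<in> carrier_mat ?n ?n" by (rule pow_carrier_mat[OF strict_partD(2)[OF X]])
  from r[unfolded rank_ge_1_iff[OF this]] obtain r0 c0 where rc: "r0 < ?n" "c0 < ?n" "(X ^\<^sub>m k) $$ (r0,c0) \<noteq> 0" by blast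
  from pow_entry_chain[OF X rc] obtain C where C: "C \<subseteq> {..<?n}" "card C = Suc k"
    "\<forall>a\<in>C. \<forall>b\<in>C. a = b \<or> step P ord a b \<or> step P ord b a" by blast
  define I where "I = (\<lambda>(i,j). index_of P i j)"
  have I: "I l < ?n" "block_of P (I l) = fst l" "level_of P (I l) = snd l" "size_at P (I l) = P ! fst l"
    if "label_ok P l" for l
    using that index_of_props[of "fst l" P "snd l"] by (auto simp: I_def label_ok_def size_at_def split: prod.splits)
  have Iinj: "l = l'" if "label_ok P l" "label_ok P l'" "I l = I l'" for l l'
    using I[OF that(1)] I[OF that(2)] that(3) by (metis prod_eqI)
  define f where "f t = (if I (a t) \<in> C then I (b t) else I (a t))" for t
  have ab: "I (a t) \<notin> C \<or> I (b t) \<notin> C" if t: "t \<in> T" for t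
  proof (rule ccontr)
    assume "\<not> ?thesis"
    with C(3) have "I (a t) = I (b t) \<or> step P ord (I (a t)) (I (b t)) \<or> step P ord (I (b t)) (I (a t))" by blast
    thus False
    proof (elim disjE)
      assume "I (a t) = I (b t)"
      hence "a t = b t" by (rule Iinj[OF ok(1)[OF t] ok(2)[OF t]])
      thus False using disj t by blast
    next
      assume "step P ord (I (a t)) (I (b t))"
      thus False using inc[OF t] I[OF ok(1)[OF t]] I[OF ok(2)[OF t]] by (simp add: step_def incomparable_def)
    next
      assume "step P ord (I (b t)) (I (a t))"
      thus False using inc[OF t] I[OF ok(1)[OF t]] I[OF ok(2)[OF t]] by (simp add: step_def incomparable_def)
    qed
  qed
  have fC: "f t \<in> {..<?n} - C" if t: "t \<in> T" for t
    using ab[OF t] I(1)[OF ok(1)[OF t]] I(1)[OF ok(2)[OF t]] by (auto simp: f_def)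
  have "inj_on f T"
  proof (rule inj_onI)
    fix t t' assume t: "t \<in> T" "t' \<in> T" and eq: "f t = f t'"
    have ne: "I (a u) \<noteq> I (b v)" if "u \<in> T" "v \<in> T" for u v
      using Iinj[OF ok(1)[OF that(1)] ok(2)[OF that(2)]] disj that by blast
    from eq ne[OF t] ne[OF t(2,1)] have "I (a t) = I (a t') \<or> I (b t) = I (b t')"
      by (auto simp: f_def split: if_splits)
    thus "t = t'"
    proof
      assume "I (a t) = I (a t')"
      hence "a t = a t'" by (rule Iinj[OF ok(1)[OF t(1)] ok(1)[OF t(2)]])
      thus ?thesis using inj(1) t by (auto simp: inj_on_def)
    next
      assume "I (b t) = I (b t')"
      hence "b t = b t'" by (rule Iinj[OF ok(2)[OF t(1)] ok(2)[OF t(2)]])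
      thus ?thesis using inj(2) t by (auto simp: inj_on_def)
    qed
  qed
  hence "card T \<le> card ({..<?n} - C)" by (rule card_inj_on_le) (use fC in auto)
  also have "\<dots> = ?n - Suc k" using C by (simp add: card_Diff_subset finite_subset)
  finally show ?thesis using card_mono[OF _ C(1)] C(2) by simp
qed

text \<open>The columns in the up-closure of an antichain are supported in the strict up-closure.\<close>

lemma antichain_rank_bound:
  fixes X :: "'a::field mat"
  assumes X: "X \<in> strict_part P ord" and A: "A \<subseteq> {..<sum_list P}" "card A = Suc m"
    and anti: "\<And>a b. a \<in> A \<Longrightarrow> b \<in> A \<Longrightarrow> \<not> step P ord a b"
  shows "\<not> rank_ge (sum_list P) (sum_list P - m) X"
proof
  let ?n = "sum_list P"
  note Xc = strict_partD(2)[OF X]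
  define \<rho> where "\<rho> = ?n - m"
  assume "rank_ge ?n (?n - m) X"
  then obtain Y Z where Y: "Y \<in> carrier_mat \<rho> ?n" and Z: "Z \<in> carrier_mat ?n \<rho>" and YZ: "Y * X * Z = 1\<^sub>m \<rho>"
    unfolding rank_ge_def \<rho>_def by blast
  define W where "W = {r. r < ?n \<and> (\<exists>a\<in>A. step P ord a r)}"
  define C where "C = W \<union> A"
  have WA: "W \<inter> A = {}" using anti by (auto simp: W_def)
  have fA: "finite A" using A(1) finite_subset by blast
  have fW: "finite W" by (simp add: W_def)
  have Cn: "C \<subseteq> {..<?n}" using A by (auto simp: C_def W_def)
  have cC: "card C = card W + Suc m" unfolding C_def using card_Un_disjoint[OF fW fA WA] A(2) by simp
  have CW: "r \<in> W" if "c \<in> C" "r < ?n" "X $$ (r,c) \<noteq> 0" for r c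
  proof -
    have "step P ord c r" using strict_partD(3)[OF X that(2) _ that(3)] that(1) Cn by auto
    thus ?thesis using that(1,2) step_trans[of P ord _ c r] by (auto simp: C_def W_def)
  qed
  have XZ: "X * Z \<in> carrier_mat ?n \<rho>" using Xc Z by simp
  \<comment> \<open>Two stacked homogeneous systems for w: X Z w vanishes on \<open>W\<close>, and Z
    w vanishes outside \<open>C\<close>. They amount to |W| + n - |C| = n - m - 1 conditions on n -
    m unknowns. Since X maps vectors supported in \<open>C\<close> into the span of
    \<open>W\<close>, a solution has X Z w = 0, against Y X Z = 1.\<close>
  define E where "E = mat (2 * ?n) \<rho> (\<lambda>(r,c). if r < ?n then (if r \<in> W then (X * Z) $$ (r,c) else 0)
    else if r - ?n \<notin> C then Z $$ (r - ?n, c) else 0)"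
  have E: "E \<in> carrier_mat (2 * ?n) \<rho>" by (simp add: E_def)
  have "{r. r < 2 * ?n \<and> (\<exists>c<\<rho>. E $$ (r,c) \<noteq> 0)} \<subseteq> W \<union> (\<lambda>c. c + ?n) ` ({..<?n} - C)"
  proof
    fix r assume "r \<in> {r. r < 2 * ?n \<and> (\<exists>c<\<rho>. E $$ (r,c) \<noteq> 0)}"
    then obtain c where r: "r < 2 * ?n" "c < \<rho>" "E $$ (r,c) \<noteq> 0" by blast
    show "r \<in> W \<union> (\<lambda>c. c + ?n) ` ({..<?n} - C)"
    proof (cases "r < ?n")
      case True
      then show ?thesis using r by (auto simp: E_def split: if_splits)
    next
      case False
      hence "r - ?n \<in> {..<?n} - C" using r by (auto simp: E_def split: if_splits)
      then show ?thesis using False by (auto intro!: image_eqI[of _ _ "r - ?n"])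
    qed
  qed
  from card_mono[OF _ this] have "card {r. r < 2 * ?n \<and> (\<exists>c<\<rho>. E $$ (r,c) \<noteq> 0)}
      \<le> card (W \<union> (\<lambda>c. c + ?n) ` ({..<?n} - C))" using fW by simp
  also have "\<dots> \<le> card W + card ((\<lambda>c. c + ?n) ` ({..<?n} - C))" by (rule card_Un_le)
  also have "\<dots> \<le> card W + card ({..<?n} - C)" by (simp add: card_image_le)
  also have "\<dots> = card W + (?n - card C)" using Cn by (simp add: card_Diff_subset finite_subset)
  also have "\<dots> < \<rho>" using cC card_mono[OF _ Cn] by (simp add: \<rho>_def)
  finally obtain w where w: "w \<in> carrier_vec \<rho>" "w \<noteq> 0\<^sub>v \<rho>" "E *\<^sub>v w = 0\<^sub>v (2 * ?n)"
    using underdetermined_system[OF E] by blast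
  have Ew: "(\<Sum>c<\<rho>. E $$ (r,c) * w $ c) = 0" if "r < 2 * ?n" for r
    using mat_mult_vec_entry[OF E w(1) that] w(3) that by simp
  have Zw: "(Z *\<^sub>v w) $ c = 0" if "c < ?n" "c \<notin> C" for c
  proof -
    have "(\<Sum>k<\<rho>. Z $$ (c,k) * w $ k) = (\<Sum>k<\<rho>. E $$ (c + ?n,k) * w $ k)"
      by (rule sum.cong) (use that in \<open>auto simp: E_def\<close>)
    thus ?thesis using Ew[of "c + ?n"] that mat_mult_vec_entry[OF Z w(1) that(1)] by simp
  qed
  have Zwc: "Z *\<^sub>v w \<in> carrier_vec ?n" using Z w by simp
  have assoc: "X * Z *\<^sub>v w = X *\<^sub>v (Z *\<^sub>v w)" by (rule assoc_mult_mat_vec[OF Xc Z w(1)])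
  have "X * Z *\<^sub>v w = 0\<^sub>v ?n"
  proof (rule eq_vecI)
    fix r assume "r < dim_vec (0\<^sub>v ?n :: 'a vec)"
    hence r: "r < ?n" by simp
    have "(X * Z *\<^sub>v w) $ r = 0"
    proof (cases "r \<in> W")
      case True
      have "(X * Z *\<^sub>v w) $ r = (\<Sum>k<\<rho>. (X * Z) $$ (r,k) * w $ k)"
        by (rule mat_mult_vec_entry[OF XZ w(1) r])
      also have "\<dots> = (\<Sum>k<\<rho>. E $$ (r,k) * w $ k)"
        by (rule sum.cong) (use r True in \<open>auto simp: E_def simp del: index_mult_mat\<close>)
      finally show ?thesis using Ew[of r] r by simp
    next
      case False
      have "(X *\<^sub>v (Z *\<^sub>v w)) $ r = (\<Sum>c<?n. X $$ (r,c) * (Z *\<^sub>v w) $ c)"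
        by (rule mat_mult_vec_entry[OF Xc Zwc r])
      also have "\<dots> = 0"
      proof (rule sum.neutral, intro ballI)
        fix c assume "c \<in> {..<?n}"
        hence c: "c < ?n" by simp
        show "X $$ (r,c) * (Z *\<^sub>v w) $ c = 0"
        proof (cases "c \<in> C")
          case True
          hence "X $$ (r,c) = 0" using CW[OF True r] False by blast
          thus ?thesis by simp
        next
          case False
          thus ?thesis using Zw[OF c] by simp
        qed
      qed
      finally show ?thesis unfolding assoc .
    qed
    thus "(X * Z *\<^sub>v w) $ r = 0\<^sub>v ?n $ r" using r by simp
  qed (use Xc in simp)
  moreover have "Y * X * Z = Y * (X * Z)" using Y Xc Z by (rule assoc_mult_mat)
  hence "Y * X * Z *\<^sub>v w = Y *\<^sub>v (X * Z *\<^sub>v w)" using assoc_mult_mat_vec[OF Y XZ w(1)] by simp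
  ultimately have "w = Y *\<^sub>v 0\<^sub>v ?n" using YZ w(1) by simp
  also have "\<dots> = 0\<^sub>v \<rho>" by (rule eq_vecI) (use Y in auto)
  finally show False using w(2) by simp
qed

text \<open>Levels 2, 1, 0 in the three blocks form an antichain: gaps of at least 2 between the
  sizes ensure that a vector of larger level is still farther from the top of its block.\<close>

lemma three_separated_rank_bound:
  fixes X :: "'a::field mat"
  assumes X: "X \<in> strict_part P ord" and i: "i1 < length P" "i2 < length P" "i3 < length P"
    and gap: "P ! i2 + 2 \<le> P ! i1" "P ! i3 + 2 \<le> P ! i2" "0 < P ! i3"
  shows "\<not> rank_ge (sum_list P) (sum_list P - 2) X"
proof -
  define a where "a = index_of P i1 2"
  define b where "b = index_of P i2 1"
  define c where "c = index_of P i3 0"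
  have a: "a < sum_list P" "level_of P a = 2" "size_at P a = P ! i1"
    using index_of_props[OF i(1), of 2] gap by (auto simp: a_def size_at_def)
  have b: "b < sum_list P" "level_of P b = 1" "size_at P b = P ! i2"
    using index_of_props[OF i(2), of 1] gap by (auto simp: b_def size_at_def)
  have c: "c < sum_list P" "level_of P c = 0" "size_at P c = P ! i3"
    using index_of_props[OF i(3), of 0] gap by (auto simp: c_def size_at_def)
  have "a \<noteq> b" "a \<noteq> c" "b \<noteq> c" using a b c by auto
  hence "card {a,b,c} = Suc 2" by simp
  moreover have "\<not> step P ord u v" if "u \<in> {a,b,c}" "v \<in> {a,b,c}" for u v
    using that a b c gap by (auto simp: step_def)
  ultimately show ?thesis
    by (intro antichain_rank_bound[OF X, where A = "{a,b,c}"]) (use a b c in auto)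
qed

section \<open>Chains for a union of two almost rectangular partitions\<close>

definition two_band :: "nat \<Rightarrow> nat \<Rightarrow> nat \<Rightarrow> nat \<Rightarrow> nat \<Rightarrow> nat \<Rightarrow> nat list" where
  "two_band p x y q z w = replicate x p @ replicate y (p - 1) @ replicate z q @ replicate w (q - 1)"

text \<open>The normal form in which the pieces are split off greedily from the top; this makes the
  six numbers unique. The last condition excludes parts equal to 0.\<close>

definition two_band_ok :: "nat \<Rightarrow> nat \<Rightarrow> nat \<Rightarrow> nat \<Rightarrow> nat \<Rightarrow> nat \<Rightarrow> bool" where
  "two_band_ok p x y q z w \<longleftrightarrow> 0 < x \<and> 0 < z \<and> 0 < q \<and> q + 2 \<le> p \<and> (q = 1 \<longrightarrow> w = 0)"

text \<open>The largest part of \<open>frakQ\<close>: the maximal length of a chain of basis vectors. Such a chain runs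
  through one of the pairs of sizes \<open>{p, p - 1}\<close>, \<open>{q, q - 1}\<close>, or \<open>{q + 1, q}\<close> if \<open>p = q + 2\<close>,
  and twice through each block of larger size.\<close>

definition max_chain :: "nat \<Rightarrow> nat \<Rightarrow> nat \<Rightarrow> nat \<Rightarrow> nat \<Rightarrow> nat \<Rightarrow> nat" where
  "max_chain p x y q z w = max (max (p * x + (p - 1) * y) (q * z + (q - 1) * w + 2 * (x + y)))
     (if p = q + 2 then q * z + (p - 1) * y + 2 * x else 0)"

lemma two_band_length: "length (two_band p x y q z w) = x + y + z + w"
  by (simp add: two_band_def)

lemma two_band_sum: "sum_list (two_band p x y q z w) = p * x + (p - 1) * y + q * z + (q - 1) * w"
  by (simp add: two_band_def sum_list_replicate algebra_simps)

lemma two_band_nth: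
  "i < x + y + z + w \<Longrightarrow> two_band p x y q z w ! i =
    (if i < x then p else if i < x + y then p - 1 else if i < x + y + z then q else q - 1)"
  by (auto simp: two_band_def nth_append)

lemma div_mod_sum: "0 < m \<Longrightarrow> i < m \<Longrightarrow> (j * m + i) div m = j \<and> (j * m + i) mod m = (i :: nat)"
  by simp

lemma inj_div_mod: "k div m = k' div m \<Longrightarrow> k mod m = k' mod m \<Longrightarrow> k = (k' :: nat)"
  by (metis div_mult_mod_eq)

text \<open>The numbers below j m + x fill \<open>j\<close> rows of width \<open>m\<close> and the
  first \<open>x\<close> places of the next row, the shape of a band listed level by level.\<close>

lemma less_rows_iff:
  assumes "0 < (m :: nat)" "x \<le> m"
  shows "k < j * m + x \<longleftrightarrow> k div m < j \<or> (k div m = j \<and> k mod m < x)"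
proof -
  define a b where "a = k div m" and "b = k mod m"
  have k: "k = a * m + b" and b: "b < m" using assms by (auto simp: a_def b_def)
  have 1: "a * m + m \<le> j * m" if "a < j"
    using that mult_le_mono1[of "Suc a" j m] by simp
  have 2: "j * m + m \<le> a * m" if "j < a"
    using that mult_le_mono1[of "Suc j" a m] by simp
  show ?thesis unfolding a_def[symmetric] b_def[symmetric] unfolding k using 1 2 b assms(2)
    by (cases "a < j"; cases "j < a") auto
qed

context
  fixes p x y q z w l s g P nL nS :: nat and L :: "nat list"
  assumes ok: "two_band_ok p x y q z w"
  defines "l \<equiv> x + y" and "s \<equiv> z + w" and "g \<equiv> p - q - 1" and "L \<equiv> two_band p x y q z w"
    and "nL \<equiv> p * x + (p - 1) * y" and "nS \<equiv> q * z + (q - 1) * w"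
begin

private lemma basic: "0 < x" "0 < z" "0 < q" "q + 2 \<le> p" "q = 1 \<longrightarrow> w = 0" "p = q + g + 1" "1 \<le> g" "0 < l" "0 < s" "x \<le> l" "z \<le> s"
  using ok by (auto simp: two_band_ok_def l_def s_def g_def)

private lemma nth_upper: "i < l \<Longrightarrow> L ! i = (if i < x then p else p - 1)"
  by (simp add: L_def two_band_nth l_def)

private lemma nth_lower: "i < s \<Longrightarrow> L ! (l + i) = (if i < z then q else q - 1)"
  by (simp add: L_def two_band_nth l_def s_def)

private lemma len: "length L = l + s"
  by (simp add: L_def two_band_length l_def s_def)

private lemma sum: "sum_list L = nL + nS"
  by (simp add: L_def two_band_sum nL_def nS_def)

private lemma nL_eq: "nL = (p - 1) * l + x"
  using basic by (cases p) (auto simp: nL_def l_def algebra_simps)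

private lemma nS_eq: "nS = (q - 1) * s + z"
  using basic by (cases q) (auto simp: nS_def s_def algebra_simps)

text \<open>Lists the upper piece level by level: levels 0 to p - 2 are full rows of
  \<open>l\<close> blocks, and the last row, of level p - 1, holds the \<open>x\<close> blocks of
  size \<open>p\<close>.\<close>

private definition upper_label :: "nat \<Rightarrow> nat \<times> nat" where
  "upper_label k = (k mod l, k div l)"

private definition lower_label :: "nat \<Rightarrow> nat \<times> nat" where
  "lower_label k = (l + k mod s, k div s)"

private lemma upper_label_ok: "k < nL \<Longrightarrow> label_ok L (upper_label k)"
  using less_rows_iff[of l x k "p - 1"] basic nL_eq nth_upper[of "k mod l"] trans_less_add1[OF mod_less_divisor[of l k], of s]
  by (auto simp: label_ok_def upper_label_def len)

private lemma lower_label_ok: "k < nS \<Longrightarrow> label_ok L (lower_label k)"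
  using less_rows_iff[of s z k "q - 1"] basic nS_eq nth_lower[of "k mod s"] mod_less_divisor[of s k]
  by (auto simp: label_ok_def lower_label_def len)

private lemma upper_label_inj: "upper_label k = upper_label k' \<Longrightarrow> k = k'"
  unfolding upper_label_def by (rule inj_div_mod[of k l k']) auto

private lemma lower_label_inj: "lower_label k = lower_label k' \<Longrightarrow> k = k'"
  unfolding lower_label_def by (rule inj_div_mod[of k s k']) auto

private lemma upper_lower_disj: "upper_label k \<noteq> lower_label k'"
proof
  assume "upper_label k = lower_label k'"
  hence "k mod l = l + k' mod s" by (simp add: upper_label_def lower_label_def)
  thus False using mod_less_divisor[OF basic(8), of k] by linarith
qed

private lemma upper_lower_images: "(\<lambda>t. upper_label (f t)) ` A \<inter> (\<lambda>t. lower_label (h t)) ` B = {}"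
proof (rule equals0I)
  fix u assume "u \<in> (\<lambda>t. upper_label (f t)) ` A \<inter> (\<lambda>t. lower_label (h t)) ` B"
  then obtain t t' where "u = upper_label (f t)" "u = lower_label (h t')" by blast
  thus False using upper_lower_disj[of "f t" "h t'"] by simp
qed

text \<open>The upper vector has the larger level, so incomparability means that it is also farther
  from the top of its block. The four conditional hypotheses are this inequality for the four
  combinations of sizes, where p - q = g + 1.\<close>

private lemma incomparable_labels:
  assumes "k' div s < k div l"
    and "k mod l < x \<Longrightarrow> k' mod s < z \<Longrightarrow> k div l \<le> k' div s + g"
    and "k mod l < x \<Longrightarrow> \<not> k' mod s < z \<Longrightarrow> k div l \<le> k' div s + g + 1"
    and "\<not> k mod l < x \<Longrightarrow> k' mod s < z \<Longrightarrow> k div l < k' div s + g"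
    and "\<not> k mod l < x \<Longrightarrow> \<not> k' mod s < z \<Longrightarrow> k div l \<le> k' div s + g"
  shows "incomparable L (upper_label k) (lower_label k')"
proof -
  have 1: "L ! (k mod l) = (if k mod l < x then p else p - 1)" using nth_upper basic by simp
  have 2: "L ! (l + k' mod s) = (if k' mod s < z then q else q - 1)" using nth_lower basic by simp
  show ?thesis unfolding incomparable_def upper_label_def lower_label_def fst_conv snd_conv 1 2
    using assms basic by auto
qed

text \<open>Each lower vector is paired with the upper vector one level higher in the same column,
  which exists as s \<le> l and q \<le> p - 2. Such a pair is comparable only for sizes p - 1 and q
  with g = 1, which \<open>gz\<close> rules out. The whole lower piece is used, and
  \<open>nL\<close> vectors remain.\<close>

lemma two_band_chain_upper_wide:
  fixes X :: "'a::field mat"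
  assumes X: "X \<in> strict_part L ord" and r: "rank_ge (sum_list L) 1 (X ^\<^sub>m k)"
    and sl: "s \<le> l" and gz: "2 \<le> g \<or> z \<le> x"
  shows "k < nL"
proof -
  define b where "b \<sigma> = upper_label ((\<sigma> div s + 1) * l + \<sigma> mod s)" for \<sigma>
  have dm: "((\<sigma> div s + 1) * l + \<sigma> mod s) div l = \<sigma> div s + 1" "((\<sigma> div s + 1) * l + \<sigma> mod s) mod l = \<sigma> mod s" for \<sigma>
    using div_mod_sum[of l "\<sigma> mod s" "\<sigma> div s + 1"] sl basic mod_less_divisor[of s \<sigma>] by linarith+
  have "k + card {..<nS} < sum_list L"
  proof (rule incomparable_pairs_bound[OF X r, where a = b and b = lower_label])
    show "inj_on b {..<nS}"
    proof (rule inj_onI)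
      fix t t' assume "b t = b t'"
      hence eq: "(t div s + 1) * l + t mod s = (t' div s + 1) * l + t' mod s"
        unfolding b_def by (rule upper_label_inj)
      have "t div s = t' div s" "t mod s = t' mod s"
        using arg_cong[OF eq, of "\<lambda>n. n div l"] arg_cong[OF eq, of "\<lambda>n. n mod l"] unfolding dm by simp_all
      thus "t = t'" by (rule inj_div_mod)
    qed
    show "inj_on lower_label {..<nS}" by (auto intro!: inj_onI dest: lower_label_inj)
    show "b ` {..<nS} \<inter> lower_label ` {..<nS} = {}"
      unfolding b_def by (rule upper_lower_images)
    fix t assume "t \<in> {..<nS}"
    hence t: "t < nS" by simp
    show "label_ok L (lower_label t)" by (rule lower_label_ok[OF t])
    have tq: "t div s < q" using less_rows_iff[of s z t "q - 1"] t nS_eq basic by auto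
    have "(t div s + 1) * l + t mod s < nL"
      unfolding nL_eq less_rows_iff[OF basic(8,10)] dm using tq basic by auto
    thus "label_ok L (b t)" unfolding b_def by (rule upper_label_ok)
    show "incomparable L (b t) (lower_label t)"
      unfolding b_def by (rule incomparable_labels) (use dm gz basic in auto)
  qed simp
  thus ?thesis by (simp add: sum)
qed

text \<open>Lower number t is paired with upper number t + l. The upper rows are not longer than the
  lower ones, so the partner is at least one level higher; \<open>le\<close> keeps it far enough
  from the top.\<close>

lemma two_band_chain_upper_narrow:
  fixes X :: "'a::field mat"
  assumes X: "X \<in> strict_part L ord" and r: "rank_ge (sum_list L) 1 (X ^\<^sub>m k)"
    and ls: "l \<le> s" and le: "nS + 2 * l \<le> nL"
  shows "k < nL"
proof -
  have "k + card {..<nS} < sum_list L"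
  proof (rule incomparable_pairs_bound[OF X r, where a = "\<lambda>\<sigma>. upper_label (\<sigma> + l)" and b = lower_label])
    show "inj_on (\<lambda>\<sigma>. upper_label (\<sigma> + l)) {..<nS}" by (auto intro!: inj_onI dest: upper_label_inj)
    show "inj_on lower_label {..<nS}" by (auto intro!: inj_onI dest: lower_label_inj)
    show "(\<lambda>\<sigma>. upper_label (\<sigma> + l)) ` {..<nS} \<inter> lower_label ` {..<nS} = {}"
      by (rule upper_lower_images)
    fix t assume "t \<in> {..<nS}"
    hence t: "t < nS" by simp
    show "label_ok L (lower_label t)" by (rule lower_label_ok[OF t])
    show "label_ok L (upper_label (t + l))" by (rule upper_label_ok) (use t le basic in simp)
    define j i where "j = t div s" and "i = t mod s"
    have ti: "t = j * s + i" "i < s" using basic by (auto simp: j_def i_def)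
    have jq: "j < q - 1 \<or> (j = q - 1 \<and> i < z)"
      using less_rows_iff[of s z t "q - 1"] t nS_eq basic by (auto simp: j_def i_def)
    have N: "(q - 1) * s + z + 2 * l \<le> (q + g) * l + x" using le nS_eq nL_eq basic by simp
    have low: "j < (t + l) div l"
    proof -
      have "j * l \<le> t" using mult_le_mono2[OF ls, of j] ti by linarith
      hence "j \<le> t div l" using basic by (simp add: less_eq_div_iff_mult_less_eq)
      thus ?thesis using basic by simp
    qed
    have up1: "t + l < (j + g) * l + x" if "i < z"
    proof -
      \<comment> \<open>The number of lower rows after row \<open>j\<close>. Subtracting them turns
        the inequality between the totals into one at row \<open>j\<close>.\<close>
      define e where "e = q - 1 - j"
      have q: "q = j + e + 1" using jq basic by (auto simp: e_def)
      have "e * l \<le> e * s" using ls by (rule mult_le_mono2)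
      moreover have "j * s + e * s + z + 2 * l \<le> j * l + e * l + l + g * l + x"
        using N by (simp add: q algebra_simps)
      ultimately show ?thesis using that ti unfolding add_mult_distrib mult_1 by linarith
    qed
    have up2: "t + l < (j + g + 1) * l + x" if "\<not> i < z"
    proof -
      define e where "e = q - 2 - j"
      have q: "q = j + e + 2" using jq that basic by (auto simp: e_def)
      have "e * l \<le> e * s" using ls by (rule mult_le_mono2)
      moreover have "j * s + e * s + s + z + 2 * l \<le> j * l + e * l + 2 * l + g * l + x"
        using N by (simp add: q algebra_simps)
      ultimately show ?thesis using that ti unfolding add_mult_distrib mult_1 by linarith
    qed
    have u1: "(t + l) div l < j + g \<or> ((t + l) div l = j + g \<and> (t + l) mod l < x)" if "i < z"
      using up1[OF that] unfolding less_rows_iff[OF basic(8,10)] .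
    have u2: "(t + l) div l < j + g + 1 \<or> ((t + l) div l = j + g + 1 \<and> (t + l) mod l < x)" if "\<not> i < z"
      using up2[OF that] unfolding less_rows_iff[OF basic(8,10)] .
    show "incomparable L (upper_label (t + l)) (lower_label t)"
      by (rule incomparable_labels; unfold j_def[symmetric] i_def[symmetric]) (use low u1 u2 in linarith)+
  qed simp
  thus ?thesis by (simp add: sum)
qed

text \<open>Blocks of size p are paired with blocks of size q, and blocks of size q - 1 with blocks
  of size p - 1, the upper one raised by a level. For g = 1 both differences of size are 2, which
  makes the pairs incomparable; x q + w (q - 1) pairs leave q z + (p - 1) y + 2 x vectors.\<close>

lemma two_band_chain_middle:
  fixes X :: "'a::field mat"
  assumes X: "X \<in> strict_part L ord" and r: "rank_ge (sum_list L) 1 (X ^\<^sub>m k)"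
    and g1: "g = 1" and wy: "w \<le> y" and xz: "x \<le> z"
  shows "k < q * z + (p - 1) * y + 2 * x"
proof -
  define T where "T = {True} \<times> {..<x} \<times> {..<q} \<union> {False} \<times> {..<w} \<times> {..<q - 1}"
  define a where "a = (\<lambda>(t, i, j). if t then (i, Suc j) else (x + i, Suc j))"
  define b where "b = (\<lambda>(t, i, j). if t then (l + i, j) else (l + z + i, j :: nat))"
  have p: "p = q + 2" using g1 basic by simp
  have "k + card T < sum_list L"
  proof (rule incomparable_pairs_bound[OF X r, where a = a and b = b])
    show "finite T" by (simp add: T_def)
    show "inj_on a T" unfolding inj_on_def T_def a_def by auto
    show "inj_on b T" unfolding inj_on_def T_def b_def using xz by auto
    show "a ` T \<inter> b ` T = {}" unfolding T_def a_def b_def using wy by (auto simp: l_def)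
    fix t assume t: "t \<in> T"
    have nth: "L ! (l + z + i) = q - 1" if "i < w" for i
      using nth_lower[of "z + i"] that by (simp add: s_def add.assoc)
    show "label_ok L (a t)" using t nth_upper wy p basic
      by (auto simp: T_def a_def label_ok_def len l_def)
    show "label_ok L (b t)" using t nth_lower nth xz basic
      by (auto simp: T_def b_def label_ok_def len s_def)
    show "incomparable L (a t) (b t)" using t nth_lower nth nth_upper xz wy p basic
      by (auto simp: T_def a_def b_def incomparable_def l_def s_def)
  qed
  moreover have "card T = x * q + w * (q - 1)"
    unfolding T_def by (subst card_Un_disjoint) (auto simp: card_cartesian_product)
  ultimately show ?thesis using p by (simp add: sum nL_def nS_def algebra_simps)
qed

text \<open>The upper piece without its first and last \<open>l\<close> vectors is paired with lower
  vectors, which leaves nS + 2 l. The partner of number \<nu> is chosen by its distance from the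
  top, and moved up to number \<nu> - l where that would fall short, which keeps the assignment
  injective.\<close>

lemma two_band_chain_lower:
  fixes X :: "'a::field mat"
  assumes X: "X \<in> strict_part L ord" and r: "rank_ge (sum_list L) 1 (X ^\<^sub>m k)"
    and ls: "l \<le> s" and le: "nL \<le> nS + 2 * l" and gy: "2 \<le> g \<or> y \<le> w"
  shows "k < nS + 2 * l"
proof -
  \<comment> \<open>Row and column are kept while the width of the rows changes from
    \<open>l\<close> to \<open>s\<close>.\<close>
  define f where "f \<mu> = (\<mu> div l) * s + \<mu> mod l" for \<mu>
  \<comment> \<open>After subtracting \<open>x\<close>, the upper rows consist of vectors at equal
    distance from the top; so do the lower rows after subtracting \<open>z\<close>. The second entry
    is thus a lower vector whose distance is smaller by one. It is cut off at 0 for small \<nu>,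
    where the first entry keeps \<sigma> strictly increasing.\<close>
  define \<sigma> where "\<sigma> \<nu> = max (\<nu> - l) (f (\<nu> - x) + z - g * s)" for \<nu>
  have f_mono: "f \<mu> < f \<mu>'" if "\<mu> < \<mu>'" for \<mu> \<mu>'
  proof (cases "\<mu> div l = \<mu>' div l")
    case True
    hence "\<mu> mod l < \<mu>' mod l" using that by (metis add_less_cancel_left div_mult_mod_eq)
    thus ?thesis using True by (simp add: f_def)
  next
    case False
    moreover have "\<mu> div l \<le> \<mu>' div l" using that by (simp add: div_le_mono)
    ultimately have "Suc (\<mu> div l) * s \<le> \<mu>' div l * s" by (intro mult_le_mono1) simp
    moreover have "\<mu> mod l < s" using mod_less_divisor[of l \<mu>] basic ls by linarith
    ultimately show ?thesis unfolding f_def mult_Suc by linarith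
  qed
  have \<sigma>_mono: "\<sigma> \<nu> < \<sigma> \<nu>'" if "l \<le> \<nu>" "\<nu> < \<nu>'" for \<nu> \<nu>'
  proof -
    have "f (\<nu> - x) < f (\<nu>' - x)" using that basic by (intro f_mono) linarith
    thus ?thesis using that unfolding \<sigma>_def by linarith
  qed
  have \<sigma>_inj: "\<nu> = \<nu>'" if "l \<le> \<nu>" "l \<le> \<nu>'" "\<sigma> \<nu> = \<sigma> \<nu>'" for \<nu> \<nu>'
    using \<sigma>_mono[OF that(1), of \<nu>'] \<sigma>_mono[OF that(2), of \<nu>] that(3) by linarith
  have ps: "(p - 2) * s = (q - 1) * s + g * s"
    unfolding add_mult_distrib[symmetric] using basic by (intro arg_cong[where f = "\<lambda>n. n * s"]) linarith
  have nL2: "nL = (p - 2) * l + x + l"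
    unfolding nL_eq using basic by (cases "p - 1") (auto simp: algebra_simps)
  have rows: "b \<le> a \<and> (b = a \<longrightarrow> z \<le> i)" if "b * s + z \<le> a * s + i" "i < s" for a b i
  proof -
    have "Suc a * s \<le> b * s" if "a < b" using that by (intro mult_le_mono1) simp
    hence "\<not> a < b" using that unfolding mult_Suc by linarith
    thus ?thesis using that by auto
  qed
  have "k + card {l..<nL - l} < sum_list L"
  proof (rule incomparable_pairs_bound[OF X r, where a = upper_label and b = "\<lambda>t. lower_label (\<sigma> t)"])
    show "inj_on upper_label {l..<nL - l}" by (auto intro!: inj_onI dest: upper_label_inj)
    show "inj_on (\<lambda>t. lower_label (\<sigma> t)) {l..<nL - l}"
    proof (rule inj_onI)
      fix t t' assume "t \<in> {l..<nL - l}" "t' \<in> {l..<nL - l}" "lower_label (\<sigma> t) = lower_label (\<sigma> t')"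
      thus "t = t'" using \<sigma>_inj[of t t'] lower_label_inj[of "\<sigma> t" "\<sigma> t'"] by simp
    qed
    show "upper_label ` {l..<nL - l} \<inter> (\<lambda>t. lower_label (\<sigma> t)) ` {l..<nL - l} = {}"
      by (rule upper_lower_images)
    fix t assume "t \<in> {l..<nL - l}"
    hence t: "l \<le> t" "t < nL - l" by auto
    show "label_ok L (upper_label t)" by (rule upper_label_ok) (use t in linarith)
    define j' i' where "j' = t div l" and "i' = t mod l"
    have ti: "t = j' * l + i'" "i' < l" using basic by (auto simp: j'_def i'_def)
    have j'1: "1 \<le> j'" using div_le_mono[OF t(1), of l] basic(8) by (simp add: j'_def)
    have js: "j' * s = (j' - 1) * s + s" and jl: "j' * l = (j' - 1) * l + l"
      using j'1 by (cases j'; simp)+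
    define F where "F = f (t - x)"
    have F: "F + x = j' * s + i'" if "x \<le> i'"
    proof -
      have "t - x = j' * l + (i' - x)" "i' - x < l" using that ti by auto
      hence "F = j' * s + (i' - x)" unfolding F_def f_def using div_mod_sum[OF basic(8), of "i' - x" j'] by simp
      thus ?thesis using that by simp
    qed
    have F': "F + x = (j' - 1) * s + l + i'" if "i' < x"
    proof -
      have "t - x = (j' - 1) * l + (l + i' - x)" "l + i' - x < l" using that ti jl basic by auto
      hence "F = (j' - 1) * s + (l + i' - x)"
        unfolding F_def f_def using div_mod_sum[OF basic(8), of "l + i' - x" "j' - 1"] by simp
      thus ?thesis using that basic by simp
    qed
    have zg: "g * s \<ge> s" "2 \<le> g \<Longrightarrow> g * s \<ge> 2 * s" using basic by auto
    have up: "\<sigma> t < j' * s"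
    proof -
      have "(j' - 1) * l \<le> (j' - 1) * s" using ls by simp
      hence "t - l < j' * s" using ti jl js ls by linarith
      moreover have "F + z < j' * s + g * s"
      proof (cases "x \<le> i'")
        case True
        have ys: "y \<le> l" "s = z + w" by (simp_all add: l_def s_def)
        have "y + z \<le> g * s"
          using gy
        proof
          assume "2 \<le> g"
          thus ?thesis using zg(2) ls ys(1) basic(11) by linarith
        next
          assume "y \<le> w"
          thus ?thesis using zg(1) ys(2) by linarith
        qed
        thus ?thesis using F[OF True] ti by (simp add: l_def)
      next
        case False
        then show ?thesis using F' js zg ls basic by linarith
      qed
      moreover have "0 < j' * s" using j'1 basic by simp
      ultimately show ?thesis unfolding \<sigma>_def F_def[symmetric] by linarith
    qed
    have "\<sigma> t < nS"
    proof -
      have "t - l < nS" using t le by linarith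
      moreover have "F < (p - 2) * s"
      proof -
        have "t - x < (p - 2) * l" using t nL2 basic by linarith
        hence "(t - x) div l < p - 2" by (rule less_mult_imp_div_less)
        hence "Suc ((t - x) div l) * s \<le> (p - 2) * s" by (intro mult_le_mono1) simp
        moreover have "(t - x) mod l < s" using mod_less_divisor[of l "t - x"] basic ls by linarith
        ultimately show ?thesis unfolding F_def f_def mult_Suc by linarith
      qed
      ultimately show ?thesis unfolding \<sigma>_def F_def[symmetric] using nS_eq ps basic by linarith
    qed
    thus "label_ok L (lower_label (\<sigma> t))" by (rule lower_label_ok)
    define j i where "j = \<sigma> t div s" and "i = \<sigma> t mod s"
    have si: "\<sigma> t = j * s + i" "i < s" using basic by (auto simp: j_def i_def)
    have low: "F + z \<le> (j + g) * s + i"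
      using si(1) unfolding \<sigma>_def F_def[symmetric] add_mult_distrib by linarith
    have jj: "j < j'" using up unfolding j_def by (simp add: less_mult_imp_div_less)
    have c1: "j' \<le> j + g \<and> (j' = j + g \<longrightarrow> z \<le> i)" if "x \<le> i'"
      by (rule rows[OF _ si(2)]) (use low F[OF that] that in linarith)
    have c2: "j' \<le> j + g + 1 \<and> (j' = j + g + 1 \<longrightarrow> z \<le> i)" if "i' < x"
      by (rule rows[OF _ si(2)]) (use low F'[OF that] js basic in \<open>simp add: add_mult_distrib\<close>)
    show "incomparable L (upper_label t) (lower_label (\<sigma> t))"
      by (rule incomparable_labels; unfold j_def[symmetric] i_def[symmetric] j'_def[symmetric] i'_def[symmetric])
         (use jj c1 c2 in linarith)+
  qed simp
  thus ?thesis using nL2 by (simp add: sum)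
qed

end

text \<open>The regions cover everything: if g = 1, then s \<le> l with z > x forces w < y, and l
  \<le> s with y > w forces x < z, so the middle pairing applies.\<close>

lemma two_band_power_bound:
  fixes X :: "'a::field mat"
  assumes ok: "two_band_ok p x y q z w" and X: "X \<in> strict_part (two_band p x y q z w) ord"
    and r: "rank_ge (sum_list (two_band p x y q z w)) 1 (X ^\<^sub>m k)"
  shows "k < max_chain p x y q z w"
proof -
  let ?nL = "p * x + (p - 1) * y" and ?nS = "q * z + (q - 1) * w"
  let ?l = "x + y" and ?s = "z + w" and ?g = "p - q - 1"
  have b: "0 < x" "0 < z" "0 < q" "q + 2 \<le> p" "q = 1 \<longrightarrow> w = 0" using ok by (auto simp: two_band_ok_def)
  consider (mid) "?g = 1" "w \<le> y" "x \<le> z" | (wide) "?s \<le> ?l" "2 \<le> ?g \<or> z \<le> x"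
    | (narrow) "?l \<le> ?s" "2 \<le> ?g \<or> y \<le> w" using b by linarith
  thus ?thesis
  proof cases
    case mid
    from two_band_chain_middle[OF ok X r mid] show ?thesis using mid(1) b by (auto simp: max_chain_def)
  next
    case wide
    from two_band_chain_upper_wide[OF ok X r wide] show ?thesis by (auto simp: max_chain_def)
  next
    case narrow
    show ?thesis
    proof (cases "?nS + 2 * ?l \<le> ?nL")
      case True
      from two_band_chain_upper_narrow[OF ok X r narrow(1) True] show ?thesis by (auto simp: max_chain_def)
    next
      case False
      from two_band_chain_lower[OF ok X r narrow(1) _ narrow(2)] False show ?thesis by (auto simp: max_chain_def)
    qed
  qed
qed

subsection \<open>Matrices with long chains\<close>

text \<open>Powers of \<open>toeplitz P a\<close> count paths of labelled edges. Weighting the edges by powers of an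
  indeterminate, a path is isolated by its weight: all other paths stay within the states satisfying
  \<open>junk\<close>, which is closed under edges and avoids the end of the given path.\<close>

lemma toeplitz_pow_path_coeff:
  fixes a :: "nat \<Rightarrow> nat \<Rightarrow> nat \<Rightarrow> 'a::comm_ring_1 poly" and path :: "nat \<Rightarrow> nat \<times> nat"
  assumes a: "\<And>i i' d. a i i' d = (if E i i' d then monom 1 (wt i i' d) else 0)"
    and ok: "\<And>k. k \<le> N \<Longrightarrow> label_ok P (path k)"
    and w0: "v 0 = 0"
    and step: "\<And>k. k < N \<Longrightarrow> \<exists>d. E (fst (path k)) (fst (path (Suc k))) d \<and>
      snd (path (Suc k)) = snd (path k) + d \<and> v (Suc k) = v k + wt (fst (path k)) (fst (path (Suc k))) d"
    and branch: "\<And>k i' d. k < N \<Longrightarrow> E (fst (path k)) i' d \<Longrightarrow> label_ok P (i', snd (path k) + d) \<Longrightarrow>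
      ((i', snd (path k) + d) = path (Suc k) \<and> v k + wt (fst (path k)) i' d = v (Suc k)) \<or>
      junk i' (snd (path k) + d) (v k + wt (fst (path k)) i' d)"
    and closed: "\<And>i j u i' d. junk i j u \<Longrightarrow> label_ok P (i, j) \<Longrightarrow> E i i' d \<Longrightarrow> label_ok P (i', j + d) \<Longrightarrow>
      junk i' (j + d) (u + wt i i' d)"
    and k: "k \<le> N" and r: "r < sum_list P" and nj: "\<not> junk (block_of P r) (level_of P r) u"
  shows "coeff ((toeplitz P a ^\<^sub>m k) $$ (r, index_of P (fst (path 0)) (snd (path 0)))) u =
    (if (block_of P r, level_of P r) = path k \<and> u = v k then 1 else 0)"
  using k r nj
proof (induction k arbitrary: r u)
  case 0
  have 00: "index_of P (fst (path 0)) (snd (path 0)) < sum_list P"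
    "block_of P (index_of P (fst (path 0)) (snd (path 0))) = fst (path 0)"
    "level_of P (index_of P (fst (path 0)) (snd (path 0))) = snd (path 0)"
    using index_of_props[of "fst (path 0)" P "snd (path 0)"] ok[of 0] by (auto simp: label_ok_def)
  have "r = index_of P (fst (path 0)) (snd (path 0)) \<longleftrightarrow> (block_of P r, level_of P r) = path 0"
    using index_props(3)[OF 0(2)] 00 by (metis fst_conv snd_conv prod.collapse)
  then show ?case using 0(2) 00 w0 by (auto simp: toeplitz_def)
next
  case (Suc k)
  let ?n = "sum_list P" and ?A = "toeplitz P a"
  let ?c0 = "index_of P (fst (path 0)) (snd (path 0))"
  have c0: "?c0 < ?n" using index_of_props[of "fst (path 0)" P "snd (path 0)"] ok[of 0] by (auto simp: label_ok_def)
  have kN: "k < N" using Suc.prems by simp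
  note r = Suc.prems(2)
  have lab: "label_ok P (block_of P c, level_of P c)" if "c < ?n" for c
    using index_props[OF that] by (simp add: label_ok_def)
  define d where "d c = level_of P r - level_of P c" for c
  define e where "e c \<longleftrightarrow> level_of P c \<le> level_of P r \<and> E (block_of P c) (block_of P r) (d c)" for c
  define \<omega> where "\<omega> c = wt (block_of P c) (block_of P r) (d c)" for c
  have contrib: "coeff (?A $$ (r,c) * (?A ^\<^sub>m k) $$ (c, ?c0)) u =
      (if e c \<and> (block_of P c, level_of P c) = path k \<and> u = v k + \<omega> c then 1 else 0)" if c: "c < ?n" for c
  proof (cases "e c \<and> \<omega> c \<le> u")
    case True
    have A: "?A $$ (r,c) = monom 1 (\<omega> c)"
      using True by (simp add: toeplitz_entry[OF r c] a e_def d_def \<omega>_def)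
    have lev: "level_of P r = level_of P c + d c" using True by (auto simp: e_def d_def)
    \<comment> \<open>By \<open>closed\<close>, a predecessor in a junk state would make the current
      state junk; so the induction hypothesis applies to the predecessor.\<close>
    have "\<not> junk (block_of P c) (level_of P c) (u - \<omega> c)"
    proof
      assume "junk (block_of P c) (level_of P c) (u - \<omega> c)"
      from closed[OF this lab[OF c], of "block_of P r" "d c"] True lab[OF r] lev
      have "junk (block_of P r) (level_of P r) (u - \<omega> c + \<omega> c)" by (simp add: e_def \<omega>_def)
      thus False using Suc.prems(3) True by simp
    qed
    from Suc.IH[OF _ c this] kN
    have "coeff ((?A ^\<^sub>m k) $$ (c, ?c0)) (u - \<omega> c) =
      (if (block_of P c, level_of P c) = path k \<and> u - \<omega> c = v k then 1 else 0)" by simp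
    moreover have "u - \<omega> c = v k \<longleftrightarrow> u = v k + \<omega> c" using True by auto
    ultimately show ?thesis using True unfolding A by (auto simp: coeff_monom_mult)
  next
    case False
    have "coeff (?A $$ (r,c) * (?A ^\<^sub>m k) $$ (c, ?c0)) u = 0"
    proof (cases "e c")
      case True
      then show ?thesis using False
        by (simp add: toeplitz_entry[OF r c] a e_def d_def \<omega>_def coeff_monom_mult)
    next
      case False
      then show ?thesis by (auto simp: toeplitz_entry[OF r c] a e_def d_def)
    qed
    then show ?thesis using False by auto
  qed
  define c1 where "c1 = index_of P (fst (path k)) (snd (path k))"
  have c1: "c1 < ?n" "block_of P c1 = fst (path k)" "level_of P c1 = snd (path k)"
    using index_of_props[of "fst (path k)" P "snd (path k)"] ok[of k] kN by (auto simp: label_ok_def c1_def)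
  have c1_iff: "(block_of P c, level_of P c) = path k \<longleftrightarrow> c = c1" if "c < ?n" for c
    using index_props(3)[OF that] c1 unfolding c1_def by (metis fst_conv snd_conv prod.collapse)
  have "coeff ((?A ^\<^sub>m Suc k) $$ (r, ?c0)) u = coeff (\<Sum>c<?n. ?A $$ (r,c) * (?A ^\<^sub>m k) $$ (c, ?c0)) u"
    unfolding pow_mat_Suc_left[OF toeplitz_carrier]
    by (rule arg_cong[OF mult_mat_entry[OF toeplitz_carrier pow_carrier_mat[OF toeplitz_carrier] r c0]])
  also have "\<dots> = (\<Sum>c<?n. if c = c1 then (if e c \<and> u = v k + \<omega> c then 1 else 0) else 0)"
    unfolding coeff_sum by (rule sum.cong) (use c1_iff in \<open>auto simp: contrib\<close>)
  also have "\<dots> = (if e c1 \<and> u = v k + \<omega> c1 then 1 else 0)" using c1(1) by simp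
  also have "e c1 \<and> u = v k + \<omega> c1 \<longleftrightarrow> (block_of P r, level_of P r) = path (Suc k) \<and> u = v (Suc k)"
  proof
    assume L: "e c1 \<and> u = v k + \<omega> c1"
    have lev: "level_of P r = snd (path k) + d c1" using L c1 by (auto simp: e_def d_def)
    have "E (fst (path k)) (block_of P r) (d c1)" using L c1 by (simp add: e_def)
    from branch[OF kN this] lab[OF r] lev
    have "(block_of P r, level_of P r) = path (Suc k) \<and> v k + \<omega> c1 = v (Suc k) \<or>
      junk (block_of P r) (level_of P r) (v k + \<omega> c1)" by (simp add: \<omega>_def c1)
    thus "(block_of P r, level_of P r) = path (Suc k) \<and> u = v (Suc k)" using L Suc.prems(3) by auto
  next
    assume R: "(block_of P r, level_of P r) = path (Suc k) \<and> u = v (Suc k)"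
    from step[OF kN] obtain d' where d': "E (fst (path k)) (fst (path (Suc k))) d'"
      "snd (path (Suc k)) = snd (path k) + d'" "v (Suc k) = v k + wt (fst (path k)) (fst (path (Suc k))) d'" by blast
    have pr: "fst (path (Suc k)) = block_of P r" "snd (path (Suc k)) = level_of P r" using R by (metis fst_conv snd_conv)+
    have "d c1 = d'" using d'(2) pr c1 by (simp add: d_def)
    thus "e c1 \<and> u = v k + \<omega> c1" using d' pr c1 R by (simp add: e_def \<omega>_def)
  qed
  finally show ?case .
qed

lemma toeplitz_strict_part:
  fixes a :: "nat \<Rightarrow> nat \<Rightarrow> nat \<Rightarrow> 'a::comm_ring_1"
  assumes "\<And>i i' d. i < length P \<Longrightarrow> i' < length P \<Longrightarrow> a i i' d \<noteq> 0 \<Longrightarrow> P ! i' \<le> d + P ! i"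
    and "\<And>i i'. i < length P \<Longrightarrow> i' < length P \<Longrightarrow> a i i' 0 \<noteq> 0 \<Longrightarrow> P ! i = P ! i' \<Longrightarrow> i < i'"
  shows "toeplitz P a \<in> strict_part P (\<lambda>i. i)"
proof (rule strict_partI[OF toeplitz_commutant[OF assms(1)]])
  fix r c assume rc: "r < sum_list P" "c < sum_list P" "toeplitz P a $$ (r,c) \<noteq> 0"
    "size_at P r = size_at P c" "level_of P r = level_of P c"
  thus "block_of P c < block_of P r"
    using assms(2)[of "block_of P c" "block_of P r"] index_props(1)[OF rc(1)] index_props(1)[OF rc(2)]
    by (auto simp: toeplitz_entry size_at_def)
qed

text \<open>The entry from the start to the end of the path has coefficient 1 at the weight
  \<open>v N\<close>. It is therefore a nonzero polynomial, which survives evaluation at some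
  element of an infinite field; evaluation commutes with the power.\<close>

lemma toeplitz_path_power:
  fixes path :: "nat \<Rightarrow> nat \<times> nat" and wt :: "nat \<Rightarrow> nat \<Rightarrow> nat \<Rightarrow> nat"
  assumes inf: "infinite (UNIV :: 'a::field set)"
    and valid: "\<And>i i' d. i < length P \<Longrightarrow> i' < length P \<Longrightarrow> E i i' d \<Longrightarrow> P ! i' \<le> d + P ! i"
    and strict: "\<And>i i'. i < length P \<Longrightarrow> i' < length P \<Longrightarrow> E i i' 0 \<Longrightarrow> P ! i = P ! i' \<Longrightarrow> i < i'"
    and ok: "\<And>k. k \<le> N \<Longrightarrow> label_ok P (path k)"
    and w0: "v 0 = 0"
    and step: "\<And>k. k < N \<Longrightarrow> \<exists>d. E (fst (path k)) (fst (path (Suc k))) d \<and>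
      snd (path (Suc k)) = snd (path k) + d \<and> v (Suc k) = v k + wt (fst (path k)) (fst (path (Suc k))) d"
    and branch: "\<And>k i' d. k < N \<Longrightarrow> E (fst (path k)) i' d \<Longrightarrow> label_ok P (i', snd (path k) + d) \<Longrightarrow>
      ((i', snd (path k) + d) = path (Suc k) \<and> v k + wt (fst (path k)) i' d = v (Suc k)) \<or>
      junk i' (snd (path k) + d) (v k + wt (fst (path k)) i' d)"
    and closed: "\<And>i j u i' d. junk i j u \<Longrightarrow> label_ok P (i, j) \<Longrightarrow> E i i' d \<Longrightarrow> label_ok P (i', j + d) \<Longrightarrow>
      junk i' (j + d) (u + wt i i' d)"
    and end_ok: "\<not> junk (fst (path N)) (snd (path N)) (v N)"
  shows "\<exists>X\<in>strict_part P (\<lambda>i. i). rank_ge (sum_list P) 1 (X ^\<^sub>m N :: 'a mat)"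
proof -
  let ?n = "sum_list P"
  define a where "a i i' d = (if E i i' d then monom (1 :: 'a) (wt i i' d) else 0)" for i i' d
  define r where "r = index_of P (fst (path N)) (snd (path N))"
  define c where "c = index_of P (fst (path 0)) (snd (path 0))"
  have r: "r < ?n" "block_of P r = fst (path N)" "level_of P r = snd (path N)"
    using index_of_props[of "fst (path N)" P "snd (path N)"] ok[of N] by (auto simp: label_ok_def r_def)
  have c: "c < ?n" using index_of_props[of "fst (path 0)" P "snd (path 0)"] ok[of 0] by (auto simp: label_ok_def c_def)
  have "coeff ((toeplitz P a ^\<^sub>m N) $$ (r, c)) (v N) =
    (if (block_of P r, level_of P r) = path N \<and> v N = v N then 1 else 0)"
    unfolding c_def
    by (rule toeplitz_pow_path_coeff[OF a_def ok w0 step branch closed order.refl r(1)]) (use end_ok r in auto)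
  hence "(toeplitz P a ^\<^sub>m N) $$ (r, c) \<noteq> 0" using r by auto
  from infinite_field_nonroot[OF inf this] obtain t where t: "poly ((toeplitz P a ^\<^sub>m N) $$ (r, c)) t \<noteq> 0" .
  define X where "X = toeplitz P (\<lambda>i i' d. poly (a i i' d) t)"
  have XA: "X = map_mat (\<lambda>p. poly p t) (toeplitz P a)"
    unfolding X_def by (rule eq_matI) (auto simp: toeplitz_def)
  have "X ^\<^sub>m N = map_mat (\<lambda>p. poly p t) (toeplitz P a ^\<^sub>m N)"
    unfolding XA by (rule semiring_hom.mat_hom_pow[OF poly_semiring_hom toeplitz_carrier, symmetric])
  moreover have C: "toeplitz P a ^\<^sub>m N \<in> carrier_mat ?n ?n" by (rule pow_carrier_mat[OF toeplitz_carrier])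
  have "map_mat (\<lambda>p. poly p t) (toeplitz P a ^\<^sub>m N) $$ (r,c) = poly ((toeplitz P a ^\<^sub>m N) $$ (r,c)) t"
    by (rule index_map_mat(1)) (use r(1) c carrier_matD[OF C] in simp_all)
  ultimately have "(X ^\<^sub>m N) $$ (r,c) \<noteq> 0" using t by simp
  moreover have "X \<in> strict_part P (\<lambda>i. i)"
    unfolding X_def by (rule toeplitz_strict_part) (use valid strict in \<open>auto simp: a_def split: if_splits\<close>)
  moreover have "X ^\<^sub>m N \<in> carrier_mat ?n ?n" unfolding X_def by (rule pow_carrier_mat[OF toeplitz_carrier])
  ultimately show ?thesis using rank_ge_1_iff r(1) c by blast
qed

text \<open>Each block has one outgoing edge, to the next block at the same level, or from the last
  block to the first one a level higher. The path is forced, so all weights are 0 and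
  \<open>junk\<close> is empty.\<close>

lemma band_chain_exists:
  fixes R :: "nat list"
  assumes inf: "infinite (UNIV :: 'a::field set)"
    and x: "0 < x" and p: "0 < p" and y: "0 < y \<longrightarrow> 2 \<le> p"
  defines "P \<equiv> replicate x p @ replicate y (p - 1) @ R"
  shows "\<exists>X\<in>strict_part P (\<lambda>i. i). rank_ge (sum_list P) 1 (X ^\<^sub>m (p * x + (p - 1) * y - 1) :: 'a mat)"
proof -
  define l where "l = x + y"
  define N where "N = p * x + (p - 1) * y - 1"
  have nL: "p * x + (p - 1) * y = (p - 1) * l + x"
    using p by (cases p) (auto simp: l_def algebra_simps)
  have l: "0 < l" "x \<le> l" using x by (auto simp: l_def)
  have nth: "P ! i = (if i < x then p else p - 1)" "i < length P" if "i < l" for i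
    using that by (auto simp: P_def l_def nth_append)
  define E where "E i i' d \<longleftrightarrow> i < l \<and> (if i = l - 1 then i' = 0 \<and> d = 1 else i' = Suc i \<and> d = (0::nat))" for i i' d
  define path where "path k = (k mod l, k div l)" for k
  have ok: "label_ok P (path k)" if "k \<le> N" for k
  proof -
    have "k < (p - 1) * l + x" using that nL x unfolding N_def by linarith
    hence "k div l < p - 1 \<or> (k div l = p - 1 \<and> k mod l < x)" using less_rows_iff[OF l] by blast
    thus ?thesis using nth[of "k mod l"] l p unfolding label_ok_def path_def by (cases "k mod l < x") auto
  qed
  have succ: "path (Suc k) = (if k mod l = l - 1 then (0, Suc (k div l)) else (Suc (k mod l), k div l))" for k
    using l unfolding path_def by (auto simp: mod_Suc div_Suc)
  show ?thesis
    unfolding N_def[symmetric]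
  proof (rule toeplitz_path_power[OF inf _ _ ok, where E = E and v = "\<lambda>_. 0" and wt = "\<lambda>_ _ _. 0" and junk = "\<lambda>_ _ _. False"])
    fix i i' d assume "E i i' d"
    thus "P ! i' \<le> d + P ! i" using nth[of i] nth[of i'] l p unfolding E_def by (auto split: if_splits)
  next
    fix i i' assume "E i i' 0"
    thus "i < i'" unfolding E_def by (cases "i = l - 1") simp_all
  next
    fix k
    have "k mod l < l" using l by simp
    thus "\<exists>d. E (fst (path k)) (fst (path (Suc k))) d \<and> snd (path (Suc k)) = snd (path k) + d \<and> (0::nat) = 0 + 0"
      unfolding succ E_def
      by (intro exI[of _ "if k mod l = l - 1 then 1 else 0"]) (simp add: path_def)
  next
    fix k i' d assume "E (fst (path k)) i' d"
    thus "((i', snd (path k) + d) = path (Suc k) \<and> (0::nat) + 0 = 0) \<or> False"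
      unfolding succ E_def by (cases "k mod l = l - 1") (simp_all add: path_def)
  qed simp_all
qed

text \<open>The path runs through the upper blocks at level 0, through the whole band {a, a - 1},
  and back through the upper blocks at their top levels. The general \<open>a\<close> and the tail
  \<open>R\<close> also cover the chain through {q + 1, q} for p = q + 2, where only the parts
  \<open>p\<close> lie above.\<close>

lemma large_blocks_chain_exists:
  fixes R :: "nat list"
  assumes inf: "infinite (UNIV :: 'a::field set)"
    and x: "0 < x" and z: "0 < z" and a: "0 < a" "a < p" and y: "0 < y \<longrightarrow> a + 2 \<le> p" and w: "0 < w \<longrightarrow> 2 \<le> a"
  defines "P \<equiv> replicate x p @ replicate y (p - 1) @ replicate z a @ replicate w (a - 1) @ R"
  shows "\<exists>X\<in>strict_part P (\<lambda>i. i). rank_ge (sum_list P) 1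
    (X ^\<^sub>m (a * z + (a - 1) * w + 2 * (x + y) - 1) :: 'a mat)"
proof -
  define l s nS where "l = x + y" and "s = z + w" and "nS = a * z + (a - 1) * w"
  define N where "N = nS + 2 * l - 1"
  have nS: "nS = (a - 1) * s + z" using a by (cases a) (auto simp: nS_def s_def algebra_simps)
  have l: "0 < l" "x \<le> l" "0 < s" "z \<le> s" using x z by (auto simp: l_def s_def)
  have nS0: "0 < nS" using nS z by simp
  have len: "l + s \<le> length P" by (simp add: P_def l_def s_def)
  have nthL: "P ! i = (if i < x then p else p - 1)" if "i < l" for i
    using that by (auto simp: P_def l_def nth_append)
  have nthS: "P ! (l + i) = (if i < z then a else a - 1)" if "i < s" for i
    using that by (auto simp: P_def l_def s_def nth_append)
  \<comment> \<open>The edge leaving the lower band goes from the last block of size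
    \<open>a\<close>. From level a - 1 it reaches the first vector of the return: block
    \<open>x\<close> at level p - 2, or block 0 at level p - 1 if there are no parts p - 1.\<close>
  define i0 d0 \<rho> where "i0 = (if y = 0 then 0 else x)" and "d0 = (if y = 0 then p - a else p - 1 - a)"
    and "\<rho> = (if y = 0 then 4 else 1 :: nat)"
  define E where "E i i' d \<longleftrightarrow> (i' = Suc i \<and> d = 0 \<and> i' < l + s) \<or> (i = l + s - 1 \<and> i' = l \<and> d = 1) \<or>
    (i = l - 1 \<and> i' = 0 \<and> d = 1) \<or> (i = l + z - 1 \<and> i' = i0 \<and> d = d0)" for i i' d :: nat
  \<comment> \<open>Leaving the lower band costs \<rho>, and passing from the last upper block to
    block 0 costs 3. The intended path ends with weight 4, as 1 + 3, or at once if
    \<open>y = 0\<close>.\<close>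
  define wt where "wt i i' d = (if i < l then if i' = Suc i then 0 else 3 else if i' < l then \<rho> else 0)" for i i' d :: nat
  \<comment> \<open>States from which weight 4 at level p - 1 of a block of size \<open>p\<close> is
    out of reach. They arise by leaving the lower band too early, by returning to block 0 before the
    lower band was entered, or by entering the lower band again.\<close>
  define junk where "junk i j u \<longleftrightarrow> 5 \<le> u \<or> (u = 4 \<and> \<not> (i < x \<and> j = p - 1)) \<or> u = 3 \<or> (u = 2 \<and> x \<le> i) \<or>
    (u = 1 \<and> (l \<le> i \<or> (x \<le> i \<and> j < p - 2)))" for i j u :: nat
  define path where "path k = (if k < l then (k, 0) else if k < l + nS then (l + (k - l) mod s, (k - l) div s)
    else if k < l + nS + y then (x + (k - l - nS), p - 2) else (k - l - nS - y, p - 1))" for k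
  define v where "v k = (if k < l + nS then 0 else if k < l + nS + y then 1 else 4 :: nat)" for k
  have Nlt: "N < nS + 2 * l" unfolding N_def using nS0 by simp
  have i0l: "i0 < l" using x by (auto simp: i0_def l_def)
  have d0: "0 < d0" using a y by (auto simp: d0_def)
  have S_label: "\<sigma> div s < a - 1 \<or> (\<sigma> div s = a - 1 \<and> \<sigma> mod s < z)" if "\<sigma> < nS" for \<sigma>
    using that unfolding nS less_rows_iff[OF l(3,4)] .
  have ok: "label_ok P (path k)" if k: "k \<le> N" for k
  proof -
    consider "k < l" | \<sigma> where "k = l + \<sigma>" "\<sigma> < nS" | i where "k = l + nS + i" "i < y"
      | i where "k = l + nS + y + i" "i < x"
    proof -
      have "k < l + nS + y + x" using k Nlt l_def by linarith
      thus thesis using that(1) that(2)[of "k - l"] that(3)[of "k - l - nS"] that(4)[of "k - l - nS - y"] by fastforce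
    qed
    thus ?thesis
    proof cases
      case 1
      then show ?thesis using nthL[of k] len a y by (auto simp: path_def label_ok_def l_def)
    next
      case (2 \<sigma>)
      have "\<sigma> mod s < s" using l by simp
      then show ?thesis using 2 nthS[of "\<sigma> mod s"] S_label[OF 2(2)] len a by (auto simp: path_def label_ok_def)
    next
      case (3 i)
      then show ?thesis using nthL[of "x + i"] len a y by (auto simp: path_def label_ok_def l_def)
    next
      case (4 i)
      then show ?thesis using nthL[of i] len a by (auto simp: path_def label_ok_def l_def)
    qed
  qed
  show ?thesis
    unfolding nS_def[symmetric] l_def[symmetric] N_def[symmetric]
  proof (rule toeplitz_path_power[OF inf _ _ ok, where E = E and v = v and wt = wt and junk = junk])
    fix i i' d assume ii: "i < length P" "i' < length P" and e: "E i i' d"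
    have mono: "P ! Suc i \<le> P ! i" if "Suc i < l + s"
    proof (cases "Suc i < l")
      case True
      then show ?thesis using nthL[of i] nthL[of "Suc i"] by auto
    next
      case False
      show ?thesis
      proof (cases "Suc i = l")
        case True
        then show ?thesis using nthL[of i] nthS[of 0] l a y by (auto simp: l_def)
      next
        case neq: False
        then show ?thesis using nthS[of "i - l"] nthS[of "Suc i - l"] that \<open>\<not> Suc i < l\<close> by auto
      qed
    qed
    show "P ! i' \<le> d + P ! i"
      using e unfolding E_def
    proof (elim disjE conjE)
      assume "i' = Suc i" "d = 0" "i' < l + s"
      then show ?thesis using mono by simp
    next
      assume "i = l + s - 1" "i' = l" "d = 1"
      then show ?thesis using nthS[of 0] nthS[of "s - 1"] l z by auto
    next
      assume "i = l - 1" "i' = 0" "d = 1"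
      then show ?thesis using nthL[of 0] nthL[of "l - 1"] l x by auto
    next
      assume "i = l + z - 1" "i' = i0" "d = d0"
      then show ?thesis using nthS[of "z - 1"] nthL[of i0] i0l l z a y x by (auto simp: i0_def d0_def)
    qed
  next
    fix i i' assume "i < length P" "i' < length P" "E i i' 0"
    thus "i < i'" using d0 by (auto simp: E_def)
  next
    show "v 0 = 0" using l by (simp add: v_def)
  next
    fix k assume k: "k < N"
    consider (A) "Suc k < l" | (B) "Suc k = l" | (C) \<sigma> where "k = l + \<sigma>" "Suc \<sigma> < nS" | (D) "Suc k = l + nS"
      | (F) i where "k = l + nS + i" "Suc i < y" | (G) "Suc k = l + nS + y" "0 < y"
      | (H) i where "k = l + nS + y + i" "Suc i < x"
    proof -
      have "Suc k < l + nS + y + x" using k Nlt l_def by linarith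
      then consider "Suc k < l" | "Suc k = l" | "l \<le> k" "Suc k < l + nS" | "Suc k = l + nS"
        | "l + nS \<le> k" "Suc k < l + nS + y" | "Suc k = l + nS + y" "0 < y" | "l + nS + y \<le> k"
        by linarith
      thus thesis
      proof cases
        case 1
        thus ?thesis by (rule that(1))
      next
        case 2
        thus ?thesis by (rule that(2))
      next
        case 3
        thus ?thesis using that(3)[of "k - l"] by simp
      next
        case 4
        thus ?thesis by (rule that(4))
      next
        case 5
        thus ?thesis using that(5)[of "k - l - nS"] by simp
      next
        case 6
        thus ?thesis by (rule that(6))
      next
        case 7
        thus ?thesis using that(7)[of "k - l - nS - y"] \<open>Suc k < l + nS + y + x\<close> by simp
      qed
    qed
    note cs = this
    have lastS: "(nS - 1) div s = a - 1" "(nS - 1) mod s = z - 1"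
    proof -
      have "nS - 1 = (a - 1) * s + (z - 1)" using nS z by simp
      moreover have "z - 1 < s" using l z by linarith
      ultimately show "(nS - 1) div s = a - 1" "(nS - 1) mod s = z - 1"
        using div_mod_sum[OF l(3), of "z - 1" "a - 1"] by simp_all
    qed
    have succ: "Suc \<sigma> mod s = (if \<sigma> mod s = s - 1 then 0 else Suc (\<sigma> mod s))"
      "Suc \<sigma> div s = (if \<sigma> mod s = s - 1 then Suc (\<sigma> div s) else \<sigma> div s)" "\<sigma> mod s < s" for \<sigma>
      using l by (auto simp: mod_Suc div_Suc)
    show "\<exists>d. E (fst (path k)) (fst (path (Suc k))) d \<and>
      snd (path (Suc k)) = snd (path k) + d \<and> v (Suc k) = v k + wt (fst (path k)) (fst (path (Suc k))) d"
      using cs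
    proof cases
      case A
      then show ?thesis using l by (intro exI[of _ 0]) (auto simp: path_def v_def wt_def E_def)
    next
      case B
      then show ?thesis using l nS0 by (intro exI[of _ 0]) (auto simp: path_def v_def wt_def E_def)
    next
      case (C \<sigma>)
      then show ?thesis using l succ[of \<sigma>]
        by (intro exI[of _ "if \<sigma> mod s = s - 1 then 1 else 0"]) (auto simp: path_def v_def wt_def E_def Suc_diff_le)
    next
      case D
      have "k - l = nS - 1" "\<not> k < l" "k < l + nS" using D nS0 by linarith+
      hence pk: "path k = (l + (z - 1), a - 1)" "v k = 0" unfolding path_def v_def using lastS by simp_all
      have "path (Suc k) = (i0, a - 1 + d0)" "v (Suc k) = \<rho>"
        using D a y by (auto simp: path_def v_def i0_def d0_def \<rho>_def)
      then show ?thesis using pk z i0l by (intro exI[of _ d0]) (auto simp: E_def wt_def)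
    next
      case (F i)
      then show ?thesis using l by (intro exI[of _ 0]) (auto simp: path_def v_def wt_def E_def l_def)
    next
      case G
      then show ?thesis using l a y x by (intro exI[of _ 1]) (auto simp: path_def v_def wt_def E_def l_def)
    next
      case (H i)
      then show ?thesis using l by (intro exI[of _ 0]) (auto simp: path_def v_def wt_def E_def l_def)
    qed
    fix i' d assume e: "E (fst (path k)) i' d" and lab: "label_ok P (i', snd (path k) + d)"
    show "((i', snd (path k) + d) = path (Suc k) \<and> v k + wt (fst (path k)) i' d = v (Suc k)) \<or>
      junk i' (snd (path k) + d) (v k + wt (fst (path k)) i' d)"
      using cs
    proof cases
      case A
      then show ?thesis using e l by (auto simp: path_def v_def wt_def E_def)
    next
      case B
      then show ?thesis using e l nS0 z by (auto simp: path_def v_def wt_def E_def junk_def)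
    next
      case (C \<sigma>)
      have pk: "path k = (l + \<sigma> mod s, \<sigma> div s)" "v k = 0" using C by (auto simp: path_def v_def)
      have pk': "path (Suc k) = (l + Suc \<sigma> mod s, Suc \<sigma> div s)" "v (Suc k) = 0"
        using C by (auto simp: path_def v_def Suc_diff_le)
      have nl: "l + \<sigma> mod s \<noteq> l - 1" using l by linarith
      from e[unfolded pk fst_conv E_def] nl
      consider "i' = Suc (l + \<sigma> mod s)" "d = 0" "i' < l + s" | "\<sigma> mod s = s - 1" "i' = l" "d = 1"
        | "\<sigma> mod s = z - 1" "i' = i0" "d = d0" using l z by fastforce
      thus ?thesis
      proof cases
        case 1
        then show ?thesis using pk pk' succ[of \<sigma>] by (auto simp: wt_def)
      next
        case 2
        then show ?thesis using pk pk' succ[of \<sigma>] by (auto simp: wt_def)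
      next
        case 3
        have "\<sigma> div s \<noteq> a - 1"
        proof
          assume "\<sigma> div s = a - 1"
          hence "\<sigma> = nS - 1" using 3(1) lastS by (intro inj_div_mod[of \<sigma> s]) simp_all
          thus False using C by simp
        qed
        hence "\<sigma> div s < a - 1" using S_label[of \<sigma>] C by auto
        then show ?thesis using 3 pk i0l x a y
          by (cases "y = 0") (auto simp: wt_def junk_def i0_def d0_def \<rho>_def l_def)
      qed
    next
      case D
      have "k - l = nS - 1" "\<not> k < l" "k < l + nS" using D nS0 by linarith+
      hence pk: "path k = (l + (z - 1), a - 1)" "v k = 0" unfolding path_def v_def using lastS by simp_all
      have pk': "path (Suc k) = (i0, a - 1 + d0)" "v (Suc k) = \<rho>"
        using D a y by (auto simp: path_def v_def i0_def d0_def \<rho>_def)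
      have nl: "l + (z - 1) \<noteq> l - 1" using l by linarith
      from e[unfolded pk fst_conv E_def] nl
      \<comment> \<open>The first two edges would lead to level a - 1 of a block of size a - 1, or
        to level a of a block of size a; \<open>lab\<close> excludes both.\<close>
      consider "i' = l + z" "d = 0" "i' < l + s" | "z = s" "i' = l" "d = 1" | "i' = i0" "d = d0" using l z by fastforce
      thus ?thesis
      proof cases
        case 1
        then show ?thesis using lab pk nthS[of z] by (auto simp: label_ok_def)
      next
        case 2
        then show ?thesis using lab pk nthS[of 0] z a l by (auto simp: label_ok_def)
      next
        case 3
        then show ?thesis using pk pk' i0l z by (auto simp: wt_def)
      qed
    next
      case (F i)
      have kk: "\<not> k < l" "\<not> k < l + nS" "k < l + nS + y" "k - l - nS = i" "\<not> Suc k < l" "\<not> Suc k < l + nS" "Suc k < l + nS + y" "Suc k - l - nS = Suc i"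
        using F l_def nS0 by linarith+
      have pk: "path k = (x + i, p - 2)" "v k = 1" unfolding path_def v_def using kk by simp_all
      have pk': "path (Suc k) = (Suc (x + i), p - 2)" "v (Suc k) = 1" unfolding path_def v_def using kk by simp_all
      have ne: "x + i < l" "x + i \<noteq> l + s - 1" "x + i \<noteq> l - 1" "x + i \<noteq> l + z - 1" using F l z l_def by linarith+
      have "i' = Suc (x + i)" "d = 0" using e[unfolded pk fst_conv E_def] ne by blast+
      then show ?thesis using pk pk' ne(1) by (simp add: wt_def)
    next
      case G
      have kk: "\<not> k < l" "\<not> k < l + nS" "k < l + nS + y" "x + (k - l - nS) = l - 1" "\<not> Suc k < l"
        "\<not> Suc k < l + nS" "\<not> Suc k < l + nS + y" "Suc k - l - nS - y = 0"
        using G l_def by linarith+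
      have pk: "path k = (l - 1, p - 2)" "v k = 1" unfolding path_def v_def using kk(1-4) by simp_all
      have pk': "path (Suc k) = (0, p - 1)" "v (Suc k) = 4" unfolding path_def v_def using kk(5-8) by simp_all
      have ne: "Suc (l - 1) = l" "l - 1 \<noteq> l + s - 1" "l - 1 \<noteq> l + z - 1" using l z by linarith+
      from e[unfolded pk fst_conv E_def] consider "i' = l" "d = 0" | "i' = 0" "d = 1" using ne by metis
      thus ?thesis
        using pk pk' l a y G by cases (auto simp: wt_def junk_def)
    next
      case (H i)
      have kk: "\<not> k < l" "\<not> k < l + nS" "\<not> k < l + nS + y" "k - l - nS - y = i" "\<not> Suc k < l" "\<not> Suc k < l + nS" "\<not> Suc k < l + nS + y" "Suc k - l - nS - y = Suc i"
        using H l_def nS0 by linarith+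
      have pk: "path k = (i, p - 1)" "v k = 4" unfolding path_def v_def using kk by simp_all
      have pk': "path (Suc k) = (Suc i, p - 1)" "v (Suc k) = 4" unfolding path_def v_def using kk by simp_all
      have ne: "i < l" "i \<noteq> l + s - 1" "i \<noteq> l - 1" "i \<noteq> l + z - 1" using H l z l_def by linarith+
      have "i' = Suc (i)" "d = 0" using e[unfolded pk fst_conv E_def] ne by blast+
      then show ?thesis using pk pk' ne(1) by (simp add: wt_def)
    qed
  next
    fix i j u i' d assume jk: "junk i j u" and e: "E i i' d" and lab: "label_ok P (i, j)"
    from e[unfolded E_def] consider (1) "i' = Suc i" "d = 0" "i' < l + s" | (2) "i = l + s - 1" "i' = l" "d = 1"
      | (3) "i = l - 1" "i' = 0" "d = 1" | (4) "i = l + z - 1" "i' = i0" "d = d0" by blast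
    thus "junk i' (j + d) (u + wt i i' d)"
    proof cases
      case 1
      then show ?thesis using jk l unfolding junk_def wt_def by auto
    next
      case 2
      then show ?thesis using jk l unfolding junk_def wt_def by auto
    next
      case 3
      then show ?thesis using jk l x unfolding junk_def wt_def by auto
    next
      case 4
      then show ?thesis using jk l z i0l unfolding junk_def wt_def i0_def \<rho>_def by auto
    qed
  next
    show "\<not> junk (fst (path N)) (snd (path N)) (v N)"
    proof -
      have "N = l + nS + y + (x - 1)" using x by (simp add: N_def l_def)
      hence "path N = (x - 1, p - 1)" "v N = 4" using x by (auto simp: path_def v_def)
      thus ?thesis using x by (simp add: junk_def)
    qed
  qed
qed

subsection \<open>Partitions with a two-part generic type\<close>

lemma sorted_wrt_replicate [simp]: "sorted_wrt (\<lambda>a b. b \<le> a) (replicate n (c :: nat))"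
  by (induction n) auto

lemma two_band_is_partition:
  "two_band_ok p x y q z w \<Longrightarrow> is_partition (two_band p x y q z w)"
  by (auto simp: is_partition_def two_band_def two_band_ok_def sorted_wrt_append)

text \<open>Each band is traversed by its own path, so \<open>X\<close> acts as two Jordan blocks;
  only the last vectors \<open>c1\<close> and \<open>c2\<close> have no successor.\<close>

lemma two_band_rank_exists:
  assumes ok: "two_band_ok p x y q z w"
  defines "P \<equiv> two_band p x y q z w"
  shows "\<exists>X\<in>strict_part P (\<lambda>i. i). rank_ge (sum_list P) (sum_list P - 2) (X :: 'a::field mat)"
proof -
  define l s where "l = x + y" and "s = z + w"
  have b: "0 < x" "0 < z" "0 < q" "q + 2 \<le> p" "q = 1 \<longrightarrow> w = 0" using ok by (auto simp: two_band_ok_def)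
  have len: "length P = l + s" by (simp add: P_def two_band_length l_def s_def)
  have nth: "P ! i = (if i < x then p else if i < l then p - 1 else if i < l + z then q else q - 1)" if "i < l + s" for i
    using that by (simp add: P_def two_band_nth l_def s_def add.assoc)
  have l: "0 < l" "x \<le> l" "0 < s" "z \<le> s" using b by (auto simp: l_def s_def)
  define succ where "succ = (\<lambda>(i,j). if i = l - 1 then (0, Suc j) else if i = l + s - 1 then (l, Suc j) else (Suc i, j))"
  define E where "E i i' d \<longleftrightarrow> i < l + s \<and> succ (i, 0) = (i', d)" for i i' d
  define a where "a i i' d = (if E i i' d then 1 else 0 :: 'a)" for i i' d
  define X where "X = toeplitz P a"
  have valid: "P ! i' \<le> d + P ! i" if "E i i' d" for i i' d
    using that l b nth[of i] nth[of i'] by (auto simp: E_def succ_def split: if_splits)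
  have "X \<in> strict_part P (\<lambda>i. i)"
    unfolding X_def
    by (rule toeplitz_strict_part) (use valid in \<open>auto simp: a_def E_def succ_def split: if_splits\<close>)
  moreover have "rank_ge (sum_list P) (sum_list P - 2) X"
  proof -
    define I where "I = (\<lambda>(i,j). index_of P i j)"
    define lab where "lab c = (block_of P c, level_of P c)" for c
    have I: "I u < sum_list P" "lab (I u) = u" if "label_ok P u" for u
      using that index_of_props[of "fst u" P "snd u"] by (auto simp: I_def lab_def label_ok_def split: prod.splits)
    have lab: "label_ok P (lab c)" "I (lab c) = c" if "c < sum_list P" for c
      using index_props[OF that] by (auto simp: I_def lab_def label_ok_def)
    define c1 c2 where "c1 = I (x - 1, p - 1)" and "c2 = I (l + z - 1, q - 1)"
    have ok1: "label_ok P (x - 1, p - 1)" using b nth[of "x - 1"] l by (auto simp: label_ok_def len)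
    have ok2: "label_ok P (l + z - 1, q - 1)" using b nth[of "l + z - 1"] l by (auto simp: label_ok_def len)
    have c12: "c1 < sum_list P" "c2 < sum_list P"
      unfolding c1_def c2_def using I(1)[OF ok1] I(1)[OF ok2] by blast+
    have c12': "c1 \<noteq> c2"
    proof
      assume "c1 = c2"
      hence "lab c1 = lab c2" by simp
      hence "(x - 1, p - 1) = (l + z - 1, q - 1)" unfolding c1_def c2_def I(2)[OF ok1] I(2)[OF ok2] .
      hence "p - 1 = q - 1" by blast
      thus False using b(3,4) by linarith
    qed
    define f where "f c = I (succ (lab c))" for c
    have okS: "label_ok P (succ (lab c))" if c: "c < sum_list P" "c \<noteq> c1" "c \<noteq> c2" for c
    proof -
      obtain i j where ij: "lab c = (i,j)" by (cases "lab c")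
      have o: "i < l + s" "j < P ! i" using lab(1)[OF c(1)] by (auto simp: ij label_ok_def len)
      have n1: "(i,j) \<noteq> (x - 1, p - 1)" using lab(2)[OF c(1)] c(2) ij c1_def by metis
      have n2: "(i,j) \<noteq> (l + z - 1, q - 1)" using lab(2)[OF c(1)] c(3) ij c2_def by metis
      note Pi = nth[OF o(1)]
      have P0: "P ! 0 = p" and Pl: "P ! l = q" using nth[of 0] nth[of l] l b by simp_all
      consider "i = l - 1" | "i \<noteq> l - 1" "i = l + s - 1" | "Suc i < l" | "l \<le> i" "Suc i < l + s" using o(1) by linarith
      thus ?thesis
      proof cases
        case 1
        have "Suc j < p"
        proof (cases "i < x")
          case True
          hence "i = x - 1" using 1 l by linarith
          thus ?thesis using n1 o(2) Pi True by simp
        next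
          case False
          thus ?thesis using o(2) Pi 1 l by simp
        qed
        thus ?thesis using 1 P0 l unfolding ij by (simp add: succ_def label_ok_def len)
      next
        case 2
        have il: "\<not> i < l" "\<not> i < x" using 2 l by linarith+
        have "Suc j < q"
        proof (cases "i < l + z")
          case True
          hence "i = l + z - 1" using 2 l by linarith
          thus ?thesis using n2 o(2) Pi True il by simp
        next
          case False
          thus ?thesis using o(2) Pi il by simp
        qed
        thus ?thesis using 2 Pl l unfolding ij by (simp add: succ_def label_ok_def len)
      next
        case 3
        have PS: "P ! Suc i = (if Suc i < x then p else p - 1)" using nth[of "Suc i"] 3 by simp
        have "j < P ! Suc i"
        proof (cases "Suc i = x")
          case True
          hence "P ! i = p" "i = x - 1" using Pi by simp_all
          thus ?thesis using PS True n1 o(2) by simp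
        next
          case False
          thus ?thesis using PS Pi o(2) 3 by (cases "i < x") simp_all
        qed
        thus ?thesis using 3 unfolding ij by (simp add: succ_def label_ok_def len)
      next
        case 4
        have il: "\<not> i < l" "\<not> i < x" "\<not> Suc i < l" "\<not> Suc i < x" using 4 l by linarith+
        have PS: "P ! Suc i = (if Suc i < l + z then q else q - 1)" using nth[of "Suc i"] 4 il by simp
        have Pi': "P ! i = (if i < l + z then q else q - 1)" using Pi il by simp
        have "j < P ! Suc i"
        proof (cases "Suc i = l + z")
          case True
          hence "P ! i = q" "i = l + z - 1" using Pi' by simp_all
          thus ?thesis using PS True n2 o(2) by simp
        next
          case False
          thus ?thesis using PS Pi' o(2) by (cases "i < l + z") simp_all
        qed
        moreover have "i \<noteq> l - 1" "i \<noteq> l + s - 1" using 4 l by linarith+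
        ultimately show ?thesis using 4 unfolding ij by (simp add: succ_def label_ok_def len)
      qed
    qed
    have succ_inj: "u = u'" if "succ u = succ u'" "label_ok P u" "label_ok P u'" for u u'
      using that l by (auto simp: succ_def label_ok_def len split: if_splits prod.splits)
    show ?thesis
    proof (rule rank_ge_select[where D = "{..<sum_list P} - {c1, c2}" and f = f])
      show "X \<in> carrier_mat (sum_list P) (sum_list P)" by (simp add: X_def)
      show "card ({..<sum_list P} - {c1, c2}) = sum_list P - 2"
        using c12 c12' by (subst card_Diff_subset) auto
      fix c assume "c \<in> {..<sum_list P} - {c1, c2}"
      hence c: "c < sum_list P" "c \<noteq> c1" "c \<noteq> c2" by auto
      show "c < sum_list P" by (rule c(1))
      show "f c < sum_list P" unfolding f_def by (rule I(1)[OF okS[OF c]])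
      fix c' assume "c' \<in> {..<sum_list P} - {c1, c2}"
      hence c': "c' < sum_list P" "c' \<noteq> c1" "c' \<noteq> c2" by auto
      have fc': "f c' < sum_list P" "lab (f c') = succ (lab c')"
        unfolding f_def using I[OF okS[OF c']] by auto
      have blk: "block_of P c < l + s" using index_props(1)[OF c(1)] len by simp
      have "X $$ (f c', c) = (if succ (lab c) = lab (f c') then 1 else 0)"
      proof -
        have "X $$ (f c', c) = (if level_of P c \<le> level_of P (f c') \<and>
          succ (block_of P c, 0) = (block_of P (f c'), level_of P (f c') - level_of P c) then 1 else 0)"
          unfolding X_def toeplitz_entry[OF fc'(1) c(1)] a_def E_def using blk by simp
        also have "level_of P c \<le> level_of P (f c') \<and>
          succ (block_of P c, 0) = (block_of P (f c'), level_of P (f c') - level_of P c) \<longleftrightarrow> succ (lab c) = lab (f c')"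
          by (auto simp: succ_def lab_def)
        finally show ?thesis .
      qed
      also have "succ (lab c) = lab (f c') \<longleftrightarrow> c = c'"
        unfolding fc'(2) using succ_inj[OF _ lab(1)[OF c(1)] lab(1)[OF c'(1)]] lab(2)[OF c(1)] lab(2)[OF c'(1)] by metis
      finally show "X $$ (f c', c) = (if c = c' then 1 else 0)" .
    qed simp
  qed
  ultimately show ?thesis by blast
qed

lemma sum_min_less_imp:
  assumes "Suc (sum_list (map (min k) Q)) \<le> sum_list Q"
  shows "\<exists>q\<in>set Q. k < (q :: nat)"
proof (rule ccontr)
  assume "\<not> ?thesis"
  hence "map (min k) Q = Q" by (intro map_idI) (meson min_absorb2 not_less)
  thus False using assms by simp
qed

lemma sum_min_eq_imp:
  assumes "sum_list Q \<le> sum_list (map (min k) Q)" "q \<in> set Q"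
  shows "q \<le> (k :: nat)"
proof -
  have "sum_list (map (\<lambda>q. q - k) Q) = 0" using sum_list_diff_min[of k Q] assms(1) by linarith
  thus ?thesis using assms(2) by (simp add: sum_list_eq_0_iff)
qed

lemma sum_min_1: "is_partition Q \<Longrightarrow> sum_list (map (min 1) Q) = length Q"
  unfolding is_partition_def by (induction Q) auto

text \<open>The sum of min(k, q) over the parts is the nullity of the k-th power of a generic
  matrix. A rank that occurs for some strict matrix bounds it from above, and a rank that occurs for
  none bounds it from below.\<close>

lemma frakQ_properties:
  assumes inf: "infinite (UNIV :: 'a::field set)" and P: "is_partition P"
  shows "is_partition (frakQ TYPE('a) P)" "sum_list (frakQ TYPE('a) P) = sum_list P"
    and "X \<in> strict_part P ord \<Longrightarrow> rank_ge (sum_list P) \<rho> (X ^\<^sub>m k :: 'a mat) \<Longrightarrow>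
      \<rho> + sum_list (map (min k) (frakQ TYPE('a) P)) \<le> sum_list P"
    and "(\<And>X ord. X \<in> strict_part P ord \<Longrightarrow> \<not> rank_ge (sum_list P) \<rho> (X ^\<^sub>m k :: 'a mat)) \<Longrightarrow>
      sum_list P < \<rho> + sum_list (map (min k) (frakQ TYPE('a) P))"
proof -
  let ?n = "sum_list P" and ?Q = "frakQ TYPE('a) P"
  obtain A :: "'a mat" where A: "A \<in> nilpotent_commutant (J P)" "has_jordan_type A ?Q"
    using frakQ_characterization(1)[OF inf P] by blast
  note Ac = nilpotent_commutant_type(1)[OF J_carrier A(1)]
  show "is_partition ?Q" "sum_list ?Q = ?n" using has_jordan_typeD[OF A(2) Ac] by auto
  show "\<rho> + sum_list (map (min k) ?Q) \<le> ?n" if "X \<in> strict_part P ord" "rank_ge ?n \<rho> (X ^\<^sub>m k :: 'a mat)"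
    using frakQ_characterization(2)[OF inf P _ that(2)] strict_part_subset that(1) by blast
  show "?n < \<rho> + sum_list (map (min k) ?Q)"
    if "\<And>X ord. X \<in> strict_part P ord \<Longrightarrow> \<not> rank_ge ?n \<rho> (X ^\<^sub>m k :: 'a mat)"
  proof -
    have "\<forall>p\<in>set P. 0 < p" using P by (simp add: is_partition_def)
    from nilpotent_commutant_rank_bound[OF A(1) this that]
    show ?thesis using rank_ge_jordan_type[OF A(2) Ac] by (simp add: not_le)
  qed
qed

lemma max_chain_less:
  assumes "two_band_ok p x y q z w"
  shows "max_chain p x y q z w < sum_list (two_band p x y q z w)" "0 < max_chain p x y q z w"
proof -
  have b: "0 < x" "0 < z" "0 < q" "q + 2 \<le> p" using assms by (auto simp: two_band_ok_def)
  have 1: "0 < q * z" "3 * x \<le> p * x" "2 * y \<le> (p - 1) * y" using b by (auto intro: mult_le_mono1)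
  have 2: "p = q + 2 \<Longrightarrow> p * x = q * x + 2 * x" "0 < q * x" using b by (auto simp: algebra_simps)
  show "max_chain p x y q z w < sum_list (two_band p x y q z w)"
    unfolding max_chain_def two_band_sum max_less_iff_conj
  proof (intro conjI)
    show "(if p = q + 2 then q * z + (p - 1) * y + 2 * x else 0) < p * x + (p - 1) * y + q * z + (q - 1) * w"
    proof (cases "p = q + 2")
      case True
      show ?thesis unfolding if_P[OF True] using 1(1) 2(1)[OF True] 2(2) by linarith
    next
      case False
      show ?thesis unfolding if_not_P[OF False] using 1(1) by linarith
    qed
    have "2 * (x + y) < A + B" if "3 * x \<le> A" "2 * y \<le> B" for A B using that b(1) by simp
    from this[OF 1(2,3)] show "q * z + (q - 1) * w + 2 * (x + y) < p * x + (p - 1) * y + q * z + (q - 1) * w" by simp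
    show "p * x + (p - 1) * y < p * x + (p - 1) * y + q * z + (q - 1) * w" using 1(1) by simp
  qed
  show "0 < max_chain p x y q z w" unfolding max_chain_def using 1 b by auto
qed

text \<open>Rank n - 2 occurs, so there are at most two parts; the power \<open>U - 1\<close> can be
  nonzero, so some part is at least \<open>U\<close>; all powers \<open>U\<close> vanish, so no part
  exceeds \<open>U\<close>. As \<open>U\<close> < n, there is a second part.\<close>

lemma frakQ_two_band:
  assumes inf: "infinite (UNIV :: 'a::field set)" and ok: "two_band_ok p x y q z w"
  defines "P \<equiv> two_band p x y q z w" and "U \<equiv> max_chain p x y q z w"
  shows "frakQ TYPE('a) P = [U, sum_list P - U]"
proof -
  let ?n = "sum_list P" and ?Q = "frakQ TYPE('a) P"
  have b: "0 < x" "0 < z" "0 < q" "q + 2 \<le> p" "q = 1 \<longrightarrow> w = 0" using ok by (auto simp: two_band_ok_def)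
  note Q = frakQ_properties[OF inf two_band_is_partition[OF ok], folded P_def]
  have Un: "U < ?n" "0 < U" using max_chain_less[OF ok] by (auto simp: U_def P_def)
  obtain X0 :: "'a mat" where X0: "X0 \<in> strict_part P (\<lambda>i. i)" "rank_ge ?n (?n - 2) X0"
    using two_band_rank_exists[OF ok] unfolding P_def by blast
  have "X0 ^\<^sub>m 1 = X0" using strict_partD(2)[OF X0(1)] by simp
  hence "?n - 2 + sum_list (map (min 1) ?Q) \<le> ?n" using Q(3)[OF X0(1), of "?n - 2" 1] X0(2) by simp
  hence len: "length ?Q \<le> 2" using sum_min_1[OF Q(1)] Un by simp
  have lower: "\<exists>t\<in>set ?Q. k - 1 < t" if "\<exists>X\<in>strict_part P (\<lambda>i. i). rank_ge ?n 1 (X ^\<^sub>m (k - 1) :: 'a mat)" for k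
  proof -
    from that obtain X :: "'a mat" where X: "X \<in> strict_part P (\<lambda>i. i)" "rank_ge ?n 1 (X ^\<^sub>m (k - 1))" by blast
    from Q(3)[OF X] Q(2) show ?thesis by (intro sum_min_less_imp) simp
  qed
  have py: "0 < p" "0 < y \<longrightarrow> 2 \<le> p" "q < p" "0 < y \<longrightarrow> q + 2 \<le> p" "0 < w \<longrightarrow> 2 \<le> q" using b by auto
  have l1: "\<exists>t\<in>set ?Q. p * x + (p - 1) * y - 1 < t"
    by (rule lower)
       (use band_chain_exists[OF inf b(1) py(1,2), of "replicate z q @ replicate w (q - 1)"] in
         \<open>unfold P_def two_band_def\<close>)
  have l2: "\<exists>t\<in>set ?Q. q * z + (q - 1) * w + 2 * (x + y) - 1 < t"
    by (rule lower)
       (use large_blocks_chain_exists[OF inf b(1,2,3) py(3-5), of "[]"] in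
         \<open>unfold P_def two_band_def append_Nil2\<close>)
  \<comment> \<open>For y > 0 this is the chain through {p - 1, q} with only the parts
    \<open>p\<close> above it; for y = 0 the length does not exceed the one in
    \<open>l2\<close>.\<close>
  have l3: "\<exists>t\<in>set ?Q. q * z + (p - 1) * y + 2 * x - 1 < t" if pq: "p = q + 2"
  proof (cases "y = 0")
    case True
    obtain t where t: "t \<in> set ?Q" "q * z + (q - 1) * w + 2 * (x + y) - 1 < t" using l2 by blast
    have "q * z + (p - 1) * y + 2 * x - 1 \<le> q * z + (q - 1) * w + 2 * (x + y) - 1"
      unfolding True by (intro diff_le_mono) simp
    thus ?thesis using t by (intro bexI[of _ t]) linarith+
  next
    case False
    have pq1: "p - 1 - 1 = q" "0 < y" "0 < p - 1" "p - 1 < p" "0 < (0::nat) \<longrightarrow> p - 1 + 2 \<le> p" "0 < z \<longrightarrow> 2 \<le> p - 1"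
      using pq b False by auto
    have "\<exists>X\<in>strict_part P (\<lambda>i. i). rank_ge ?n 1 (X ^\<^sub>m ((p - 1) * y + q * z + 2 * (x + 0) - 1) :: 'a mat)"
      using large_blocks_chain_exists[OF inf b(1) pq1(2-6), of "replicate w (q - 1)"]
      unfolding P_def two_band_def replicate_0 append_Nil pq1(1) .
    hence "\<exists>t\<in>set ?Q. (p - 1) * y + q * z + 2 * (x + 0) - 1 < t" by (rule lower)
    thus ?thesis by (simp add: add.commute)
  qed
  have "\<exists>t\<in>set ?Q. U \<le> t"
  proof -
    have "U = p * x + (p - 1) * y \<or> U = q * z + (q - 1) * w + 2 * (x + y) \<or> (p = q + 2 \<and> U = q * z + (p - 1) * y + 2 * x)"
      unfolding U_def max_chain_def by (auto simp: max_def split: if_splits)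
    thus ?thesis
    proof (elim disjE conjE)
      assume "U = p * x + (p - 1) * y"
      with l1 show ?thesis by (metis Suc_pred' Suc_leI Un(2))
    next
      assume "U = q * z + (q - 1) * w + 2 * (x + y)"
      with l2 show ?thesis by (metis Suc_pred' Suc_leI Un(2))
    next
      assume "p = q + 2" "U = q * z + (p - 1) * y + 2 * x"
      with l3 show ?thesis by (metis Suc_pred' Suc_leI Un(2))
    qed
  qed
  then obtain t where t: "t \<in> set ?Q" "U \<le> t" by blast
  have upper: "t' \<le> U" if "t' \<in> set ?Q" for t'
  proof -
    have "?n < 1 + sum_list (map (min U) ?Q)"
    proof (rule Q(4))
      fix X :: "'a mat" and ord assume "X \<in> strict_part P ord"
      thus "\<not> rank_ge ?n 1 (X ^\<^sub>m U)"
        using two_band_power_bound[OF ok, of X ord U] unfolding P_def U_def by blast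
    qed
    thus ?thesis using sum_min_eq_imp[OF _ that] Q(2) by simp
  qed
  have tU: "t = U" using t upper by force
  consider "?Q = []" | a where "?Q = [a]" | a a' where "?Q = [a, a']"
    using len by (metis One_nat_def Suc_1 Suc_le_length_iff le_SucE length_0_conv length_Suc_conv le_zero_eq)
  thus ?thesis
  proof cases
    case 1
    then show ?thesis using t by simp
  next
    case (2 a)
    then show ?thesis using t tU Q(2) Un by simp
  next
    case (3 a a')
    have "a' \<le> a" using Q(1) 3 by (simp add: is_partition_def)
    moreover have "a \<le> U" using upper 3 by simp
    ultimately have "a = U" using t tU 3 by auto
    then show ?thesis using 3 Q(2) by simp
  qed
qed

text \<open>One path through the whole basis makes the power n - 1 nonzero, hence the generic type
  has a single part.\<close>

lemma frakQ_band:
  assumes inf: "infinite (UNIV :: 'a::field set)" and x: "0 < x" and p: "0 < p" and y: "0 < y \<longrightarrow> 2 \<le> p"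
    and uv: "0 < u" "0 < v"
  shows "frakQ TYPE('a) (replicate x p @ replicate y (p - 1)) \<noteq> [u, v]"
proof
  let ?P = "replicate x p @ replicate y (p - 1)"
  assume eq: "frakQ TYPE('a) ?P = [u, v]"
  have P: "is_partition ?P" using p y by (auto simp: is_partition_def sorted_wrt_append)
  note Q = frakQ_properties[OF inf P]
  have n: "sum_list ?P = p * x + (p - 1) * y" by (simp add: sum_list_replicate algebra_simps)
  obtain X :: "'a mat" where X: "X \<in> strict_part ?P (\<lambda>i. i)" "rank_ge (sum_list ?P) 1 (X ^\<^sub>m (sum_list ?P - 1))"
    using band_chain_exists[OF inf x p y, of "[]"] unfolding n append_Nil2 by blast
  from Q(3)[OF X] Q(2) have "\<exists>q\<in>set [u,v]. sum_list ?P - 1 < q" unfolding eq by (intro sum_min_less_imp) simp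
  thus False using Q(2) uv unfolding eq by auto
qed

lemma frakQ_three_separated:
  assumes inf: "infinite (UNIV :: 'a::field set)" and P: "is_partition P"
    and mem: "a \<in> set P" "b \<in> set P" "c \<in> set P" and gap: "b + 2 \<le> a" "c + 2 \<le> b"
  shows "frakQ TYPE('a) P \<noteq> [u, v]"
proof
  assume eq: "frakQ TYPE('a) P = [u, v]"
  note Q = frakQ_properties[OF inf P]
  from mem obtain i1 i2 i3 where i: "i1 < length P" "i2 < length P" "i3 < length P" "P ! i1 = a" "P ! i2 = b" "P ! i3 = c"
    by (metis in_set_conv_nth)
  have c0: "0 < c" using P mem(3) by (simp add: is_partition_def)
  have "sum_list P < (sum_list P - 2) + sum_list (map (min 1) (frakQ TYPE('a) P))"
  proof (rule Q(4))
    fix X :: "'a mat" and ord assume X: "X \<in> strict_part P ord"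
    have "X ^\<^sub>m 1 = X" using strict_partD(2)[OF X] by simp
    thus "\<not> rank_ge (sum_list P) (sum_list P - 2) (X ^\<^sub>m 1)"
      using three_separated_rank_bound[OF X i(1-3)] i(4-6) gap c0 by simp
  qed
  hence "sum_list P < sum_list P - 2 + 2" using sum_min_1[OF Q(1)] eq by simp
  moreover have "2 \<le> sum_list P" using member_le_sum_list[OF mem(1)] gap by linarith
  ultimately show False by simp
qed

section \<open>Which partitions have a generic type with two parts\<close>

lemma top_band_decomposition:
  assumes "sorted_wrt (\<ge>) P" "\<forall>r\<in>set P. r \<le> p" "0 < (p :: nat)"
  shows "P = replicate (length (filter (\<lambda>r. r = p) P)) p @
    replicate (length (filter (\<lambda>r. r = p - 1) P)) (p - 1) @ filter (\<lambda>r. r + 2 \<le> p) P"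
  using assms
proof (induction P)
  case Nil
  then show ?case by simp
next
  case (Cons r P)
  have IH: "P = replicate (length (filter (\<lambda>r. r = p) P)) p @
    replicate (length (filter (\<lambda>r. r = p - 1) P)) (p - 1) @ filter (\<lambda>r. r + 2 \<le> p) P"
    using Cons by simp
  define n1 n2 R where "n1 = length (filter (\<lambda>r. r = p) P)" and "n2 = length (filter (\<lambda>r. r = p - 1) P)"
    and "R = filter (\<lambda>r. r + 2 \<le> p) P"
  note defs = n1_def n2_def R_def
  have P: "replicate n1 p @ replicate n2 (p - 1) @ R = P" unfolding defs by (rule IH[symmetric])
  have le: "\<forall>t\<in>set P. t \<le> r" using Cons.prems(1) by simp
  consider "r = p" | "r = p - 1" "r < p" | "r + 2 \<le> p" using Cons.prems(2,3) by fastforce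
  thus ?case
  proof cases
    case 1
    have "length (filter (\<lambda>t. t = p) (r # P)) = Suc n1" "length (filter (\<lambda>t. t = p - 1) (r # P)) = n2"
      "filter (\<lambda>t. t + 2 \<le> p) (r # P) = R" using 1 Cons.prems(3) by (simp_all add: defs)
    then show ?thesis using 1 P by simp
  next
    case 2
    have n1: "n1 = 0" using le 2 by (auto simp: n1_def filter_empty_conv)
    have "length (filter (\<lambda>t. t = p) (r # P)) = 0" "length (filter (\<lambda>t. t = p - 1) (r # P)) = Suc n2"
      "filter (\<lambda>t. t + 2 \<le> p) (r # P) = R" using 2 n1 by (simp_all add: defs)
    then show ?thesis using 2 P n1 by simp
  next
    case 3
    have n: "n1 = 0" "n2 = 0" using le 3 by (auto simp: n1_def n2_def filter_empty_conv)
    have "length (filter (\<lambda>t. t = p) (r # P)) = 0" "length (filter (\<lambda>t. t = p - 1) (r # P)) = 0"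
      "filter (\<lambda>t. t + 2 \<le> p) (r # P) = r # R" using 3 n by (simp_all add: defs)
    then show ?thesis using P n by simp
  qed
qed

lemma partition_top_band:
  assumes "is_partition P" "P \<noteq> []"
  shows "\<exists>p x y R. P = replicate x p @ replicate y (p - 1) @ R \<and> 0 < x \<and> 0 < p \<and> (0 < y \<longrightarrow> 2 \<le> p) \<and>
    is_partition R \<and> (\<forall>r\<in>set R. r + 2 \<le> p)"
proof -
  obtain p P' where P: "P = p # P'" using assms(2) by (cases P) auto
  have s: "sorted_wrt (\<ge>) P" "\<forall>r\<in>set P. 0 < r" using assms(1) by (auto simp: is_partition_def)
  have p: "0 < p" "\<forall>r\<in>set P. r \<le> p" using s P by auto
  define y where "y = length (filter (\<lambda>r. r = p - 1) P)"
  have "2 \<le> p" if "0 < y"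
  proof -
    from that obtain r where "r \<in> set P" "r = p - 1" unfolding y_def by (auto simp: filter_empty_conv)
    thus ?thesis using s(2) by fastforce
  qed
  moreover have "is_partition (filter (\<lambda>r. r + 2 \<le> p) P)"
    using s by (auto simp: is_partition_def sorted_wrt_filter)
  moreover have "0 < length (filter (\<lambda>r. r = p) P)" using P by simp
  ultimately show ?thesis
    using top_band_decomposition[OF s(1) p(2,1)] p(1) unfolding y_def
    by (intro exI[of _ p] exI[of _ "length (filter (\<lambda>r. r = p) P)"] exI[of _ "length (filter (\<lambda>r. r = p - 1) P)"]
        exI[of _ "filter (\<lambda>r. r + 2 \<le> p) P"]) auto
qed

text \<open>Bands are peeled off from the top. A single band gives one generic part, and anything
  left after two bands gives three separated parts, hence at least three generic parts. Exactly two
  bands remain.\<close>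

lemma frakQ_inv_eq:
  assumes inf: "infinite (UNIV :: 'k::field set)" and uv: "0 < u" "0 < v"
  shows "frakQ_inv TYPE('k) [u, v] = (\<lambda>(p,x,y,q,z,w). two_band p x y q z w) `
    {(p,x,y,q,z,w). two_band_ok p x y q z w \<and> max_chain p x y q z w = u \<and>
      sum_list (two_band p x y q z w) = u + v}" (is "_ = ?f ` ?T")
proof (intro equalityI subsetI)
  fix P assume "P \<in> frakQ_inv TYPE('k) [u, v]"
  hence P: "is_partition P" and eq: "frakQ TYPE('k) P = [u, v]" by (auto simp: frakQ_inv_def)
  have n: "sum_list P = u + v" using frakQ_properties(2)[OF inf P] eq by simp
  hence "P \<noteq> []" using uv by auto
  from partition_top_band[OF P this] obtain p x y R where 1: "P = replicate x p @ replicate y (p - 1) @ R"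
    "0 < x" "0 < p" "0 < y \<longrightarrow> 2 \<le> p" "is_partition R" "\<forall>r\<in>set R. r + 2 \<le> p" by blast
  have "R \<noteq> []" using frakQ_band[OF inf 1(2,3,4) uv] eq 1(1) by auto
  from partition_top_band[OF 1(5) this] obtain q z w R' where 2: "R = replicate z q @ replicate w (q - 1) @ R'"
    "0 < z" "0 < q" "0 < w \<longrightarrow> 2 \<le> q" "is_partition R'" "\<forall>r\<in>set R'. r + 2 \<le> q" by blast
  have pq: "q + 2 \<le> p" using 1(6) 2(1,2) by simp
  have "R' = []"
  proof (rule ccontr)
    assume "R' \<noteq> []"
    then obtain r where "r \<in> set R'" by (cases R') auto
    thus False using frakQ_three_separated[OF inf P, of p q r u v] eq 1 2 pq by auto
  qed
  hence Pt: "P = two_band p x y q z w" using 1(1) 2(1) by (simp add: two_band_def)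
  have ok: "two_band_ok p x y q z w" using 1 2 pq by (auto simp: two_band_ok_def)
  have "max_chain p x y q z w = u" using frakQ_two_band[OF inf ok] eq Pt by simp
  thus "P \<in> ?f ` ?T" using ok n Pt by (intro image_eqI[of _ _ "(p,x,y,q,z,w)"]) auto
next
  fix P assume "P \<in> ?f ` ?T"
  then obtain p x y q z w where P: "P = two_band p x y q z w" "two_band_ok p x y q z w"
    "max_chain p x y q z w = u" "sum_list P = u + v" by auto
  show "P \<in> frakQ_inv TYPE('k) [u, v]"
    using frakQ_two_band[OF inf P(2)] two_band_is_partition[OF P(2)] P by (simp add: frakQ_inv_def)
qed

subsection \<open>Counting\<close>

type_synonym band_data = "nat \<times> nat \<times> nat \<times> nat \<times> nat \<times> nat"

definition fibre :: "nat \<Rightarrow> nat \<Rightarrow> band_data set" where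
  "fibre u v = {(p,x,y,q,z,w). two_band_ok p x y q z w \<and> max_chain p x y q z w = u \<and>
    sum_list (two_band p x y q z w) = u + v}"

fun parts :: "band_data \<Rightarrow> nat" where
  "parts (p,x,y,q,z,w) = x + y + z + w"

text \<open>\<open>descend\<close> replaces one part \<open>p\<close> by \<open>p - 1\<close> and one part \<open>q\<close> by \<open>q - 1\<close>; the
  resulting partition is then regrouped into bands from the top, while \<open>ascend\<close> groups
  it from the bottom. This is one step of the Burge correspondence.\<close>

fun descend :: "band_data \<Rightarrow> band_data" where
  "descend (p,x,y,q,z,w) =
    (if 2 \<le> x then if 2 \<le> z then (p, x - 1, y + 1, q, z - 1, w + 1) else (p, x - 1, y + 1, q - 1, w + 1, 0)
     else if 2 \<le> z then if p = q + 2 then (p - 1, y + 1, z - 1, q - 1, w + 1, 0)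
       else (p - 1, y + 1, 0, q, z - 1, w + 1)
     else (p - 1, y + 1, 0, q - 1, w + 1, 0))"

fun ascend :: "band_data \<Rightarrow> band_data" where
  "ascend (p,x,y,q,z,w) =
    (if 0 < w then if 0 < y then (p, x + 1, y - 1, q, z + 1, w - 1) else (p + 1, 1, x - 1, q, z + 1, w - 1)
     else if 0 < y then if p = q + 2 then (p + 1, 1, x - 1, q + 1, y + 1, z - 1)
       else (p, x + 1, y - 1, q + 1, 1, z - 1)
     else (p + 1, 1, x - 1, q + 1, 1, z - 1))"

text \<open>Fits the case without regrouping, where the third candidate grows by 1 if p = q + 2 and
  is 0 before and after otherwise.\<close>

lemma max_eqI3: "a' = Suc a \<Longrightarrow> b' = Suc b \<Longrightarrow> (c' = Suc c \<or> (c \<le> max a b \<and> c' \<le> max a' b')) \<Longrightarrow>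
  max (max a' b') c' = Suc (max (max a b) (c :: nat))"
  by linarith

lemma ascend_chain:
  assumes ok: "two_band_ok p x y q z w" and a: "ascend (p,x,y,q,z,w) = (p',x',y',q',z',w')"
  shows "max_chain p' x' y' q' z' w' = Suc (max_chain p x y q z w)"
    "sum_list (two_band p' x' y' q' z' w') = Suc (Suc (sum_list (two_band p x y q z w)))"
    "two_band_ok p' x' y' q' z' w'" "2 \<le> q'" "x' + y' + z' + w' = x + y + z + w"
proof -
  have b: "0 < x" "0 < z" "0 < q" "q + 2 \<le> p" "q = 1 \<longrightarrow> w = 0" using ok by (auto simp: two_band_ok_def)
  obtain q0 where q0: "q = Suc q0" using b(3) by (cases q) auto
  obtain x0 where x0: "x = Suc x0" using b(1) by (cases x) auto
  obtain z0 where z0: "z = Suc z0" using b(2) by (cases z) auto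
  define g where "g = p - q0 - 3"
  have g: "p = q0 + g + 3" using b(4) q0 unfolding g_def by linarith
  consider (1) w0 y0 where "w = Suc w0" "y = Suc y0" | (2) w0 where "w = Suc w0" "y = 0"
    | (3) y0 where "w = 0" "y = Suc y0" "g = 0" | (4) y0 g0 where "w = 0" "y = Suc y0" "g = Suc g0" | (5) "w = 0" "y = 0"
    by (cases w; cases y; cases g) blast+
  note cs = this
  show "max_chain p' x' y' q' z' w' = Suc (max_chain p x y q z w)"
    using cs
  proof cases
    case 1
    show ?thesis using a 1 unfolding q0 x0 z0 g
      by (auto simp: max_chain_def algebra_simps intro!: max_eqI3 split: if_splits)
  next
    case 2
    show ?thesis using a 2 unfolding q0 x0 z0 g
      by (auto simp: max_chain_def algebra_simps)
  next
    case 3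
    \<comment> \<open>Regrouping permutes the candidates: the new second is the old third plus 1,
      and the new third is the old first plus 1. The new first and the old second are
      dominated.\<close>
    show ?thesis using a 3 unfolding q0 x0 z0 g
      by (auto simp: max_chain_def algebra_simps max_def)
  next
    case 4
    show ?thesis using a 4 unfolding q0 x0 z0 g
      by (auto simp: max_chain_def algebra_simps max_def)
  next
    case 5
    show ?thesis using a 5 unfolding q0 x0 z0 g
      by (auto simp: max_chain_def algebra_simps max_def)
  qed
  show "sum_list (two_band p' x' y' q' z' w') = Suc (Suc (sum_list (two_band p x y q z w)))"
    using cs a unfolding q0 x0 z0 g two_band_sum by cases (auto simp: algebra_simps)
  show "two_band_ok p' x' y' q' z' w'" "2 \<le> q'"
    using a b unfolding two_band_ok_def by (auto split: if_splits)
  show "x' + y' + z' + w' = x + y + z + w"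
    using a b by (auto split: if_splits)
qed

lemma descend_ascend:
  assumes "two_band_ok p x y q z w"
  shows "descend (ascend (p,x,y,q,z,w)) = (p,x,y,q,z,w)"
  using assms by (auto simp: two_band_ok_def)

text \<open>\<open>2 \<le> q\<close> keeps positive the part of the lower band that
  \<open>descend\<close> decreases.\<close>

lemma ascend_descend:
  assumes "two_band_ok p x y q z w" "2 \<le> q"
  shows "ascend (descend (p,x,y,q,z,w)) = (p,x,y,q,z,w)"
    "descend (p,x,y,q,z,w) = (p',x',y',q',z',w') \<Longrightarrow> two_band_ok p' x' y' q' z' w'"
  using assms by (auto simp: two_band_ok_def split: if_splits)

lemma ascend_bij:
  "bij_betw ascend (fibre u v) {(p,x,y,q,z,w). (p,x,y,q,z,w) \<in> fibre (Suc u) (Suc v) \<and> 2 \<le> q}"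
proof (rule bij_betw_byWitness[where f' = descend])
  show "\<forall>t\<in>fibre u v. descend (ascend t) = t"
    unfolding fibre_def using descend_ascend by blast
  show "\<forall>t\<in>{(p,x,y,q,z,w). (p,x,y,q,z,w) \<in> fibre (Suc u) (Suc v) \<and> 2 \<le> q}. ascend (descend t) = t"
    unfolding fibre_def using ascend_descend(1) by blast
  show "ascend ` fibre u v \<subseteq> {(p,x,y,q,z,w). (p,x,y,q,z,w) \<in> fibre (Suc u) (Suc v) \<and> 2 \<le> q}"
  proof (rule image_subsetI)
    fix t assume "t \<in> fibre u v"
    then obtain p x y q z w where t: "t = (p,x,y,q,z,w)" "two_band_ok p x y q z w" "max_chain p x y q z w = u"
      "sum_list (two_band p x y q z w) = u + v" unfolding fibre_def by blast
    obtain p' x' y' q' z' w' where a: "ascend t = (p',x',y',q',z',w')" by (metis prod_cases6)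
    from ascend_chain[OF t(2) a[unfolded t(1)]] t
    show "ascend t \<in> {(p,x,y,q,z,w). (p,x,y,q,z,w) \<in> fibre (Suc u) (Suc v) \<and> 2 \<le> q}"
      unfolding a fibre_def by simp
  qed
  show "descend ` {(p,x,y,q,z,w). (p,x,y,q,z,w) \<in> fibre (Suc u) (Suc v) \<and> 2 \<le> q} \<subseteq> fibre u v"
  proof (rule image_subsetI)
    fix t assume "t \<in> {(p,x,y,q,z,w). (p,x,y,q,z,w) \<in> fibre (Suc u) (Suc v) \<and> 2 \<le> q}"
    then obtain p x y q z w where t: "t = (p,x,y,q,z,w)" "two_band_ok p x y q z w" "max_chain p x y q z w = Suc u"
      "sum_list (two_band p x y q z w) = Suc u + Suc v" "2 \<le> q" unfolding fibre_def by blast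
    obtain p' x' y' q' z' w' where a: "descend t = (p',x',y',q',z',w')" by (metis prod_cases6)
    have ok': "two_band_ok p' x' y' q' z' w'" by (rule ascend_descend(2)[OF t(2,5) a[unfolded t(1)]])
    have "ascend (p',x',y',q',z',w') = (p,x,y,q,z,w)" using ascend_descend(1)[OF t(2,5)] a t(1) by simp
    from ascend_chain(1,2)[OF ok' this] t(3,4) ok' show "descend t \<in> fibre u v"
      unfolding a fibre_def by simp
  qed
qed

lemma parts_ascend: "t \<in> fibre u v \<Longrightarrow> parts (ascend t) = parts t"
proof -
  assume "t \<in> fibre u v"
  then obtain p x y q z w where t: "t = (p,x,y,q,z,w)" "two_band_ok p x y q z w" unfolding fibre_def by blast
  obtain p' x' y' q' z' w' where a: "ascend t = (p',x',y',q',z',w')" by (metis prod_cases6)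
  have "parts (ascend t) = x' + y' + z' + w'" unfolding a by simp
  also have "\<dots> = parts t" using ascend_chain(5)[OF t(2) a[unfolded t(1)]] by (simp add: t(1))
  finally show ?thesis .
qed

section \<open>Members of the fibre whose lower band consists of ones\<close>

text \<open>The almost rectangular partition of \<open>N\<close> into \<open>l\<close> parts, followed by \<open>z\<close> ones.\<close>

definition with_ones :: "nat \<Rightarrow> nat \<Rightarrow> nat \<Rightarrow> band_data" where
  "with_ones N l z = ((N - 1) div l + 1, (N - 1) mod l + 1, l - 1 - (N - 1) mod l, 1, z, 0)"

text \<open>There are two ways to reach maximal chain length u with size u + v. Either the upper
  band has size u, with v ones and k parts above them, which needs v + 2 k \<le> u; or the chain
  uses the z ones and l larger parts, so z + 2 l = u, the upper band has size v + 2 l, and l + z = v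
  + k forces l = u - v - k.\<close>

definition unit_member :: "nat \<Rightarrow> nat \<Rightarrow> nat \<Rightarrow> band_data" where
  "unit_member u v k = (if 2 * k \<le> u - v then with_ones u k v
     else with_ones (v + 2 * (u - v - k)) (u - v - k) (u - 2 * (u - v - k)))"

text \<open>For q = 1 the third candidate arises only if p = 3, and it then equals the
  second.\<close>

lemma max_chain_unit: "two_band_ok p x y 1 z 0 \<Longrightarrow> max_chain p x y 1 z 0 = max (p * x + (p - 1) * y) (z + 2 * (x + y))"
  by (auto simp: max_chain_def two_band_ok_def)

text \<open>N = (p - 1) l + x with 1 \<le> x \<le> l is division with remainder of N - 1 by l. The
  bound \<open>2 * l < N\<close> yields p \<ge> 3, the required gap to the ones.\<close>

lemma with_ones_props:
  assumes "0 < l" "2 * l < N" "0 < z"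
  shows "\<exists>p x y. with_ones N l z = (p,x,y,1,z,0) \<and> two_band_ok p x y 1 z 0 \<and> p * x + (p - 1) * y = N \<and> x + y = l"
proof -
  define p x y where "p = (N - 1) div l + 1" and "x = (N - 1) mod l + 1" and "y = l - 1 - (N - 1) mod l"
  have m: "(N - 1) mod l < l" using assms by simp
  have xy: "x + y = l" using m by (simp add: x_def y_def)
  have "2 * l \<le> N - 1" using assms by simp
  hence "2 \<le> (N - 1) div l" using assms(1) by (simp add: less_eq_div_iff_mult_less_eq)
  hence p3: "3 \<le> p" by (simp add: p_def)
  have "p * x + (p - 1) * y = (p - 1) * (x + y) + x" using p3 by (cases p) (auto simp: algebra_simps)
  also have "\<dots> = (N - 1) div l * l + (N - 1) mod l + 1" unfolding xy by (simp add: p_def x_def)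
  also have "\<dots> = N" using assms by simp
  finally have "p * x + (p - 1) * y = N" .
  moreover have "two_band_ok p x y 1 z 0" using p3 assms by (simp add: two_band_ok_def x_def)
  ultimately show ?thesis using xy unfolding with_ones_def p_def[symmetric] x_def[symmetric] y_def[symmetric] by blast
qed

lemma with_ones_eq:
  assumes "two_band_ok p x y 1 z 0"
  shows "(p,x,y,1,z,0) = with_ones (p * x + (p - 1) * y) (x + y) z"
proof -
  have b: "0 < x" "3 \<le> p" using assms by (auto simp: two_band_ok_def)
  have e: "p * x + (p - 1) * y - 1 = (p - 1) * (x + y) + (x - 1)" using b by (cases p; cases x) (auto simp: algebra_simps)
  have l: "0 < x + y" "x - 1 < x + y" using b by linarith+
  have d: "(p * x + (p - 1) * y - 1) div (x + y) = p - 1" "(p * x + (p - 1) * y - 1) mod (x + y) = x - 1"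
    unfolding e using div_mod_sum[OF l, of "p - 1"] by blast+
  have "p - 1 + 1 = p" "x - 1 + 1 = x" "x + y - 1 - (x - 1) = y" using b by linarith+
  thus ?thesis unfolding with_ones_def d by (simp only:)
qed

lemma unit_member_bij:
  assumes v: "0 < v" and r: "v + 2 \<le> u"
  shows "bij_betw (unit_member u v) {1..u - v - 1} {(p,x,y,q,z,w). (p,x,y,q,z,w) \<in> fibre u v \<and> \<not> 2 \<le> q}"
    "\<And>k. k \<in> {1..u - v - 1} \<Longrightarrow> parts (unit_member u v k) = v + k"
proof -
  let ?U = "{(p,x,y,q,z,w). (p,x,y,q,z,w) \<in> fibre u v \<and> \<not> 2 \<le> q}"
  have mem: "unit_member u v k \<in> ?U \<and> parts (unit_member u v k) = v + k" if k: "k \<in> {1..u - v - 1}" for k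
  proof (cases "2 * k \<le> u - v")
    case True
    from with_ones_props[of k u v] True k v r obtain p x y where 1: "with_ones u k v = (p,x,y,1,v,0)"
      "two_band_ok p x y 1 v 0" "p * x + (p - 1) * y = u" "x + y = k" by force
    have "max_chain p x y 1 v 0 = u" unfolding max_chain_unit[OF 1(2)] using 1 True r by simp
    moreover have "sum_list (two_band p x y 1 v 0) = u + v" unfolding two_band_sum using 1(3) by simp
    ultimately show ?thesis using True 1 by (simp add: unit_member_def fibre_def)
  next
    case False
    define l where "l = u - v - k"
    have l: "0 < l" "v + 2 * l < u" "k = u - v - l" using False k by (auto simp: l_def)
    from with_ones_props[of l "v + 2 * l" "u - 2 * l"] l v obtain p x y where 1: "with_ones (v + 2 * l) l (u - 2 * l) = (p,x,y,1,u - 2 * l,0)"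
      "two_band_ok p x y 1 (u - 2 * l) 0" "p * x + (p - 1) * y = v + 2 * l" "x + y = l" by force
    have "max_chain p x y 1 (u - 2 * l) 0 = u" unfolding max_chain_unit[OF 1(2)] using 1 l by simp
    moreover have "sum_list (two_band p x y 1 (u - 2 * l) 0) = u + v" unfolding two_band_sum using 1(3) l by simp
    moreover have "unit_member u v k = (p,x,y,1,u - 2 * l,0)" using False 1(1) by (simp add: unit_member_def l_def)
    ultimately show ?thesis using 1 l by (simp add: fibre_def)
  qed
  show "parts (unit_member u v k) = v + k" if "k \<in> {1..u - v - 1}" for k using mem[OF that] by blast
  have inverse: "parts t - v \<in> {1..u - v - 1} \<and> unit_member u v (parts t - v) = t" if tU: "t \<in> ?U" for t
  proof -
    from tU obtain p x y q z w where t: "t = (p,x,y,q,z,w)" "two_band_ok p x y q z w" "max_chain p x y q z w = u"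
      "sum_list (two_band p x y q z w) = u + v" "\<not> 2 \<le> q" unfolding fibre_def by blast
    have q1: "q = 1" "w = 0" using t(2,5) by (auto simp: two_band_ok_def)
    have b: "0 < x" "0 < z" "3 \<le> p" using t(2) q1 by (auto simp: two_band_ok_def)
    define N l where "N = p * x + (p - 1) * y" and "l = x + y"
    have eq: "t = with_ones N l z" unfolding t(1) q1 N_def l_def by (rule with_ones_eq[OF t(2)[unfolded q1]])
    have sum: "N + z = u + v" using t(4) unfolding two_band_sum N_def q1 by simp
    have mx: "max N (z + 2 * l) = u" using t(3) max_chain_unit[OF t(2)[unfolded q1]] unfolding N_def l_def q1 by simp
    have pt: "parts t = l + z" unfolding t(1) q1 l_def by simp
    have l0: "0 < l" using b by (simp add: l_def)
    show ?thesis
    \<comment> \<open>The candidate attaining the maximum decides the regime. If both equal u, then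
      2 l = u - v, and the first regime applies, in accordance with the test in
      \<open>unit_member\<close>.\<close>
    proof (cases "N = u")
      case True
      hence "z = v" "2 * l \<le> u - v" using sum mx by auto
      thus ?thesis using True pt l0 eq r by (auto simp: unit_member_def)
    next
      case False
      hence z: "z + 2 * l = u" "N < u" using mx by (auto simp: max_def split: if_splits)
      hence N: "N = v + 2 * l" using sum by simp
      have k: "parts t - v = u - v - l" using pt z N by simp
      have "\<not> 2 * (u - v - l) \<le> u - v" using z N by simp
      moreover have "u - v - (u - v - l) = l" using z N by simp
      ultimately have "unit_member u v (parts t - v) = with_ones (v + 2 * l) l (u - 2 * l)"
        unfolding k unit_member_def by simp
      thus ?thesis using eq N z k l0 by auto
    qed
  qed
  show "bij_betw (unit_member u v) {1..u - v - 1} ?U"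
  proof (rule bij_betw_byWitness[where f' = "\<lambda>t. parts t - v"])
    show "\<forall>k\<in>{1..u - v - 1}. parts (unit_member u v k) - v = k"
      using conjunct2[OF mem] by (metis add_diff_cancel_left')
    show "\<forall>t\<in>?U. unit_member u v (parts t - v) = t"
      by (rule ballI) (rule conjunct2[OF inverse])
    show "unit_member u v ` {1..u - v - 1} \<subseteq> ?U"
      by (rule image_subsetI) (rule conjunct1[OF mem])
    show "(\<lambda>t. parts t - v) ` ?U \<subseteq> {1..u - v - 1}"
      by (rule image_subsetI) (rule conjunct1[OF inverse])
  qed
qed

text \<open>Induction on \<open>v\<close> with r fixed. Columns up to \<open>v\<close> are carried
  over by \<open>ascend\<close>, which keeps the number of parts, and column v + 1 holds the r - 1
  new members. The fibre for v = 0 is empty because a chain never exhausts the basis.\<close>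

lemma fibre_table:
  assumes r: "2 \<le> r"
  shows "\<exists>Pf. bij_betw (\<lambda>(k,l). Pf k l) ({1..r - 1} \<times> {1..v}) (fibre (v + r) v) \<and>
    (\<forall>k\<in>{1..r - 1}. \<forall>l\<in>{1..v}. parts (Pf k l) = k + l)"
proof (induction v)
  case 0
  have "t \<notin> fibre (0 + r) 0" for t
    using max_chain_less(1) unfolding fibre_def by fastforce
  hence "fibre (0 + r) 0 = {}" by blast
  then show ?case by (auto simp: bij_betw_def)
next
  case (Suc v)
  then obtain Pf where Pf: "bij_betw (\<lambda>(k,l). Pf k l) ({1..r - 1} \<times> {1..v}) (fibre (v + r) v)"
    "\<And>k l. k \<in> {1..r - 1} \<Longrightarrow> l \<in> {1..v} \<Longrightarrow> parts (Pf k l) = k + l" by blast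
  let ?u = "Suc v + r"
  let ?A = "{(p,x,y,q,z,w). (p,x,y,q,z,w) \<in> fibre ?u (Suc v) \<and> 2 \<le> q}"
  let ?B = "{(p,x,y,q,z,w). (p,x,y,q,z,w) \<in> fibre ?u (Suc v) \<and> \<not> 2 \<le> q}"
  have AB: "fibre ?u (Suc v) = ?A \<union> ?B" "?A \<inter> ?B = {}" by auto
  define Pg where "Pg k l = (if l = Suc v then unit_member ?u (Suc v) k else ascend (Pf k l))" for k l
  have rk: "?u - Suc v - 1 = r - 1" by simp
  note un = unit_member_bij[of "Suc v" ?u, unfolded rk]
  have 1: "bij_betw (ascend \<circ> (\<lambda>(k,l). Pf k l)) ({1..r - 1} \<times> {1..v}) ?A"
    using bij_betw_trans[OF Pf(1) ascend_bij] by simp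
  have b1: "bij_betw (\<lambda>(k,l). Pg k l) ({1..r - 1} \<times> {1..v}) ?A"
    by (rule iffD1[OF bij_betw_cong 1]) (auto simp: Pg_def)
  have b2: "bij_betw (\<lambda>(k,l). Pg k l) ({1..r - 1} \<times> {Suc v}) ?B"
  proof -
    have f: "bij_betw fst ({1..r - 1} \<times> {Suc v}) {1..r - 1}"
      by (rule bij_betw_byWitness[where f' = "\<lambda>k. (k, Suc v)"]) auto
    have "bij_betw (unit_member ?u (Suc v) \<circ> fst) ({1..r - 1} \<times> {Suc v}) ?B"
      by (rule bij_betw_trans[OF f un(1)]) (use r in auto)
    thus ?thesis by (rule iffD1[OF bij_betw_cong, rotated]) (auto simp: Pg_def)
  qed
  have dom: "{1..r - 1} \<times> {1..Suc v} = {1..r - 1} \<times> {1..v} \<union> {1..r - 1} \<times> {Suc v}" by auto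
  have "bij_betw (\<lambda>(k,l). Pg k l) ({1..r - 1} \<times> {1..Suc v}) (fibre ?u (Suc v))"
    using bij_betw_combine[OF b1 b2 AB(2)] unfolding dom AB(1)[symmetric] .
  moreover have "parts (Pg k l) = k + l" if k: "k \<in> {1..r - 1}" and l: "l \<in> {1..Suc v}" for k l
  proof (cases "l = Suc v")
    case True
    then show ?thesis using un(2)[OF _ _ k] r by (simp add: Pg_def)
  next
    case False
    hence l': "l \<in> {1..v}" using l by auto
    have "Pf k l \<in> fibre (v + r) v" using bij_betw_apply[OF Pf(1), of "(k,l)"] k l' by simp
    then show ?thesis using parts_ascend Pf(2)[OF k l'] False by (simp add: Pg_def)
  qed
  ultimately show ?case by blast
qed

text \<open>The data can be read off the list: \<open>p\<close> is its head, \<open>q\<close> the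
  head of the parts at most p - 2, and the other four are multiplicities.\<close>

lemma two_band_inj:
  assumes 1: "two_band_ok p x y q z w" and 2: "two_band_ok p' x' y' q' z' w'"
    and eq: "two_band p x y q z w = two_band p' x' y' q' z' w'"
  shows "(p,x,y,q,z,w) = (p',x',y',q',z',w')"
proof -
  have hd: "hd (two_band p x y q z w) = p" if "two_band_ok p x y q z w" for p x y q z w
    using that by (cases x) (auto simp: two_band_ok_def two_band_def)
  have cx: "length (filter (\<lambda>t. t = p) (two_band p x y q z w)) = x"
    "length (filter (\<lambda>t. t + 1 = p) (two_band p x y q z w)) = y"
    "hd (filter (\<lambda>t. t + 2 \<le> p) (two_band p x y q z w)) = q"
    "length (filter (\<lambda>t. t + 2 \<le> p \<and> t = q) (two_band p x y q z w)) = z"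
    "length (filter (\<lambda>t. t + 1 = q) (two_band p x y q z w)) = w"
    if "two_band_ok p x y q z w" for p x y q z w
    using that by (cases z; auto simp: two_band_ok_def two_band_def)+
  have p: "p = p'" using hd[OF 1] hd[OF 2] eq by simp
  have x: "x = x'" "y = y'" "q = q'" using cx(1-3)[OF 1] cx(1-3)[OF 2] eq p by simp_all
  have "z = z'" "w = w'" using cx(4,5)[OF 1] cx(4,5)[OF 2] eq p x(3) by simp_all
  thus ?thesis using p x by simp
qed

theorem theorem1p1:
  fixes u r :: nat
  assumes "infinite (UNIV :: 'k::field set)"
    and "u > r" and "r \<ge> 2"
  shows "card (frakQ_inv TYPE('k) [u, u - r]) = (r - 1) * (u - r) \<and>
    (\<exists>P :: nat \<Rightarrow> nat \<Rightarrow> nat list.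
      bij_betw (\<lambda>(k, l). P k l) ({1..r - 1} \<times> {1..u - r}) (frakQ_inv TYPE('k) [u, u - r]) \<and>
      (\<forall>k\<in>{1..r - 1}. \<forall>l\<in>{1..u - r}. length (P k l) = k + l))"
proof -
  define v where "v = u - r"
  have u: "u = v + r" "0 < v" "0 < u" using assms by (auto simp: v_def)
  define tb where "tb = (\<lambda>(p,x,y,q,z,w). two_band p x y q z w)"
  obtain Pf where Pf: "bij_betw (\<lambda>(k,l). Pf k l) ({1..r - 1} \<times> {1..v}) (fibre u v)"
    "\<And>k l. k \<in> {1..r - 1} \<Longrightarrow> l \<in> {1..v} \<Longrightarrow> parts (Pf k l) = k + l"
    using fibre_table[OF assms(3), of v] unfolding u(1) by blast
  have "frakQ_inv TYPE('k) [u, v] = tb ` fibre u v"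
    unfolding frakQ_inv_eq[OF assms(1) u(3,2)] fibre_def tb_def ..
  moreover have "inj_on tb (fibre u v)"
  proof (rule inj_onI)
    fix s t assume s: "s \<in> fibre u v" and t: "t \<in> fibre u v" and eq: "tb s = tb t"
    obtain p x y q z w where s': "s = (p,x,y,q,z,w)" "two_band_ok p x y q z w" using s unfolding fibre_def by blast
    obtain p' x' y' q' z' w' where t': "t = (p',x',y',q',z',w')" "two_band_ok p' x' y' q' z' w'"
      using t unfolding fibre_def by blast
    show "s = t" unfolding s'(1) t'(1) by (rule two_band_inj[OF s'(2) t'(2)]) (use eq s' t' in \<open>simp add: tb_def\<close>)
  qed
  ultimately have "bij_betw tb (fibre u v) (frakQ_inv TYPE('k) [u, v])" by (simp add: bij_betw_def)
  from bij_betw_trans[OF Pf(1) this]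
  have bij: "bij_betw (\<lambda>(k, l). tb (Pf k l)) ({1..r - 1} \<times> {1..v}) (frakQ_inv TYPE('k) [u, v])"
    by (simp add: comp_def case_prod_unfold)
  have len: "length (tb t) = parts t" for t
    by (cases t rule: prod_cases6) (simp add: tb_def two_band_length)
  have "card (frakQ_inv TYPE('k) [u, v]) = card ({1..r - 1} \<times> {1..v})"
    by (rule bij_betw_same_card[OF bij, symmetric])
  also have "\<dots> = (r - 1) * v" by (simp add: card_cartesian_product)
  finally have card: "card (frakQ_inv TYPE('k) [u, v]) = (r - 1) * v" .
  have "\<forall>k\<in>{1..r - 1}. \<forall>l\<in>{1..v}. length (tb (Pf k l)) = k + l"
    by (intro ballI) (simp only: len Pf(2))
  with bij card show ?thesis unfolding v_def[symmetric]
    by (intro conjI exI[of _ "\<lambda>k l. tb (Pf k l)"])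
qed

end
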